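(* Let $G\subset\mathbb{C}$ be a simply connected domain, let $\mathcal{S}\subset G$ be a smooth Jordan curve with bounded face $D$, let $\Gamma\subset\mathbb{C}$ be a smooth Jordan curve with bounded face $\Omega_-$ and unbounded face $\Omega_+$ (with $\infty\in\Omega_+$), and let $f:G\to\hat{\mathbb{C}}$ be meromorphic. The following are equivalent. <ol> <li>$\mathcal{S}$ is a $\Gamma$-pseudo-lemniscate of $f$ in $G$.</li> <li>There are non-negative integers $n_-$ and $n_+$ such that: $\mathcal{N}_f(w)=n_-$ for every $w\in\Omega_-$; $\mathcal{N}_f(w)=n_+$ for every $w\in\Omega_+$; and $\mathcal{N}_f(w)=\min(n_-,n_+)$ for every $w\in\Gamma$.</li> </ol> Moreover: (a) If items 1 and 2 hold and $f$ is analytic (pole-free) in $D$, then $n_+=0$, and for any Riemann maps $\phi:\mathbb{D}\to D$ and $\psi:\mathbb{D}\to\Omega_-$, the function $\psi^{-1}\circ f\circ\phi$ is a Blaschke product of degree $n_-$. (b) If items 1 and 2 hold and $\Gamma=\mathbb{T}$ (the unit circle), then for any Riemann map $\phi:\mathbb{D}\to D$, $f\circ\phi=A/B$ where $A$ is a Blaschke product of degree $n_-$ and $B$ is a Blaschke product of degree $n_+$.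
   Context: $\mathbb{D}$ is the open unit disk, $\mathbb{T}$ its boundary circle, $\hat{\mathbb{C}}$ the Riemann sphere. A Blaschke product of degree $n$ is a function of the form $\lambda\prod_{j=1}^n\frac{z-a_j}{1-\overline{a_j}z}$ with $|\lambda|=1$ and $a_j\in\mathbb{D}$ (degree $0$ meaning a unimodular constant). For a meromorphic $f:G\to\hat{\mathbb{C}}$ and a smooth Jordan curve $\Gamma\subset\mathbb{C}$, a connected component of $f^{-1}(\Gamma)$ (in $G$) is called a $\Gamma$-pseudo-lemniscate of $f$. For $w\in\hat{\mathbb{C}}$, $\mathcal{N}_f(w)$ denotes the number of preimages of $w$ under $f$ lying in $D$ (the bounded face of $\mathcal{S}$), counted with multiplicity (for $w=\infty$ these are the poles of $f$ in $D$ counted with order). *)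

theory Defs
  imports "HOL-Analysis.Analysis" "HOL-Library.Extended_Nat"
begin

definition smooth_jordan_curve :: "complex set \<Rightarrow> bool" where
  "smooth_jordan_curve S \<longleftrightarrow>
     (\<exists>g :: real \<Rightarrow> complex. \<exists>Dg :: nat \<Rightarrow> real \<Rightarrow> complex.
        (\<forall>t. g (t + 1) = g t) \<and> inj_on g {0..<1} \<and> g ` {0..1} = S \<and>
        Dg 0 = g \<and>
        (\<forall>k t. (Dg k has_vector_derivative Dg (Suc k) t) (at t)) \<and>
        (\<forall>t. Dg 1 t \<noteq> 0))"

text \<open>Meromorphic function on an open set G: f is holomorphic on G minus a set P
  of poles with no accumulation point in G; at each point of P, f tends to infinity.
  (Values of f at points of P are irrelevant; they represent the value infinity.)\<close>
definition meromorphic_with_poles :: "(complex \<Rightarrow> complex) \<Rightarrow> complex set \<Rightarrow> complex set \<Rightarrow> bool" where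
  "meromorphic_with_poles f G P \<longleftrightarrow>
     open G \<and> P \<subseteq> G \<and> (\<forall>z\<in>G. \<not> z islimpt P) \<and> f holomorphic_on (G - P) \<and>
     (\<forall>p\<in>P. filterlim f at_infinity (at p))"

text \<open>Multiplicity of z0 as a zero of g (0 if g z0 \<noteq> 0, infinity if g vanishes identically near z0).\<close>
definition zero_mult :: "(complex \<Rightarrow> complex) \<Rightarrow> complex \<Rightarrow> enat" where
  "zero_mult g z0 =
     (if \<exists>n h r. r > 0 \<and> h holomorphic_on ball z0 r \<and> h z0 \<noteq> 0 \<and>
                 (\<forall>z\<in>ball z0 r. g z = (z - z0) ^ n * h z)
      then enat (LEAST n. \<exists>h r. r > 0 \<and> h holomorphic_on ball z0 r \<and> h z0 \<noteq> 0 \<and>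
                 (\<forall>z\<in>ball z0 r. g z = (z - z0) ^ n * h z))
      else \<infinity>)"

definition pole_mult :: "(complex \<Rightarrow> complex) \<Rightarrow> complex \<Rightarrow> enat" where
  "pole_mult f p =
     (if \<exists>n h r. r > 0 \<and> h holomorphic_on ball p r \<and> h p \<noteq> 0 \<and>
                 (\<forall>z\<in>ball p r - {p}. f z = h z / (z - p) ^ n)
      then enat (LEAST n. \<exists>h r. r > 0 \<and> h holomorphic_on ball p r \<and> h p \<noteq> 0 \<and>
                 (\<forall>z\<in>ball p r - {p}. f z = h z / (z - p) ^ n))
      else \<infinity>)"

definition count_preimages :: "(complex \<Rightarrow> complex) \<Rightarrow> complex set \<Rightarrow> complex set \<Rightarrow> complex \<Rightarrow> enat" where
  "count_preimages f P D w =
     (let Z = {z \<in> D - P. f z = w} in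
      if finite Z then (\<Sum>z\<in>Z. zero_mult (\<lambda>x. f x - w) z) else \<infinity>)"

definition count_poles :: "(complex \<Rightarrow> complex) \<Rightarrow> complex set \<Rightarrow> complex set \<Rightarrow> enat" where
  "count_poles f P D =
     (if finite (P \<inter> D) then (\<Sum>p\<in>P \<inter> D. pole_mult f p) else \<infinity>)"

definition pseudo_lemniscate :: "(complex \<Rightarrow> complex) \<Rightarrow> complex set \<Rightarrow> complex set \<Rightarrow> complex set \<Rightarrow> complex set \<Rightarrow> bool" where
  "pseudo_lemniscate f G P \<Gamma> S \<longleftrightarrow> S \<in> components {z \<in> G - P. f z \<in> \<Gamma>}"

definition blaschke_product :: "nat \<Rightarrow> (complex \<Rightarrow> complex) \<Rightarrow> bool" where
  "blaschke_product n B \<longleftrightarrow>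
     (\<exists>c (a :: nat \<Rightarrow> complex). norm c = 1 \<and> (\<forall>j<n. norm (a j) < 1) \<and>
        (\<forall>z\<in>ball 0 1. B z = c * (\<Prod>j<n. (z - a j) / (1 - cnj (a j) * z))))"

definition riemann_map :: "(complex \<Rightarrow> complex) \<Rightarrow> complex set \<Rightarrow> bool" where
  "riemann_map \<phi> D \<longleftrightarrow> \<phi> holomorphic_on ball 0 1 \<and> bij_betw \<phi> (ball 0 1) D"

end

theory Submission
  imports Defs "HOL-Complex_Analysis.Complex_Analysis"
begin

text \<open>
  Write \<open>D\<close> for the inside of \<open>S\<close>. The number \<open>N(w)\<close> of preimages of \<open>w\<close> in \<open>D\<close> is lower
  semicontinuous on the sphere, and its excess near \<open>w\<close> counts the preimages that enter
  \<open>D\<close> through \<open>S\<close>.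

  If \<open>S\<close> is a component of the preimage of \<open>\<Gamma>\<close>, then \<open>f\<close> has no critical point on \<open>S\<close>, since otherwise
  more than two arcs of the preimage would meet there. So \<open>f\<close> maps a collar of \<open>S\<close> in \<open>D\<close> to one side
  of \<open>\<Gamma>\<close>; no preimages are lost or gained when \<open>w\<close> moves within a face of \<open>\<Gamma>\<close> or tends
  to \<open>\<Gamma>\<close> from the other side. Conversely, if \<open>N\<close> has the stated values, it does not jump at
  values off \<open>\<Gamma>\<close>, hence \<open>f\<close> maps \<open>S\<close> into \<open>\<Gamma>\<close>, and points of \<open>D\<close> near \<open>S\<close> go to the face where
  \<open>N\<close> is larger. By smoothness the half disk on the inner side of \<open>S\<close> has angle \<open>\<pi>\<close>, so \<open>f\<close> is again
  locally injective along \<open>S\<close>, and \<open>S\<close> is open and closed in the preimage of \<open>\<Gamma>\<close>.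

  For the two factorizations, the function transported to the unit disk has modulus tending to 1 at the
  unit circle; dividing by the Blaschke products of its zeros and poles leaves a unimodular constant.
\<close>

subsection \<open>Smooth Jordan curves\<close>

text \<open>\<open>N\<close> sees only \<open>inside S\<close>, while being a component concerns
  both sides of \<open>S\<close>, so counts alone cannot isolate \<open>S\<close> in the preimage of
  \<open>\<Gamma>\<close>. The bridge is \<open>deriv f z \<noteq> 0\<close> along \<open>S\<close>:
  local injectivity then also controls the outer side. The two directions must reach it differently.
  From the counts one learns into which face the inner side of \<open>S\<close> goes. From a
  component no face is known beforehand, and the contradiction comes from tangents: arcs lifted at a
  point of multiplicity n leave in directions differing by the angle pi/n, all of them lie in
  \<open>S\<close>, and \<open>S\<close> has a single tangent line. In both cases smoothness is used
  through one fact, a chart whose derivative at the base point is multiplication by a complex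
  number. Infinity is handled as the filter \<open>at_infinity\<close>. The counting lemma is
  therefore stated for an arbitrary filter, and poles enter it through the zeros of 1/f. Orders are
  meaningless for constant functions, so these are excluded beforehand, for a different reason in
  each direction.\<close>

lemma smooth_jordan_curve_param:
  assumes "smooth_jordan_curve S"
  obtains g g' where "\<And>s t::real. g s = g t \<longleftrightarrow> s - t \<in> \<int>" "range g = S"
    "\<And>t. (g has_vector_derivative g' t) (at t)" "continuous_on UNIV g'" "\<And>t. g' t \<noteq> 0"
    "simple_path g" "pathfinish g = pathstart g" "path_image g = S"
proof -
  obtain g and Dg :: "nat \<Rightarrow> real \<Rightarrow> complex" where per: "\<And>t. g (t + 1) = g t" and inj: "inj_on g {0..<1}"
    and im: "g ` {0..1} = S" and D0: "Dg 0 = g"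
    and D: "\<And>k t. (Dg k has_vector_derivative Dg (Suc k) t) (at t)" and nz: "\<And>t. Dg 1 t \<noteq> 0"
    using assms unfolding smooth_jordan_curve_def by metis
  interpret periodic_fun_simple' g by unfold_locales (rule per)
  have frac: "g (frac t) = g t" for t
    using plus_of_int[of "frac t" "\<lfloor>t\<rfloor>"] by (simp add: frac_def)
  have eq: "g s = g t \<longleftrightarrow> s - t \<in> \<int>" for s t
  proof
    assume "g s = g t"
    then have "g (frac s) = g (frac t)" by (simp add: frac)
    then have "frac s = frac t"
      using inj by (auto simp: inj_on_def frac_lt_1)
    then have "s - t = of_int (\<lfloor>s\<rfloor> - \<lfloor>t\<rfloor>)" by (simp add: frac_def)
    then show "s - t \<in> \<int>" by (metis Ints_of_int)
  next
    assume "s - t \<in> \<int>"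
    then obtain k where "s - t = of_int k" by (auto elim: Ints_cases)
    then have "s = t + of_int k" by simp
    then show "g s = g t" using plus_of_int by metis
  qed
  have rg: "range g = S"
  proof -
    have "g t \<in> g ` {0..1}" for t
      using frac[of t] frac_ge_0[of t] frac_lt_1[of t] by (metis atLeastAtMost_iff imageI less_imp_le)
    then show ?thesis using im by auto
  qed
  have d: "(g has_vector_derivative Dg 1 t) (at t)" for t
    using D[of 0 t] D0 by simp
  have cg: "continuous_on A g" for A
    by (meson continuous_at_imp_continuous_on d has_vector_derivative_continuous)
  have cg': "continuous_on UNIV (Dg 1)"
    using D[of 1] by (meson continuous_at_imp_continuous_on has_vector_derivative_continuous)
  have sp: "simple_path g"
    unfolding simple_path_def loop_free_def path_def
  proof (intro conjI ballI impI cg)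
    fix x y :: real assume xy: "x \<in> {0..1}" "y \<in> {0..1}" "g x = g y"
    then obtain k where k: "x - y = of_int k" using eq by (auto elim: Ints_cases)
    then have "k = 0 \<or> k = 1 \<or> k = -1" using xy by auto
    then show "x = y \<or> x = 0 \<and> y = 1 \<or> x = 1 \<and> y = 0" using k xy by auto
  qed
  have "pathfinish g = pathstart g"
    using per[of 0] by (simp add: pathfinish_def pathstart_def)
  then show ?thesis
    using that[OF eq rg d cg' nz sp] im by (simp add: path_image_def)
qed

lemma smooth_jordan_curve_facts:
  assumes "smooth_jordan_curve S"
  shows "compact S" "connected S" "S \<noteq> {}" "inside S \<noteq> {}" "open (inside S)" "connected (inside S)"
    "open (outside S)" "connected (outside S)" "bounded (inside S)"
    "inside S \<inter> outside S = {}" "inside S \<union> outside S = - S"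
    "frontier (inside S) = S" "frontier (outside S) = S"
    "closure (inside S) = inside S \<union> S" "compact (inside S \<union> S)" "inside S \<inter> S = {}"
proof -
  obtain g where g: "simple_path g" "pathfinish g = pathstart g" "path_image g = S"
    using smooth_jordan_curve_param[OF assms] by metis
  show *: "inside S \<noteq> {}" "open (inside S)" "connected (inside S)"
    "open (outside S)" "connected (outside S)" "bounded (inside S)"
    "inside S \<inter> outside S = {}" "inside S \<union> outside S = - S"
    and fr: "frontier (inside S) = S" and "frontier (outside S) = S"
    using Jordan_inside_outside[OF g(1,2)] g(3) by auto
  show "compact S" "connected S" "S \<noteq> {}"
    using g compact_simple_path_image connected_simple_path_image path_image_nonempty by metis+
  show cl: "closure (inside S) = inside S \<union> S"
    using fr by (metis closure_Un_frontier)
  show "compact (inside S \<union> S)"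
    using *(6) by (metis cl compact_closure)
  show "inside S \<inter> S = {}" by (rule inside_no_overlap)
qed

text \<open>\<open>F\<close> moves from \<open>g (t0 + Re z)\<close> along the normal
  \<open>\<i> * c\<close> frozen at the base point. Because it is frozen,
  \<open>Re (F z / c)\<close> depends on \<open>Re z\<close> alone and increases with it, which
  yields injectivity; at 0 the two tangent directions combine to multiplication by
  \<open>c\<close>.\<close>

lemma smooth_jordan_curve_graph:
  assumes "smooth_jordan_curve S" and "z0 \<in> S"
  obtains F r c where "r > 0" "c \<noteq> 0" "F 0 = z0" "continuous_on (ball 0 r) F" "inj_on F (ball 0 r)"
    "(F has_derivative (\<lambda>h. c * h)) (at 0)" "\<And>z. z \<in> ball 0 r \<Longrightarrow> F z \<in> S \<longleftrightarrow> Im z = 0"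
proof -
  obtain g g' where g: "\<And>s t::real. g s = g t \<longleftrightarrow> s - t \<in> \<int>" "range g = S"
    and dg: "\<And>t. (g has_vector_derivative g' t) (at t)" and cg': "continuous_on UNIV g'"
    and nz: "\<And>t. g' t \<noteq> 0" and "simple_path g" "pathfinish g = pathstart g" "path_image g = S"
    by (rule smooth_jordan_curve_param[OF assms(1)], rule that; assumption)
  obtain t0 where t0: "z0 = g t0" using g(2) assms(2) by auto
  define c where "c = g' t0"
  have c0: "c \<noteq> 0" using nz c_def by simp
  define F where "F = (\<lambda>z. g (t0 + Re z) + c * (\<i> * of_real (Im z)))"
  define u where "u = (\<lambda>x. Re (g (t0 + x) / c))"
  have cg: "continuous_on A g" for A
    by (meson continuous_at_imp_continuous_on dg has_vector_derivative_continuous)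
  have du: "(u has_real_derivative Re (g' (t0 + x) / c)) (at x)" for x
  proof -
    have "((\<lambda>x. g (t0 + x)) has_vector_derivative g' (t0 + x)) (at x)"
    proof -
      have "((\<lambda>x. t0 + x) has_vector_derivative 1) (at x)"
        unfolding has_real_derivative_iff_has_vector_derivative[symmetric]
        by (auto intro!: derivative_eq_intros)
      from vector_diff_chain_at[OF this dg[of "t0 + x"]] show ?thesis by (simp add: o_def)
    qed
    then have "((\<lambda>x. g (t0 + x) / c) has_vector_derivative g' (t0 + x) / c) (at x)"
      by (rule has_vector_derivative_divide)
    then show ?thesis
      unfolding u_def has_real_derivative_iff_has_vector_derivative
      using bounded_linear.has_vector_derivative[OF bounded_linear_Re] by blast
  qed
  have "continuous_on UNIV (\<lambda>x. Re (g' (t0 + x) / c))"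
    using c0 by (auto intro!: continuous_intros continuous_on_compose2[OF cg'])
  then have "isCont (\<lambda>x. Re (g' (t0 + x) / c)) 0"
    by (simp add: continuous_on_eq_continuous_at)
  moreover have "Re (g' (t0 + 0) / c) > 0" using c0 by (simp add: c_def)
  ultimately have "eventually (\<lambda>x. Re (g' (t0 + x) / c) > 0) (nhds 0)"
    using tendsto_at_iff_tendsto_nhds[of "\<lambda>x. Re (g' (t0 + x) / c)" 0] order_tendstoD(1)
    unfolding isCont_def by blast
  then obtain d where d: "d > 0" "\<And>x. \<bar>x\<bar> < d \<Longrightarrow> Re (g' (t0 + x) / c) > 0"
    unfolding eventually_nhds_metric by (auto simp: dist_real_def)
  \<comment> \<open>The cap 1/2 is half a period: the window of radius \<open>e\<close> about
    \<open>t0\<close> and the parameters of \<open>K\<close> below together fill one full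
    period.\<close>
  define e where "e = min d (1/2)"
  have e: "e > 0" "e \<le> 1/2" "e \<le> d" using d by (auto simp: e_def)
  have umono: "u x < u y" if "-e < x" "x < y" "y < e" for x y
  proof (rule DERIV_pos_imp_increasing[OF that(2)])
    fix s assume "x \<le> s" "s \<le> y"
    then have "\<bar>s\<bar> < d" using that e by linarith
    then show "\<exists>y. (u has_real_derivative y) (at s) \<and> 0 < y" using du d by blast
  qed
  have uF: "Re (F z / c) = u (Re z)" for z
    using c0 by (simp add: F_def u_def add_divide_distrib)
  have injF: "inj_on F (ball 0 e)"
  proof (rule inj_onI)
    fix x y assume xy: "x \<in> ball 0 e" "y \<in> ball 0 e" "F x = F y"
    have "\<bar>Re x\<bar> < e" "\<bar>Re y\<bar> < e"
      using xy(1,2) abs_Re_le_cmod[of x] abs_Re_le_cmod[of y] by auto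
    moreover have "u (Re x) = u (Re y)" using uF xy(3) by metis
    ultimately have "Re x = Re y"
      using umono[of "Re x" "Re y"] umono[of "Re y" "Re x"] by (cases "Re x" "Re y" rule: linorder_cases) (auto simp: abs_less_iff)
    moreover from this have "Im x = Im y" using xy(3) c0 by (simp add: F_def)
    ultimately show "x = y" by (simp add: complex_eq_iff)
  qed
  have contF: "continuous_on UNIV F"
    unfolding F_def by (intro continuous_intros continuous_on_compose2[OF cg]) auto
  \<comment> \<open>The remaining part of the curve is compact and misses \<open>z0\<close>. Keeping
    the chart away from it prevents a distant strand of \<open>S\<close> from returning into the
    chart.\<close>
  define K where "K = g ` ({t0 - 1/2..t0 - e} \<union> {t0 + e..t0 + 1/2})"
  have "compact K" unfolding K_def by (intro compact_continuous_image cg compact_Un compact_Icc)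
  moreover have "z0 \<notin> K"
  proof
    assume "z0 \<in> K"
    then obtain t where t: "t \<in> {t0 - 1/2..t0 - e} \<union> {t0 + e..t0 + 1/2}" "g t0 = g t"
      unfolding K_def t0 by blast
    have "t - t0 \<in> \<int>" using g(1)[of t t0] t(2) by simp
    then obtain k where k: "t - t0 = of_int k" by (auto elim: Ints_cases)
    have "\<bar>t - t0\<bar> \<le> 1/2" "t \<noteq> t0" using t e by auto
    moreover from this have "\<bar>k\<bar> < 1" unfolding k by linarith
    then have "k = 0" by simp
    ultimately show False using k by simp
  qed
  ultimately have "open (-K)" "z0 \<in> -K" by (auto simp: compact_imp_closed)
  moreover have F0: "F 0 = z0" by (simp add: F_def t0)
  ultimately have "open (F -` (-K))" "0 \<in> F -` (-K)"
    using open_vimage contF by auto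
  then obtain r0 where r0: "r0 > 0" "ball 0 r0 \<subseteq> F -` (-K)" by (meson openE)
  define r where "r = min r0 e"
  have r: "r > 0" "ball 0 r \<subseteq> ball 0 e" "\<And>z. z \<in> ball 0 r \<Longrightarrow> F z \<notin> K"
    using r0 e by (auto simp: r_def)
  have dF: "(F has_derivative (\<lambda>h. c * h)) (at 0)"
  proof -
    have 1: "(g has_derivative (\<lambda>h. h *\<^sub>R c)) (at (t0 + Re 0))"
      using dg[of t0] by (simp add: has_vector_derivative_def c_def)
    have "((\<lambda>z. t0 + Re z) has_derivative Re) (at 0)"
      by (auto intro!: derivative_eq_intros)
    from has_derivative_compose[OF this 1]
    have 2: "((\<lambda>z. g (t0 + Re z)) has_derivative (\<lambda>h. Re h *\<^sub>R c)) (at 0)" .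
    show ?thesis unfolding F_def
      by (rule has_derivative_eq_rhs, (rule derivative_intros 2)+)
         (auto simp: fun_eq_iff complex_eq_iff algebra_simps scaleR_conv_of_real)
  qed
  have S: "F z \<in> S \<longleftrightarrow> Im z = 0" if z: "z \<in> ball 0 r" for z
  proof
    assume "Im z = 0"
    then show "F z \<in> S" using g(2) by (auto simp: F_def)
  next
    assume "F z \<in> S"
    then obtain s where s: "F z = g s" using g(2) by auto
    define t where "t = s - of_int (round (s - t0))"
    have gt: "F z = g t" unfolding s g(1) by (simp add: t_def)
    have "\<bar>t - t0\<bar> \<le> 1/2" using of_int_round_abs_le[of "s - t0"] by (simp add: t_def abs_minus_commute algebra_simps)
    moreover have "t \<notin> {t0 - 1/2..t0 - e} \<union> {t0 + e..t0 + 1/2}"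
      using r(3)[OF z] gt K_def by auto
    ultimately have te: "\<bar>t - t0\<bar> < e" by auto
    have "F (of_real (t - t0)) = F z" unfolding gt by (simp add: F_def)
    moreover have "complex_of_real (t - t0) \<in> ball 0 e" using te by (simp del: of_real_diff)
    ultimately have "z = of_real (t - t0)" using injF r(2) z by (metis inj_onD subsetD)
    then show "Im z = 0" by simp
  qed
  show ?thesis
    using that[of r c F] r(1) c0 F0 dF S contF continuous_on_subset inj_on_subset[OF injF r(2)] by blast
qed

lemma connected_half_ball: "connected (ball (0::complex) r \<inter> {z. Im z > 0})"
  "connected (ball (0::complex) r \<inter> {z. Im z < 0})"
  by (intro convex_connected convex_Int convex_ball convex_halfspace_Im_gt convex_halfspace_Im_lt)+

text \<open>The derivative of the chart at the base point is complex linear, so angles are preserved there.\<close>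
lemma smooth_jordan_curve_chart:
  assumes "smooth_jordan_curve S" and "z0 \<in> S"
  obtains F r c where "r > 0" "c \<noteq> 0" "F 0 = z0" "continuous_on (ball 0 r) F" "inj_on F (ball 0 r)"
    "(F has_derivative (\<lambda>h. c * h)) (at 0)" "\<And>z. z \<in> ball 0 r \<Longrightarrow> F z \<in> S \<longleftrightarrow> Im z = 0"
    "\<And>z. z \<in> ball 0 r \<Longrightarrow> F z \<in> inside S \<longleftrightarrow> Im z > 0"
    "\<And>z. z \<in> ball 0 r \<Longrightarrow> F z \<in> outside S \<longleftrightarrow> Im z < 0"
proof -
  note J = smooth_jordan_curve_facts[OF assms(1)]
  obtain F r c where F: "r > 0" "c \<noteq> 0" "F 0 = z0" "continuous_on (ball 0 r) F" "inj_on F (ball 0 r)"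
    "(F has_derivative (\<lambda>h. c * h)) (at 0)" "\<And>z. z \<in> ball 0 r \<Longrightarrow> F z \<in> S \<longleftrightarrow> Im z = 0"
    by (rule smooth_jordan_curve_graph[OF assms], rule that; assumption)
  define U where "U = ball (0::complex) r \<inter> {z. Im z > 0}"
  define L where "L = ball (0::complex) r \<inter> {z. Im z < 0}"
  have side: "F ` A \<subseteq> inside S \<or> F ` A \<subseteq> outside S" if "connected A" "A \<subseteq> ball 0 r" "\<And>z. z \<in> A \<Longrightarrow> Im z \<noteq> 0" for A
  proof -
    have "connected (F ` A)" using that F(4) by (meson connected_continuous_image continuous_on_subset)
    moreover have "F ` A \<subseteq> inside S \<union> outside S" using that F(7) J(11) by blast
    ultimately show ?thesis using J(5,7,10) connectedD[of "F ` A" "inside S" "outside S"] by blast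
  qed
  have sU: "F ` U \<subseteq> inside S \<or> F ` U \<subseteq> outside S" and sL: "F ` L \<subseteq> inside S \<or> F ` L \<subseteq> outside S"
    using connected_half_ball[of r] by (intro side; auto simp: U_def L_def)+
  have op: "open (F ` ball 0 r)" using F by (intro invariance_of_domain) auto
  moreover have z0: "z0 \<in> F ` ball 0 r" using F(1,3) by (metis centre_in_ball imageI)
  ultimately have ne: "F ` ball 0 r \<inter> inside S \<noteq> {}" "F ` ball 0 r \<inter> outside S \<noteq> {}"
    using J(12,13) assms(2) unfolding frontier_def
    by (metis DiffD1 Int_commute open_Int_closure_eq_empty disjoint_iff)+
  have tri: "z \<in> U \<or> z \<in> L \<or> F z \<in> S" if "z \<in> ball 0 r" for z
    using that F(7) by (cases "Im z" "0::real" rule: linorder_cases) (auto simp: U_def L_def)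
  have inS: "F z \<notin> inside S" "F z \<notin> outside S" if "F z \<in> S" for z using that J(11) by blast+
  have cs: "(F ` U \<subseteq> inside S \<and> F ` L \<subseteq> outside S) \<or> (F ` L \<subseteq> inside S \<and> F ` U \<subseteq> outside S)"
    using sU sL ne tri inS J(10) by blast
  have key: "(F z \<in> X \<longleftrightarrow> Im z > 0) \<and> (F z \<in> Y \<longleftrightarrow> Im z < 0)"
    if z: "z \<in> ball 0 r" and UL: "F ` U \<subseteq> X" "F ` L \<subseteq> Y" and XY: "X \<inter> Y = {}" "X \<union> Y = - S" for z X Y
  proof -
    have "Im z > 0 \<Longrightarrow> F z \<in> X" "Im z < 0 \<Longrightarrow> F z \<in> Y" "Im z = 0 \<Longrightarrow> F z \<in> S"
      using z UL F(7) by (auto simp: U_def L_def)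
    moreover have "F z \<in> X \<Longrightarrow> F z \<notin> Y" "F z \<in> S \<Longrightarrow> F z \<notin> X" "F z \<in> S \<Longrightarrow> F z \<notin> Y"
      using XY by blast+
    ultimately show ?thesis by (cases "Im z" "0::real" rule: linorder_cases) auto
  qed
  from cs show ?thesis
  proof (elim disjE conjE)
    assume 1: "F ` U \<subseteq> inside S" "F ` L \<subseteq> outside S"
    have "F z \<in> inside S \<longleftrightarrow> Im z > 0" "F z \<in> outside S \<longleftrightarrow> Im z < 0" if "z \<in> ball 0 r" for z
      using key[OF that 1 J(10)] J(11) by auto
    from that[OF F this] show ?thesis .
  next
    assume 2: "F ` L \<subseteq> inside S" "F ` U \<subseteq> outside S"
    \<comment> \<open>Half a turn exchanges the two half disks and keeps the derivative complex
      linear, which a reflection would not do.\<close>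
    define H where "H = (\<lambda>z. F (- z))"
    have m: "- z \<in> ball 0 r" if "z \<in> ball 0 r" for z :: complex using that by simp
    have 3: "F z \<in> inside S \<longleftrightarrow> Im z < 0" "F z \<in> outside S \<longleftrightarrow> Im z > 0" if "z \<in> ball 0 r" for z
      using key[OF that 2(2,1)] J(10) J(11) by (simp_all add: Un_commute Int_commute)
    have "(H has_derivative (\<lambda>h. (-c) * h)) (at 0)"
    proof -
      have 1: "(F has_derivative (\<lambda>h. c * h)) (at (- 0))" using F(6) by simp
      have "((\<lambda>z::complex. - z) has_derivative (\<lambda>h. - h)) (at 0)" by (auto intro!: derivative_eq_intros)
      from has_derivative_compose[OF this 1] show ?thesis by (simp add: H_def)
    qed
    moreover have "continuous_on (ball 0 r) H" unfolding H_def
      by (rule continuous_on_compose2[OF F(4)]) (auto intro!: continuous_intros)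
    moreover have "inj_on H (ball 0 r)" using F(5) m unfolding H_def inj_on_def by (metis neg_equal_iff_equal)
    moreover have "H z \<in> S \<longleftrightarrow> Im z = 0" "H z \<in> inside S \<longleftrightarrow> Im z > 0" "H z \<in> outside S \<longleftrightarrow> Im z < 0"
      if "z \<in> ball 0 r" for z
      using F(7)[OF m[OF that]] 3[OF m[OF that]] by (auto simp: H_def)
    moreover have "H 0 = z0" "- c \<noteq> 0" using F by (auto simp: H_def)
    ultimately show ?thesis using that[of r "-c" H] F(1) by blast
  qed
qed

subsection \<open>Order and local degree\<close>

text \<open>One signed order for zeros and poles. The identity is required only on a punctured
  neighbourhood because the values of \<open>f\<close> at its poles are arbitrary; the explicit unit
  factor \<open>h\<close> makes products, inverses and compositions easy.\<close>

definition has_order :: "(complex \<Rightarrow> complex) \<Rightarrow> complex \<Rightarrow> int \<Rightarrow> bool" where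
  "has_order f z n \<longleftrightarrow>
     (\<exists>h. h analytic_on {z} \<and> h z \<noteq> 0 \<and> (\<forall>\<^sub>F x in at z. f x = h x * (x - z) powi n))"

lemma has_orderI:
  assumes "h analytic_on {z}" "h z \<noteq> 0" "\<forall>\<^sub>F x in at z. f x = h x * (x - z) powi n"
  shows "has_order f z n"
  using assms unfolding has_order_def by blast

lemma has_orderI_ball:
  assumes "r > 0" "h holomorphic_on ball z r" "h z \<noteq> 0" "\<And>x. x \<in> ball z r - {z} \<Longrightarrow> f x = h x * (x - z) powi n"
  shows "has_order f z n"
proof (rule has_orderI)
  show "h analytic_on {z}" using assms(1,2) by (metis analytic_at centre_in_ball open_ball)
  show "\<forall>\<^sub>F x in at z. f x = h x * (x - z) powi n"
    using eventually_at_in_open[of "ball z r" z] assms(1)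
    by (auto elim!: eventually_mono intro: assms(4))
qed (fact assms(3))

lemma zorder_eq_if_has_order:
  assumes "has_order f z n" shows "zorder f z = n"
proof -
  obtain h where h: "h analytic_on {z}" "h z \<noteq> 0" "\<forall>\<^sub>F x in at z. f x = h x * (x - z) powi n"
    using assms unfolding has_order_def by blast
  obtain A where A: "open A" "z \<in> A" "h holomorphic_on A" using h(1) analytic_at by blast
  obtain B where B: "open B" "z \<in> B" "\<And>x. x \<in> B \<Longrightarrow> x \<noteq> z \<Longrightarrow> f x = h x * (x - z) powi n"
    using h(3) unfolding eventually_at_topological by blast
  show ?thesis
    by (rule zorder_eqI[of "A \<inter> B" z h]) (use A B h in \<open>auto intro: holomorphic_on_subset\<close>)
qed

lemma has_order_unique: "has_order f z m \<Longrightarrow> has_order f z n \<Longrightarrow> m = n"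
  using zorder_eq_if_has_order by blast

lemma has_order_cong:
  assumes "\<forall>\<^sub>F x in at z. f x = g x" "has_order f z n" shows "has_order g z n"
proof -
  obtain h where h: "h analytic_on {z}" "h z \<noteq> 0" "\<forall>\<^sub>F x in at z. f x = h x * (x - z) powi n"
    using assms unfolding has_order_def by blast
  show ?thesis
    by (rule has_orderI[OF h(1,2)]) (use h(3) assms(1) in eventually_elim, auto)
qed

lemma has_order_mult:
  assumes "has_order f z m" "has_order g z n"
  shows "has_order (\<lambda>x. f x * g x) z (m + n)"
proof -
  obtain h where h: "h analytic_on {z}" "h z \<noteq> 0" "\<forall>\<^sub>F x in at z. f x = h x * (x - z) powi m"
    using assms unfolding has_order_def by blast
  obtain k where k: "k analytic_on {z}" "k z \<noteq> 0" "\<forall>\<^sub>F x in at z. g x = k x * (x - z) powi n"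
    using assms unfolding has_order_def by blast
  show ?thesis
  proof (rule has_orderI)
    show "(\<lambda>x. h x * k x) analytic_on {z}" "h z * k z \<noteq> 0"
      using h k by (auto intro!: analytic_intros)
    show "\<forall>\<^sub>F x in at z. f x * g x = h x * k x * (x - z) powi (m + n)"
      using h(3) k(3) eventually_neq_at_within[of z z UNIV]
      by eventually_elim (simp add: power_int_add)
  qed
qed

lemma has_order_inverse:
  assumes "has_order f z m"
  shows "has_order (\<lambda>x. inverse (f x)) z (- m)"
proof -
  obtain h where h: "h analytic_on {z}" "h z \<noteq> 0" "\<forall>\<^sub>F x in at z. f x = h x * (x - z) powi m"
    using assms unfolding has_order_def by blast
  show ?thesis
  proof (rule has_orderI)
    show "(\<lambda>x. inverse (h x)) analytic_on {z}" "inverse (h z) \<noteq> 0"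
      using h by (auto intro!: analytic_intros)
    show "\<forall>\<^sub>F x in at z. inverse (f x) = inverse (h x) * (x - z) powi (- m)"
      using h(3) by eventually_elim (simp add: power_int_minus)
  qed
qed

lemma has_order_analytic:
  assumes "f analytic_on {z}" "f z \<noteq> 0" shows "has_order f z 0"
  using assms by (intro has_orderI[of f]) auto

lemma has_order_ident: "has_order (\<lambda>x. x - z) z 1"
  by (intro has_orderI[of "\<lambda>_. 1"]) auto

lemma has_order_power:
  assumes "has_order f z m" shows "has_order (\<lambda>x. f x ^ k) z (int k * m)"
proof (induction k)
  case 0
  show ?case by (simp add: has_order_analytic)
next
  case (Suc k)
  from has_order_mult[OF assms this] show ?case by (simp add: algebra_simps)
qed

lemma has_order_prod:
  assumes "finite A" "\<And>a. a \<in> A \<Longrightarrow> has_order (f a) z (m a)"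
  shows "has_order (\<lambda>x. \<Prod>a\<in>A. f a x) z (\<Sum>a\<in>A. m a)"
  using assms by (induction A rule: finite_induct) (auto simp: has_order_analytic intro!: has_order_mult)

lemma has_order_0_tendsto:
  assumes "has_order f z 0" obtains l where "l \<noteq> 0" "(f \<longlongrightarrow> l) (at z)"
proof -
  obtain h where h: "h analytic_on {z}" "h z \<noteq> 0" "\<forall>\<^sub>F x in at z. f x = h x * (x - z) powi 0"
    using assms unfolding has_order_def by blast
  have "(h \<longlongrightarrow> h z) (at z)" using h(1) by (simp add: analytic_at_imp_isCont isContD)
  moreover have "\<forall>\<^sub>F x in at z. h x = f x" using h(3) by eventually_elim simp
  ultimately show ?thesis using that[OF h(2)] Lim_transform_eventually by blast
qed

text \<open>By injectivity \<open>deriv \<phi> z \<noteq> 0\<close>, so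
  \<open>\<phi> x - \<phi> z\<close> is \<open>x - z\<close> times a factor \<open>k\<close> that is
  analytic and nonzero at \<open>z\<close>.\<close>

lemma has_order_compose:
  assumes f: "has_order f (\<phi> z) n" and \<phi>: "\<phi> holomorphic_on A" "open A" "z \<in> A" "inj_on \<phi> A"
  shows "has_order (\<lambda>x. f (\<phi> x)) z n"
proof -
  obtain h where h: "h analytic_on {\<phi> z}" "h (\<phi> z) \<noteq> 0" "\<forall>\<^sub>F x in at (\<phi> z). f x = h x * (x - \<phi> z) powi n"
    using f unfolding has_order_def by blast
  have an: "\<phi> analytic_on {z}" using \<phi> analytic_at by blast
  have d: "deriv \<phi> z \<noteq> 0" using \<phi> holomorphic_injective_imp_regular by blast
  have inA: "\<forall>\<^sub>F x in at z. x \<in> A - {z}" using \<phi> by (intro eventually_at_in_open) auto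
  have fl: "filterlim \<phi> (at (\<phi> z)) (at z)"
  proof (rule filterlim_atI)
    show "(\<phi> \<longlongrightarrow> \<phi> z) (at z)" using an by (simp add: analytic_at_imp_isCont isContD)
    show "\<forall>\<^sub>F x in at z. \<phi> x \<noteq> \<phi> z" using inA by eventually_elim (use \<phi> in \<open>auto simp: inj_on_def\<close>)
  qed
  define k where "k = (\<lambda>x. if x = z then deriv \<phi> z else (\<phi> x - \<phi> z) / (x - z))"
  have "k holomorphic_on A" unfolding k_def using \<phi> by (intro pole_lemma_open) auto
  then have k: "k analytic_on {z}" using \<phi> analytic_at by blast
  have kz: "k z \<noteq> 0" using d by (simp add: k_def)
  show ?thesis
  proof (rule has_orderI)
    show "(\<lambda>x. h (\<phi> x) * k x powi n) analytic_on {z}"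
      using h(1) k kz an by (intro analytic_intros analytic_on_compose_gen[of \<phi> "{z}" h "{\<phi> z}", unfolded o_def]) auto
    show "h (\<phi> z) * k z powi n \<noteq> 0" using h kz by simp
    have "\<forall>\<^sub>F x in at z. f (\<phi> x) = h (\<phi> x) * (\<phi> x - \<phi> z) powi n"
      using h(3) fl by (rule eventually_compose_filterlim)
    then show "\<forall>\<^sub>F x in at z. f (\<phi> x) = h (\<phi> x) * k x powi n * (x - z) powi n"
      using inA by eventually_elim (simp add: k_def power_int_mult_distrib[symmetric])
  qed
qed

text \<open>Connects the \<open>LEAST\<close> in the definition with orders: uniqueness of the order
  leaves only one candidate exponent.\<close>

lemma zero_mult_eq:
  assumes g: "g analytic_on {z}" and n: "has_order g z (int n)"
  shows "zero_mult g z = enat n"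
proof -
  define P where "P = (\<lambda>n. \<exists>h r. r > 0 \<and> h holomorphic_on ball z r \<and> h z \<noteq> 0 \<and>
                 (\<forall>x\<in>ball z r. g x = (x - z) ^ n * h x))"
  obtain h where h: "h analytic_on {z}" "h z \<noteq> 0" "\<forall>\<^sub>F x in at z. g x = h x * (x - z) powi (int n)"
    using n unfolding has_order_def by blast
  have ev: "\<forall>\<^sub>F x in at z. (x - z) ^ n * h x = g x"
    using h(3) by eventually_elim (simp add: mult.commute)
  have "((\<lambda>x. (x - z) ^ n * h x) \<longlongrightarrow> (z - z) ^ n * h z) (at z)"
    using h(1) by (intro tendsto_intros) (simp add: analytic_at_imp_isCont isContD)
  then have "(g \<longlongrightarrow> (z - z) ^ n * h z) (at z)" using ev Lim_transform_eventually by blast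
  moreover have "(g \<longlongrightarrow> g z) (at z)" using g by (simp add: analytic_at_imp_isCont isContD)
  \<comment> \<open>The factorization in \<open>zero_mult\<close> includes the centre, about which
    \<open>has_order\<close> says nothing; continuity of \<open>g\<close> supplies it.\<close>
  ultimately have "g z = (z - z) ^ n * h z" using tendsto_unique[OF at_neq_bot] by blast
  with ev have "\<forall>\<^sub>F x in nhds z. g x = (x - z) ^ n * h x"
    unfolding eventually_nhds_conv_at by (auto elim: eventually_mono)
  then obtain r1 where r1: "r1 > 0" "\<And>x. dist x z < r1 \<Longrightarrow> g x = (x - z) ^ n * h x"
    unfolding eventually_nhds_metric by blast
  obtain r2 where r2: "r2 > 0" "h holomorphic_on ball z r2"
    using h(1) unfolding analytic_on_def by auto
  have Pn: "P n" unfolding P_def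
    by (rule exI[of _ h], rule exI[of _ "min r1 r2"])
       (use r1 r2 h(2) in \<open>auto simp: dist_commute intro: holomorphic_on_subset\<close>)
  have Pu: "m = n" if Pm: "P m" for m
  proof -
    obtain h' r' where h': "r' > 0" "h' holomorphic_on ball z r'" "h' z \<noteq> 0"
       "\<And>x. x \<in> ball z r' \<Longrightarrow> g x = (x - z) ^ m * h' x"
      using Pm unfolding P_def by blast
    have "has_order g z (int m)"
      by (rule has_orderI_ball[OF h'(1-3)]) (simp add: h'(4) mult.commute)
    then show ?thesis using n has_order_unique by fastforce
  qed
  have "(LEAST m. P m) = n" using Pn Pu by (metis LeastI)
  moreover have "\<exists>m. P m" using Pn by blast
  ultimately show ?thesis unfolding zero_mult_def P_def by simp
qed

lemma pole_mult_eq: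
  assumes n: "has_order f z (- int n)"
  shows "pole_mult f z = enat n"
proof -
  define P where "P = (\<lambda>n. \<exists>h r. r > 0 \<and> h holomorphic_on ball z r \<and> h z \<noteq> 0 \<and>
                 (\<forall>x\<in>ball z r - {z}. f x = h x / (x - z) ^ n))"
  obtain h where h: "h analytic_on {z}" "h z \<noteq> 0" "\<forall>\<^sub>F x in at z. f x = h x * (x - z) powi (- int n)"
    using n unfolding has_order_def by blast
  obtain r1 where r1: "r1 > 0" "\<And>x. x \<noteq> z \<Longrightarrow> dist x z < r1 \<Longrightarrow> f x = h x * (x - z) powi (- int n)"
    using h(3) unfolding eventually_at by blast
  obtain r2 where r2: "r2 > 0" "h holomorphic_on ball z r2"
    using h(1) unfolding analytic_on_def by auto
  have Pn: "P n" unfolding P_def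
    by (rule exI[of _ h], rule exI[of _ "min r1 r2"])
       (use r1 r2 h(2) in \<open>auto simp: dist_commute power_int_minus divide_inverse intro: holomorphic_on_subset\<close>)
  have Pu: "m = n" if Pm: "P m" for m
  proof -
    obtain h' r' where h': "r' > 0" "h' holomorphic_on ball z r'" "h' z \<noteq> 0"
       "\<And>x. x \<in> ball z r' - {z} \<Longrightarrow> f x = h' x / (x - z) ^ m"
      using Pm unfolding P_def by blast
    have "has_order f z (- int m)"
      by (rule has_orderI_ball[OF h'(1-3)]) (simp add: h'(4) power_int_minus divide_inverse)
    then show ?thesis using n has_order_unique by fastforce
  qed
  have "(LEAST m. P m) = n" using Pn Pu by (metis LeastI)
  moreover have "\<exists>m. P m" using Pn by blast
  ultimately show ?thesis unfolding pole_mult_def P_def by simp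
qed

definition mult_at :: "(complex \<Rightarrow> complex) \<Rightarrow> complex \<Rightarrow> complex \<Rightarrow> nat" where
  "mult_at f w z = nat (zorder (\<lambda>x. f x - w) z)"

lemma mult_at_eqI: "has_order (\<lambda>x. f x - w) z (int n) \<Longrightarrow> mult_at f w z = n"
  by (simp add: mult_at_def zorder_eq_if_has_order)

lemma nonconstant_has_order:
  assumes "f holomorphic_on V" "open V" "connected V" "\<not> f constant_on V" "z \<in> V"
  shows "has_order (\<lambda>x. f x - w) z (int (mult_at f w z))" "mult_at f w z = 0 \<longleftrightarrow> f z \<noteq> w"
    "zero_mult (\<lambda>x. f x - w) z = enat (mult_at f w z)"
proof -
  have hol: "(\<lambda>x. f x - w) holomorphic_on V" using assms by (intro holomorphic_intros)
  have "\<exists>n. has_order (\<lambda>x. f x - w) z (int n) \<and> (n = 0 \<longleftrightarrow> f z \<noteq> w)"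
  proof (cases "f z = w")
    case True
    have "\<not> (\<lambda>x. f x - w) constant_on V"
      using assms(4) unfolding constant_on_def by (metis diff_add_cancel)
    moreover have "f z - w = 0" using True by simp
    ultimately obtain g r n where "0 < n" "0 < r" "ball z r \<subseteq> V" "g holomorphic_on ball z r"
            "\<And>x. x \<in> ball z r \<Longrightarrow> f x - w = (x - z)^n * g x"
            "\<And>x. x \<in> ball z r \<Longrightarrow> g x \<noteq> 0"
      using holomorphic_factor_zero_nonconstant[OF hol assms(2,3,5)] by metis
    then show ?thesis using True
      by (intro exI[of _ n] conjI has_orderI_ball[of r g]) (auto simp: mult.commute)
  next
    case False
    then show ?thesis using hol assms(2,5)
      by (intro exI[of _ 0] conjI) (auto intro!: has_order_analytic simp: analytic_at)
  qed
  then obtain n where n: "has_order (\<lambda>x. f x - w) z (int n)" "n = 0 \<longleftrightarrow> f z \<noteq> w" by blast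
  have m: "mult_at f w z = n" using mult_at_eqI[OF n(1)] .
  show "has_order (\<lambda>x. f x - w) z (int (mult_at f w z))" "mult_at f w z = 0 \<longleftrightarrow> f z \<noteq> w"
    using n m by auto
  then show "zero_mult (\<lambda>x. f x - w) z = enat (mult_at f w z)"
    using hol assms(2,5) by (intro zero_mult_eq) (auto simp: analytic_at)
qed

text \<open>Rouche on a circle about \<open>x\<close> on which \<open>f\<close> does not take the
  value \<open>f x\<close>: passing from \<open>f - f x\<close> to \<open>f - w\<close> adds the
  constant \<open>f x - w\<close>, which is smaller than \<open>f - f x\<close> on the circle once
  \<open>w\<close> is near \<open>f x\<close>.\<close>

lemma local_degree:
  assumes f: "f holomorphic_on V" "open V" "connected V" "\<not> f constant_on V" "x \<in> V" and W: "open W" "x \<in> W"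
  obtains U where "open U" "x \<in> U" "U \<subseteq> V \<inter> W"
    "\<forall>\<^sub>F w in nhds (f x). finite {y \<in> U. f y = w} \<and> (\<Sum>y | y \<in> U \<and> f y = w. mult_at f w y) = mult_at f (f x) x"
proof -
  obtain r0 where r0: "r0 > 0" "cball x r0 \<subseteq> V \<inter> W"
    using f W by (metis Int_iff open_Int open_contains_cball)
  have fin: "finite {y \<in> cball x r0. f y = w}" for w
  proof -
    have "(\<lambda>y. f y - w) holomorphic_on V" using f by (intro holomorphic_intros)
    moreover have "\<not> (\<lambda>y. f y - w) constant_on V"
      using f(4) unfolding constant_on_def by (metis diff_add_cancel)
    ultimately show ?thesis
      using holomorphic_compact_finite_zeros[of "\<lambda>y. f y - w" V "cball x r0"] f r0 by auto
  qed
  obtain d where d: "d > 0" "\<And>y. y \<in> {y \<in> cball x r0. f y = f x} \<Longrightarrow> y \<noteq> x \<Longrightarrow> d \<le> dist x y"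
    using finite_set_avoid[OF fin] by metis
  \<comment> \<open>In \<open>s\<close> the fibre over \<open>f x\<close> is just \<open>x\<close>.
    The circle has half that radius; zeros of \<open>f - w\<close> in \<open>s\<close> beyond the
    circle get winding number 0 and drop out.\<close>
  define s where "s = ball x (min d r0)"
  define r where "r = min d r0 / 2"
  have r: "r > 0" "r < min d r0" using d r0 by (auto simp: r_def)
  have sV: "s \<subseteq> V" "s \<subseteq> cball x r0" using r0 by (auto simp: s_def)
  have iso: "y = x" if "y \<in> s" "f y = f x" for y
    using d(2)[of y] that by (force simp: s_def)
  have cont: "continuous_on V f" using f holomorphic_on_imp_continuous_on by blast
  have sph: "sphere x r \<subseteq> s" using r by (auto simp: s_def)
  have "compact (f ` sphere x r)" using cont sph sV by (meson compact_continuous_image compact_sphere continuous_on_subset subset_trans)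
  moreover have "f x \<notin> f ` sphere x r" using iso sph r by force
  ultimately have "open (- f ` sphere x r)" "f x \<in> - f ` sphere x r" by (auto simp: compact_imp_closed)
  then obtain e where e: "e > 0" "ball (f x) e \<subseteq> - f ` sphere x r" by (meson openE)
  have wind: "winding_number (circlepath x r) p = (if p \<in> ball x r then 1 else 0)" if "p \<notin> sphere x r" for p
  proof (cases "p \<in> ball x r")
    case True
    then show ?thesis by (simp add: winding_number_circlepath dist_norm norm_minus_commute)
  next
    case False
    then show ?thesis using that r
      by (auto intro!: winding_number_zero_outside[of _ "cball x r"])
  qed
  have main: "(\<Sum>y | y \<in> ball x r \<and> f y = w. mult_at f w y) = mult_at f (f x) x" if w: "w \<in> ball (f x) e" for w
  proof -
    have nos: "p \<notin> sphere x r" if "p \<in> s" "f p = w" for p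
    proof -
      have "w \<notin> f ` sphere x r" using e(2) w by blast
      then show ?thesis using that(2) by blast
    qed
    have zo: "complex_of_int (zorder (\<lambda>x. f x - v) p) = of_nat (mult_at f v p)" if "p \<in> s" for p v
    proof -
      have "p \<in> V" using that sV by blast
      from zorder_eq_if_has_order[OF nonconstant_has_order(1)[OF f(1-4) this]] show ?thesis by simp
    qed
    have fins: "finite {p \<in> s. f p = v}" for v by (rule finite_subset[OF _ fin[of v]]) (use sV in blast)
    have "(\<Sum>p\<in>{p\<in>s. (f p - f x) + (f x - w) = 0}. winding_number (circlepath x r) p * zorder (\<lambda>p. (f p - f x) + (f x - w)) p)
          = (\<Sum>p\<in>{p\<in>s. f p - f x = 0}. winding_number (circlepath x r) p * zorder (\<lambda>p. f p - f x) p)"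
    proof (rule Rouche_theorem)
      show "\<forall>z\<in>path_image (circlepath x r). cmod (f x - w) < cmod (f z - f x)"
      proof
        fix z assume "z \<in> path_image (circlepath x r)"
        then have "f z \<notin> ball (f x) e" using e r by auto
        then show "cmod (f x - w) < cmod (f z - f x)" using w
          by (auto simp: dist_norm norm_minus_commute)
      qed
      show "\<forall>z. z \<notin> s \<longrightarrow> winding_number (circlepath x r) z = 0"
      proof (intro allI impI)
        fix z assume "z \<notin> s"
        then have "z \<notin> sphere x r" using sph by blast
        moreover have "z \<notin> ball x r" using r(2) \<open>z \<notin> s\<close> unfolding s_def mem_ball by linarith
        ultimately show "winding_number (circlepath x r) z = 0" using wind by simp
      qed
      show "path_image (circlepath x r) \<subseteq> s" using sph r by simp
      show "finite {p \<in> s. f p - f x + (f x - w) = 0}" "finite {p \<in> s. f p - f x = 0}"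
        using fins[of w] fins[of "f x"] by simp_all
    qed (use f sV in \<open>auto simp: s_def intro!: holomorphic_intros intro: holomorphic_on_subset\<close>)
    then have "(\<Sum>p\<in>{p\<in>s. f p = w}. winding_number (circlepath x r) p * of_nat (mult_at f w p))
          = (\<Sum>p\<in>{p\<in>s. f p = f x}. winding_number (circlepath x r) p * of_nat (mult_at f (f x) p))"
      using zo by simp
    also have "{p\<in>s. f p = f x} = {x}" using iso r by (auto simp: s_def)
    also have "(\<Sum>p\<in>{p\<in>s. f p = w}. winding_number (circlepath x r) p * of_nat (mult_at f w p))
        = (\<Sum>p\<in>{p\<in>s. f p = w}. if p \<in> ball x r then of_nat (mult_at f w p) else 0)"
      by (rule sum.cong) (use wind nos in auto)
    also have "\<dots> = (\<Sum>p\<in>{p\<in>s. f p = w} \<inter> {p. p \<in> ball x r}. of_nat (mult_at f w p))"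
      using fins[of w] by (simp add: sum.inter_filter[symmetric] Int_def)
    also have "{p\<in>s. f p = w} \<inter> {p. p \<in> ball x r} = {y. y \<in> ball x r \<and> f y = w}" using r by (auto simp: s_def)
    finally have "complex_of_nat (\<Sum>y | y \<in> ball x r \<and> f y = w. mult_at f w y) = of_nat (mult_at f (f x) x)"
      using wind[of x] r by simp
    then show ?thesis by (simp only: of_nat_eq_iff)
  qed
  show ?thesis
  proof (rule that[of "ball x r"])
    show "ball x r \<subseteq> V \<inter> W" using r0 r by auto
    have "\<forall>\<^sub>F w in nhds (f x). w \<in> ball (f x) e" using e by (intro eventually_nhds_in_open) auto
    then show "\<forall>\<^sub>F w in nhds (f x). finite {y \<in> ball x r. f y = w} \<and> (\<Sum>y | y \<in> ball x r \<and> f y = w. mult_at f w y) = mult_at f (f x) x"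
    proof eventually_elim
      case (elim w)
      have "{y \<in> ball x r. f y = w} \<subseteq> {y \<in> cball x r0. f y = w}" using r by auto
      then show ?case using main[OF elim] fin[of w] finite_subset by blast
    qed
  qed (use r in auto)
qed

subsection \<open>Counting preimages\<close>

lemma finite_separated:
  fixes Z :: "'a::metric_space set"
  assumes "finite Z"
  obtains e where "e > 0" "\<And>x y. x \<in> Z \<Longrightarrow> y \<in> Z \<Longrightarrow> x \<noteq> y \<Longrightarrow> ball x e \<inter> ball y e = {}"
proof -
  define Q where "Q = insert 1 ((\<lambda>(x, y). dist x y) ` ({p \<in> Z \<times> Z. fst p \<noteq> snd p}))"
  have Q: "finite Q" "Q \<noteq> {}" "\<And>q. q \<in> Q \<Longrightarrow> q > 0" using assms by (auto simp: Q_def)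
  show ?thesis
  proof (rule that[of "Min Q / 2"])
    show "Min Q / 2 > 0" using Q by simp
    fix x y assume "x \<in> Z" "y \<in> Z" "x \<noteq> y"
    then have "dist x y \<in> Q" by (force simp: Q_def)
    then have "Min Q \<le> dist x y" using Q by simp
    then show "ball x (Min Q / 2) \<inter> ball y (Min Q / 2) = {}"
      by (intro disjoint_ballI) simp
  qed
qed

lemma finite_Int_compact:
  assumes "compact K" "\<And>x. x \<in> K \<Longrightarrow> \<exists>U. open U \<and> x \<in> U \<and> finite (A \<inter> U)"
  shows "finite (A \<inter> K)"
proof -
  obtain U where U: "\<And>x. x \<in> K \<Longrightarrow> open (U x)" "\<And>x. x \<in> K \<Longrightarrow> x \<in> U x" "\<And>x. x \<in> K \<Longrightarrow> finite (A \<inter> U x)"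
    using assms(2) by metis
  have "K \<subseteq> (\<Union>x\<in>K. U x)" using U by blast
  then obtain T where T: "T \<subseteq> K" "finite T" "K \<subseteq> (\<Union>x\<in>T. U x)"
    using compactE_image[OF assms(1), of K U] U by metis
  then have "A \<inter> K \<subseteq> (\<Union>x\<in>T. A \<inter> U x)" by blast
  then show ?thesis using T U by (meson finite_UN_I finite_subset subsetD)
qed

text \<open>Here \<open>c y w\<close> plays the role of the multiplicity of \<open>y\<close> as a preimage of \<open>w\<close>, and \<open>m y\<close>
  that of the multiplicity for the limit value along \<open>F\<close>, which may be infinity.\<close>
lemma eventually_count:
  fixes c :: "'a::metric_space \<Rightarrow> 'b \<Rightarrow> nat" and m :: "'a \<Rightarrow> nat"
  assumes K: "compact K" "open D" "D \<subseteq> K" and U0: "open U0" "K - D \<subseteq> U0" and fin: "finite {y \<in> K. m y \<noteq> 0}"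
    and loc: "\<And>x V. x \<in> K \<Longrightarrow> open V \<Longrightarrow> x \<in> V \<Longrightarrow> \<exists>U. open U \<and> x \<in> U \<and> U \<subseteq> V \<and>
       (\<forall>\<^sub>F w in F. finite {y \<in> U. c y w \<noteq> 0} \<and> (\<Sum>y | y \<in> U \<and> c y w \<noteq> 0. c y w) = m x)"
  obtains U' where "open U'" "K - D \<subseteq> U'"
    "\<forall>\<^sub>F w in F. finite {y \<in> D. c y w \<noteq> 0} \<and>
       (\<Sum>y | y \<in> D \<and> m y \<noteq> 0. m y) \<le> (\<Sum>y | y \<in> D \<and> c y w \<noteq> 0. c y w) \<and>
       ((\<Sum>y | y \<in> D \<and> m y \<noteq> 0. m y) = (\<Sum>y | y \<in> D \<and> c y w \<noteq> 0. c y w) \<longrightarrow> (\<forall>y\<in>D \<inter> U'. c y w = 0)) \<and>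
       ((\<forall>y\<in>D \<inter> U0. c y w = 0) \<longrightarrow> (\<Sum>y | y \<in> D \<and> m y \<noteq> 0. m y) = (\<Sum>y | y \<in> D \<and> c y w \<noteq> 0. c y w))"
proof -
  define Z where "Z = {y \<in> K. m y \<noteq> 0}"
  define ZD where "ZD = {y. y \<in> D \<and> m y \<noteq> 0}"
  have Z: "finite Z" "Z \<subseteq> K" "ZD \<subseteq> Z" "finite ZD" using fin K finite_subset[of ZD Z] by (auto simp: Z_def ZD_def)
  obtain e where e: "e > 0" "\<And>x y. x \<in> Z \<Longrightarrow> y \<in> Z \<Longrightarrow> x \<noteq> y \<Longrightarrow> ball x e \<inter> ball y e = {}"
    using finite_separated[OF Z(1)] by metis
  have "\<forall>x\<in>D. \<exists>r. r > 0 \<and> cball x r \<subseteq> D" using K(2) open_contains_cball by blast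
  then obtain \<rho> where \<rho>: "\<And>x. x \<in> D \<Longrightarrow> \<rho> x > 0" "\<And>x. x \<in> D \<Longrightarrow> cball x (\<rho> x) \<subseteq> D" by metis
  \<comment> \<open>Around points of \<open>D\<close> the neighbourhoods stay within
    \<open>D\<close>, around points of \<open>K - D\<close> within \<open>U0\<close>; the bound
    \<open>e\<close> keeps those of different limit points disjoint.\<close>
  define V where "V = (\<lambda>x. if x \<in> D then ball x (min e (\<rho> x)) else ball x e \<inter> U0)"
  have V: "open (V x)" "x \<in> V x" "V x \<subseteq> ball x e" if "x \<in> K" for x
    using that e \<rho> U0 by (auto simp: V_def)
  define Q where "Q = (\<lambda>x U. open U \<and> x \<in> U \<and> U \<subseteq> V x \<and>
       (\<forall>\<^sub>F w in F. finite {y \<in> U. c y w \<noteq> 0} \<and> (\<Sum>y | y \<in> U \<and> c y w \<noteq> 0. c y w) = m x))"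
  have "\<forall>x\<in>K. \<exists>U. Q x U"
    using loc V(1,2) unfolding Q_def by blast
  from bchoice[OF this] obtain U where "\<forall>x\<in>K. Q x (U x)" by blast
  then have U: "\<And>x. x \<in> K \<Longrightarrow> open (U x)" "\<And>x. x \<in> K \<Longrightarrow> x \<in> U x" "\<And>x. x \<in> K \<Longrightarrow> U x \<subseteq> V x"
    "\<And>x. x \<in> K \<Longrightarrow> \<forall>\<^sub>F w in F. finite {y \<in> U x. c y w \<noteq> 0} \<and> (\<Sum>y | y \<in> U x \<and> c y w \<noteq> 0. c y w) = m x"
    unfolding Q_def by blast+
  \<comment> \<open>The finite subcover confines all solutions in \<open>K\<close>: one of them in
    \<open>U x\<close> forces \<open>m x \<noteq> 0\<close>, so every solution is close to a point
    of \<open>Z\<close>.\<close>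
  obtain T where T: "T \<subseteq> K" "finite T" "K \<subseteq> (\<Union>x\<in>T. U x)"
  proof -
    have "K \<subseteq> (\<Union>x\<in>K. U x)" using U by blast
    then show ?thesis using compactE_image[OF K(1), of K U] U that by metis
  qed
  have "\<forall>\<^sub>F w in F. \<forall>x\<in>T \<union> Z. finite {y \<in> U x. c y w \<noteq> 0} \<and> (\<Sum>y | y \<in> U x \<and> c y w \<noteq> 0. c y w) = m x"
    using T Z U(4) by (intro eventually_ball_finite) auto
  then have ev: "\<forall>\<^sub>F w in F. finite {y \<in> D. c y w \<noteq> 0} \<and> (\<forall>y\<in>K. c y w \<noteq> 0 \<longrightarrow> (\<exists>x\<in>Z. y \<in> U x)) \<and>
      (\<forall>x\<in>Z. finite {y \<in> U x. c y w \<noteq> 0} \<and> (\<Sum>y | y \<in> U x \<and> c y w \<noteq> 0. c y w) = m x)"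
  proof eventually_elim
    case (elim w)
    have "{y \<in> D. c y w \<noteq> 0} \<subseteq> (\<Union>x\<in>T. {y \<in> U x. c y w \<noteq> 0})" using T K by blast
    then have "finite {y \<in> D. c y w \<noteq> 0}" using T elim finite_subset by (metis (no_types, lifting) UnCI finite_UN_I)
    moreover have "\<exists>x\<in>Z. y \<in> U x" if y: "y \<in> K" "c y w \<noteq> 0" for y
    proof -
      obtain x where x: "x \<in> T" "y \<in> U x" using T y by blast
      have "finite {y \<in> U x. c y w \<noteq> 0}" "(\<Sum>y | y \<in> U x \<and> c y w \<noteq> 0. c y w) = m x" using elim x by auto
      then have "m x \<noteq> 0"
        using member_le_sum[of y "{y \<in> U x. c y w \<noteq> 0}" "\<lambda>y. c y w"] x y by auto
      then have "x \<in> Z" using x T by (auto simp: Z_def)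
      then show ?thesis using x by blast
    qed
    ultimately show ?case using elim by blast
  qed
  \<comment> \<open>If nothing is gained in passing to \<open>w\<close>, all solutions in
    \<open>D\<close> lie in the balls removed here, which are compact subsets of
    \<open>D\<close>.\<close>
  define U' where "U' = - (\<Union>x\<in>ZD. cball x (min e (\<rho> x)))"
  show ?thesis
  proof (rule that[of U'])
    show "open U'" unfolding U'_def using Z by (intro open_Compl closed_UN) auto
    have "cball x (min e (\<rho> x)) \<subseteq> D" if "x \<in> ZD" for x
      using \<rho>(2)[of x] that by (auto simp: ZD_def)
    then show "K - D \<subseteq> U'" unfolding U'_def by blast
    from ev show "\<forall>\<^sub>F w in F. finite {y \<in> D. c y w \<noteq> 0} \<and>
       (\<Sum>y | y \<in> D \<and> m y \<noteq> 0. m y) \<le> (\<Sum>y | y \<in> D \<and> c y w \<noteq> 0. c y w) \<and>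
       ((\<Sum>y | y \<in> D \<and> m y \<noteq> 0. m y) = (\<Sum>y | y \<in> D \<and> c y w \<noteq> 0. c y w) \<longrightarrow> (\<forall>y\<in>D \<inter> U'. c y w = 0)) \<and>
       ((\<forall>y\<in>D \<inter> U0. c y w = 0) \<longrightarrow> (\<Sum>y | y \<in> D \<and> m y \<noteq> 0. m y) = (\<Sum>y | y \<in> D \<and> c y w \<noteq> 0. c y w))"
    proof eventually_elim
      case (elim w)
      define E where "E = {y. y \<in> D \<and> c y w \<noteq> 0}"
      \<comment> \<open>Solutions near limit points inside \<open>D\<close>; their total is the
        limit count. So \<open>E - A\<close> carries the excess, made of solutions near limit points
        in \<open>K - D\<close>.\<close>
      define A where "A = (\<Union>x\<in>ZD. {y. y \<in> U x \<and> c y w \<noteq> 0})"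
      have UD: "U x \<subseteq> D \<and> U x \<subseteq> cball x (min e (\<rho> x))" if "x \<in> ZD" for x
      proof -
        have x: "x \<in> D" "x \<in> K" using that K by (auto simp: ZD_def)
        have "U x \<subseteq> ball x (min e (\<rho> x))" using U(3)[OF x(2)] x(1) by (simp add: V_def)
        then show ?thesis using \<rho>(2)[OF x(1)] by force
      qed
      have AE: "A \<subseteq> E" unfolding A_def E_def using UD by blast
      have fE: "finite E" using elim by (simp add: E_def)
      have disj: "{y. y \<in> U x \<and> c y w \<noteq> 0} \<inter> {y. y \<in> U x' \<and> c y w \<noteq> 0} = {}"
        if "x \<in> ZD" "x' \<in> ZD" "x \<noteq> x'" for x x'
        using e(2)[of x x'] that Z(2,3) U(3) V(3) by blast
      have "sum (\<lambda>y. c y w) A = (\<Sum>x\<in>ZD. \<Sum>y | y \<in> U x \<and> c y w \<noteq> 0. c y w)"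
        unfolding A_def using Z elim disj by (intro sum.UNION_disjoint) auto
      also have "\<dots> = (\<Sum>x\<in>ZD. m x)" using elim Z(3) by (intro sum.cong) auto
      finally have sA: "sum (\<lambda>y. c y w) A = sum m ZD" .
      have sE: "sum (\<lambda>y. c y w) E = sum m ZD + sum (\<lambda>y. c y w) (E - A)"
        using sum.subset_diff[OF AE fE, of "\<lambda>y. c y w"] sA by simp
      have 1: "c y w = 0" if "sum m ZD = sum (\<lambda>y. c y w) E" "y \<in> D \<inter> U'" for y
      proof (rule ccontr)
        assume "c y w \<noteq> 0"
        moreover have "y \<notin> A" using that(2) UD unfolding A_def U'_def by blast
        ultimately have "y \<in> E - A" using that by (auto simp: E_def)
        moreover have "sum (\<lambda>y. c y w) (E - A) = 0" using sE that(1) by simp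
        ultimately show False using fE \<open>c y w \<noteq> 0\<close> by simp
      qed
      have 2: "sum m ZD = sum (\<lambda>y. c y w) E" if none: "\<forall>y\<in>D \<inter> U0. c y w = 0"
      proof -
        have "y \<in> A" if y: "y \<in> E" for y
        proof -
          have "y \<in> K" "c y w \<noteq> 0" "y \<in> D" using y K by (auto simp: E_def)
          then obtain x where x: "x \<in> Z" "y \<in> U x" using elim by blast
          have "x \<in> D"
          proof (rule ccontr)
            assume "x \<notin> D"
            then have "V x \<subseteq> U0" by (simp add: V_def)
            moreover have "x \<in> K" using x Z by blast
            ultimately have "y \<in> U0" using x U(3) by blast
            then have "y \<in> D \<inter> U0" using \<open>y \<in> D\<close> by blast
            with none have "c y w = 0" by blast
            with \<open>c y w \<noteq> 0\<close> show False by contradiction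
          qed
          then have "x \<in> ZD" using x by (auto simp: Z_def ZD_def)
          then show ?thesis using x \<open>c y w \<noteq> 0\<close> by (auto simp: A_def)
        qed
        then have "E = A" using AE by blast
        then show ?thesis using sA by simp
      qed
      have "sum m ZD \<le> sum (\<lambda>y. c y w) E" using sE by simp
      then show ?case using fE 1 2 unfolding E_def[symmetric] ZD_def[symmetric] by blast
    qed
  qed
qed

lemma finite_sum_zeroI:
  assumes "\<forall>\<^sub>F w in F. \<forall>y\<in>U. c y w = (0::nat)"
  shows "\<forall>\<^sub>F w in F. finite {y \<in> U. c y w \<noteq> 0} \<and> (\<Sum>y | y \<in> U \<and> c y w \<noteq> 0. c y w) = 0"
  using assms
proof eventually_elim
  case (elim w)
  then have "{y \<in> U. c y w \<noteq> 0} = {}" by auto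
  then show ?case by (simp only: finite.emptyI sum.empty simp_thms)
qed

section \<open>Multiplicities and pole orders of a nonconstant meromorphic function\<close>

locale nonconstant_meromorphic =
  fixes f :: "complex \<Rightarrow> complex" and G P :: "complex set"
  assumes G: "open G" "connected G" and mero: "meromorphic_with_poles f G P"
    and nonconst: "\<not> f constant_on (G - P)"
begin

lemma sparse: "P sparse_in G" and PG: "P \<subseteq> G" and hol: "f holomorphic_on (G - P)"
  and pole: "p \<in> P \<Longrightarrow> is_pole f p"
  using mero sparse_in_open[OF G(1)] by (auto simp: meromorphic_with_poles_def is_pole_def)

lemma open_GP: "open (G - P)" and connected_GP: "connected (G - P)"
  using open_diff_sparse_pts[OF G(1) sparse] sparse_imp_connected[OF _ G(2,1) sparse] by auto

lemma cont: "continuous_on (G - P) f"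
  using hol holomorphic_on_imp_continuous_on by blast

lemma open_preimage: "open B \<Longrightarrow> open {y \<in> G - P. f y \<in> B}"
  using continuous_open_preimage[OF cont open_GP, of B] by (simp add: vimage_def Int_def)

text \<open>The case distinction discards the arbitrary value of \<open>f\<close> at a pole, which
  might happen to equal \<open>w\<close>.\<close>

definition pmult :: "complex \<Rightarrow> complex \<Rightarrow> nat" where
  "pmult y w = (if y \<in> P then 0 else mult_at f w y)"

definition porder :: "complex \<Rightarrow> nat" where
  "porder p = (if p \<in> P then nat (- zorder f p) else 0)"

lemmas order_at = nonconstant_has_order[OF hol open_GP connected_GP nonconst]

lemma pmult_eq_0_iff: "y \<in> G \<Longrightarrow> pmult y w = 0 \<longleftrightarrow> y \<in> P \<or> f y \<noteq> w"
  using order_at(2)[of y w] by (auto simp: pmult_def)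

lemma pmult_pos_iff: "y \<in> G \<Longrightarrow> pmult y w > 0 \<longleftrightarrow> y \<notin> P \<and> f y = w"
  using pmult_eq_0_iff[of y w] by auto

lemma pole_nbhd:
  assumes p: "p \<in> P" and V: "open V" "p \<in> V"
  obtains e where "e > 0" "ball p e \<subseteq> V \<inter> G" "ball p e \<inter> P = {p}" "\<And>y. y \<in> ball p e - {p} \<Longrightarrow> cmod (f y) > b"
proof -
  have "\<forall>\<^sub>F y in at p. max b 0 + 1 \<le> cmod (f y)"
    using pole[OF p] unfolding is_pole_def filterlim_at_infinity[OF order_refl] by auto
  moreover have "\<forall>\<^sub>F y in at p. y \<in> V \<inter> G"
    using V p PG G by (intro eventually_at_in_open') auto
  moreover have "\<forall>\<^sub>F y in at p. y \<notin> P"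
    using sparse p PG by (metis islimpt_iff_eventually sparse_in_open[OF G(1)] subsetD)
  ultimately have "\<forall>\<^sub>F y in at p. b + 1 \<le> cmod (f y) \<and> y \<in> V \<inter> G \<and> y \<notin> P" by eventually_elim auto
  then obtain e where e: "e > 0" "\<And>y. y \<noteq> p \<Longrightarrow> dist y p < e \<Longrightarrow> b + 1 \<le> cmod (f y) \<and> y \<in> V \<inter> G \<and> y \<notin> P"
    unfolding eventually_at by blast
  show ?thesis
  proof (rule that[OF e(1)])
    have "y \<in> V \<inter> G \<and> (y \<in> P \<longrightarrow> y = p)" if "y \<in> ball p e" for y
      using e(2)[of y] that V p PG by (cases "y = p") (auto simp: dist_commute)
    then show "ball p e \<subseteq> V \<inter> G" "ball p e \<inter> P = {p}" using e(1) p by auto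
    show "cmod (f y) > b" if "y \<in> ball p e - {p}" for y
      using e(2)[of y] that by (auto simp: dist_commute)
  qed
qed

text \<open>The reciprocal \<open>g\<close>, set to 0 at \<open>p\<close>, is holomorphic with a
  zero there. Its local degree over values near 0 becomes a count for \<open>f\<close> near infinity
  under inversion of the value.\<close>

lemma pole_order:
  assumes p: "p \<in> P" and V: "open V" "p \<in> V"
  shows "has_order f p (- int (porder p))" "porder p > 0"
    "\<exists>U. open U \<and> p \<in> U \<and> U \<subseteq> V \<inter> G \<and> (\<forall>\<^sub>F w in at_infinity. finite {y \<in> U. pmult y w \<noteq> 0} \<and>
       (\<Sum>y | y \<in> U \<and> pmult y w \<noteq> 0. pmult y w) = porder p)"
proof -
  obtain e where e: "e > 0" "ball p e \<subseteq> V \<inter> G" "ball p e \<inter> P = {p}" "\<And>y. y \<in> ball p e - {p} \<Longrightarrow> cmod (f y) > 0"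
    using pole_nbhd[OF p V] by metis
  define g where "g = (\<lambda>y. if y = p then 0 else inverse (f y))"
  have sub: "ball p e - {p} \<subseteq> G - P" using e by auto
  have holb: "f holomorphic_on ball p e - {p}" using hol sub holomorphic_on_subset by blast
  have holg: "g holomorphic_on ball p e" unfolding g_def
    using e holb pole[OF p] by (intro is_pole_inverse_holomorphic) auto
  have fnz: "f y \<noteq> 0" if "y \<in> ball p e" "y \<noteq> p" for y using e(4)[of y] that by auto
  have ncg: "\<not> g constant_on ball p e"
  proof
    assume "g constant_on ball p e"
    then obtain k where k: "\<And>y. y \<in> ball p e \<Longrightarrow> g y = k" unfolding constant_on_def by blast
    have q: "p + of_real (e/2) \<in> ball p e" "p + of_real (e/2) \<noteq> p" using e(1) by (auto simp: dist_norm)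
    have "g (p + of_real (e/2)) \<noteq> 0" unfolding g_def using fnz[OF q] q(2) by (simp only: if_False) simp
    moreover have "g (p + of_real (e/2)) = k" using k[OF q(1)] .
    moreover have "g p = k" using k[of p] e(1) by simp
    ultimately show False by (simp add: g_def)
  qed
  note og = nonconstant_has_order[OF holg open_ball connected_ball ncg]
  have pb: "p \<in> ball p e" using e by simp
  have n0: "has_order g p (int (mult_at g 0 p))" "mult_at g 0 p \<noteq> 0"
    using og(1,2)[OF pb, of 0] by (auto simp: g_def)
  have "has_order (\<lambda>y. inverse (g y)) p (- int (mult_at g 0 p))" using has_order_inverse[OF n0(1)] .
  moreover have "\<forall>\<^sub>F y in at p. inverse (g y) = f y"
    using eventually_neq_at_within[of p p UNIV] by eventually_elim (simp add: g_def)
  ultimately have o: "has_order f p (- int (mult_at g 0 p))" by (rule has_order_cong[rotated])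
  have po: "porder p = mult_at g 0 p" using zorder_eq_if_has_order[OF o] p by (simp add: porder_def)
  show "has_order f p (- int (porder p))" "porder p > 0" using o n0 po by auto
  obtain U where U: "open U" "p \<in> U" "U \<subseteq> ball p e \<inter> UNIV"
    "\<forall>\<^sub>F v in nhds (g p). finite {y \<in> U. g y = v} \<and> (\<Sum>y | y \<in> U \<and> g y = v. mult_at g v y) = mult_at g (g p) p"
    by (rule local_degree[OF holg open_ball connected_ball ncg pb open_UNIV UNIV_I], rule that; assumption)
  have gp: "g p = 0" by (simp add: g_def)
  have "\<forall>\<^sub>F w in at_infinity. finite {y \<in> U. g y = inverse w} \<and> (\<Sum>y | y \<in> U \<and> g y = inverse w. mult_at g (inverse w) y) = mult_at g 0 p"
    using eventually_compose_filterlim[OF U(4)[unfolded gp] tendsto_inverse_0] .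
  moreover have "\<forall>\<^sub>F w::complex in at_infinity. w \<noteq> 0" using eventually_not_equal_at_infinity by blast
  ultimately have "\<forall>\<^sub>F w in at_infinity. finite {y \<in> U. pmult y w \<noteq> 0} \<and>
       (\<Sum>y | y \<in> U \<and> pmult y w \<noteq> 0. pmult y w) = porder p"
  proof eventually_elim
    case (elim w)
    have eq: "pmult y w \<noteq> 0 \<longleftrightarrow> g y = inverse w" if "y \<in> U" for y
    proof -
      have y: "y \<in> ball p e" using that U by blast
      show ?thesis
      proof (cases "y = p")
        case True
        then show ?thesis using elim p by (simp add: pmult_def g_def)
      next
        case False
        then have "y \<in> G - P" using y sub by blast
        then show ?thesis using False pmult_eq_0_iff[of y w] by (auto simp: g_def)
      qed
    qed
    have m: "mult_at g (inverse w) y = pmult y w" if y: "y \<in> U" "g y = inverse w" for y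
    proof -
      have yb: "y \<in> ball p e" and yp: "y \<noteq> p" using y U elim by (auto simp: g_def)
      have yP: "y \<in> G - P" using yb yp sub by blast
      have 1: "has_order (\<lambda>x. g x - inverse w) y (int (mult_at g (inverse w) y))" using og(1)[OF yb] .
      have an: "f analytic_on {y}" using hol open_GP yP analytic_at by blast
      \<comment> \<open>Since \<open>f - w = (1/f - 1/w) * (- w * f)\<close> and the last factor is
        nonzero at \<open>y\<close>, the multiplicities of \<open>y\<close> for \<open>f\<close>
        over \<open>w\<close> and for \<open>g\<close> over \<open>1/w\<close> agree.\<close>
      have 2: "has_order (\<lambda>x. - (w * f x)) y 0"
        using an fnz[OF yb yp] elim by (intro has_order_analytic analytic_intros) auto
      have ev: "\<forall>\<^sub>F x in at y. (g x - inverse w) * (- (w * f x)) = f x - w"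
      proof -
        have "\<forall>\<^sub>F x in at y. x \<in> ball p e - {p}" using yb yp by (intro eventually_at_in_open') auto
        then show ?thesis
        proof eventually_elim
          case (elim x)
          then show ?case using fnz[of x] \<open>w \<noteq> 0\<close> by (simp add: g_def field_simps)
        qed
      qed
      have "has_order (\<lambda>x. f x - w) y (int (mult_at g (inverse w) y))"
        using has_order_cong[OF ev has_order_mult[OF 1 2]] by simp
      then show ?thesis using mult_at_eqI yP by (simp add: pmult_def)
    qed
    have "{y. y \<in> U \<and> pmult y w \<noteq> 0} = {y. y \<in> U \<and> g y = inverse w}" using eq by blast
    then show ?case using elim m po by simp
  qed
  then show "\<exists>U. open U \<and> p \<in> U \<and> U \<subseteq> V \<inter> G \<and> (\<forall>\<^sub>F w in at_infinity. finite {y \<in> U. pmult y w \<noteq> 0} \<and>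
       (\<Sum>y | y \<in> U \<and> pmult y w \<noteq> 0. pmult y w) = porder p)"
    using U e by blast
qed

text \<open>The local hypothesis of \<open>eventually_count\<close> along
  \<open>at_infinity\<close>, with \<open>porder\<close> as limit multiplicity. Near a point that is
  not a pole \<open>f\<close> is bounded and misses all large values.\<close>

lemma local_count_infinity:
  assumes x: "x \<in> G" and V: "open V" "x \<in> V"
  shows "\<exists>U. open U \<and> x \<in> U \<and> U \<subseteq> V \<inter> G \<and> (\<forall>\<^sub>F w in at_infinity. finite {y \<in> U. pmult y w \<noteq> 0} \<and>
       (\<Sum>y | y \<in> U \<and> pmult y w \<noteq> 0. pmult y w) = porder x)"
proof (cases "x \<in> P")
  case True
  then show ?thesis using pole_order(3)[OF True V] by blast
next
  case False
  define U where "U = {y \<in> G - P. f y \<in> ball (f x) 1} \<inter> V"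
  have "open U" unfolding U_def by (intro open_Int open_preimage open_ball V(1))
  moreover have "\<forall>\<^sub>F w in at_infinity. \<forall>y\<in>U. pmult y w = 0"
    unfolding eventually_at_infinity
  proof (intro exI allI impI ballI)
    fix w y assume w: "cmod (f x) + 1 \<le> cmod w" and y: "y \<in> U"
    have "cmod (f y) < cmod (f x) + 1" using y norm_triangle_sub[of "f y" "f x"]
      by (auto simp: U_def dist_norm norm_minus_commute)
    then have "f y \<noteq> w" using w by auto
    then show "pmult y w = 0" using y pmult_eq_0_iff by (auto simp: U_def)
  qed
  ultimately show ?thesis using x V False finite_sum_zeroI[of U pmult at_infinity]
    by (intro exI[of _ U]) (auto simp: U_def porder_def)
qed

text \<open>The same hypothesis along \<open>nhds w0\<close>. Only points with value
  \<open>w0\<close> need the local degree; near poles and near points with another value, values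
  close to \<open>w0\<close> are not taken.\<close>

lemma local_count:
  assumes x: "x \<in> G" and V: "open V" "x \<in> V"
  shows "\<exists>U. open U \<and> x \<in> U \<and> U \<subseteq> V \<inter> G \<and> (\<forall>\<^sub>F w in nhds w0. finite {y \<in> U. pmult y w \<noteq> 0} \<and>
       (\<Sum>y | y \<in> U \<and> pmult y w \<noteq> 0. pmult y w) = pmult x w0)"
proof (cases "x \<in> P")
  case True
  obtain e where e: "e > 0" "ball x e \<subseteq> V \<inter> G" "ball x e \<inter> P = {x}" "\<And>y. y \<in> ball x e - {x} \<Longrightarrow> cmod (f y) > cmod w0 + 1"
    using pole_nbhd[OF True V] by metis
  have "\<forall>\<^sub>F w in nhds w0. w \<in> ball w0 1" by (intro eventually_nhds_in_open) auto
  then have "\<forall>\<^sub>F w in nhds w0. \<forall>y\<in>ball x e. pmult y w = 0"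
  proof eventually_elim
    case (elim w)
    have w: "cmod w < cmod w0 + 1" using elim norm_triangle_sub[of w w0] by (auto simp: dist_norm norm_minus_commute)
    show ?case
    proof
      fix y assume y: "y \<in> ball x e"
      show "pmult y w = 0"
      proof (cases "y = x")
        case True
        then show ?thesis using \<open>x \<in> P\<close> by (simp add: pmult_def)
      next
        case False
        then have "f y \<noteq> w" using e(4)[of y] y w by auto
        then show ?thesis using pmult_eq_0_iff e(2) y by blast
      qed
    qed
  qed
  then show ?thesis using e True finite_sum_zeroI[of "ball x e" pmult "nhds w0"]
    by (intro exI[of _ "ball x e"]) (auto simp: pmult_def)
next
  case False
  then have xGP: "x \<in> G - P" using x by simp
  show ?thesis
  proof (cases "f x = w0")
    case True
    obtain U where U: "open U" "x \<in> U" "U \<subseteq> (G - P) \<inter> V"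
      "\<forall>\<^sub>F w in nhds (f x). finite {y \<in> U. f y = w} \<and> (\<Sum>y | y \<in> U \<and> f y = w. mult_at f w y) = mult_at f (f x) x"
      by (rule local_degree[OF hol open_GP connected_GP nonconst xGP V], rule that; assumption)
    have "{y. y \<in> U \<and> pmult y w \<noteq> 0} = {y. y \<in> U \<and> f y = w}" for w
      by (rule Collect_cong) (use U(3) in \<open>auto simp: pmult_pos_iff subset_iff\<close>)
    moreover have "(\<Sum>y | y \<in> U \<and> f y = w. mult_at f w y) = (\<Sum>y | y \<in> U \<and> f y = w. pmult y w)" for w
      using U(3) by (intro sum.cong) (auto simp: pmult_def)
    ultimately show ?thesis using U True False
      by (intro exI[of _ U]) (auto simp: pmult_def)
  next
    case ne: False
    define d where "d = dist (f x) w0 / 2"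
    have d: "d > 0" using ne by (simp add: d_def)
    define U where "U = {y \<in> G - P. f y \<in> ball (f x) d} \<inter> V"
    have "open U" unfolding U_def by (intro open_Int open_preimage open_ball V(1))
    moreover have "\<forall>\<^sub>F w in nhds w0. w \<in> ball w0 d" using d by (intro eventually_nhds_in_open) auto
    then have "\<forall>\<^sub>F w in nhds w0. \<forall>y\<in>U. pmult y w = 0"
    proof eventually_elim
      case (elim w)
      have "ball (f x) d \<inter> ball w0 d = {}" by (intro disjoint_ballI) (simp add: d_def)
      then show ?case using elim pmult_eq_0_iff unfolding U_def by blast
    qed
    ultimately show ?thesis using x V False ne d finite_sum_zeroI[of U pmult "nhds w0"] pmult_eq_0_iff[OF x, of w0]
      by (intro exI[of _ U]) (auto simp: U_def)
  qed
qed

lemma finite_pmult: assumes "compact K" "K \<subseteq> G" shows "finite {y \<in> K. pmult y w \<noteq> 0}"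
proof -
  have "finite ({y. pmult y w \<noteq> 0} \<inter> K)"
  proof (rule finite_Int_compact[OF assms(1)])
    fix x assume "x \<in> K"
    then obtain U where U: "open U" "x \<in> U" "\<forall>\<^sub>F v in nhds w. finite {y \<in> U. pmult y v \<noteq> 0} \<and>
       (\<Sum>y | y \<in> U \<and> pmult y v \<noteq> 0. pmult y v) = pmult x w"
      using local_count[of x UNIV w] assms by blast
    have "finite {y \<in> U. pmult y w \<noteq> 0}" using eventually_nhds_x_imp_x[OF U(3)] by blast
    then show "\<exists>U. open U \<and> x \<in> U \<and> finite ({y. pmult y w \<noteq> 0} \<inter> U)"
      using U by (intro exI[of _ U]) (simp add: Int_def conj_commute)
  qed
  then show ?thesis by (simp add: Int_def conj_commute)
qed

lemma finite_poles: assumes "compact K" "K \<subseteq> G" shows "finite (K \<inter> P)"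
  using sparse_in_compact_finite[OF sparse_in_subset[OF sparse assms(2)] assms(1)] .

lemma porder_eq_0_iff: "porder p = 0 \<longleftrightarrow> p \<notin> P"
  using pole_order(2)[of p UNIV] by (auto simp: porder_def)

end

locale meromorphic_on_compact = nonconstant_meromorphic +
  fixes D K :: "complex set"
  assumes K: "compact K" "K \<subseteq> G" and D: "open D" "D \<subseteq> K"
begin

definition N :: "complex \<Rightarrow> nat" where "N w = (\<Sum>y | y \<in> D \<and> pmult y w \<noteq> 0. pmult y w)"

definition Ninf :: nat where "Ninf = (\<Sum>y | y \<in> D \<and> porder y \<noteq> 0. porder y)"

lemma DG: "D \<subseteq> G" using K D by blast

lemma count_preimages_eq: "count_preimages f P D w = enat (N w)"
proof -
  have eq: "{z \<in> D - P. f z = w} = {y. y \<in> D \<and> pmult y w \<noteq> 0}"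
    using DG by (auto simp: pmult_pos_iff subset_iff)
  have fin: "finite {y. y \<in> D \<and> pmult y w \<noteq> 0}"
    using D by (intro finite_subset[OF _ finite_pmult[OF K, of w]]) auto
  have "(\<Sum>z | z \<in> D \<and> pmult z w \<noteq> 0. zero_mult (\<lambda>x. f x - w) z) = (\<Sum>z | z \<in> D \<and> pmult z w \<noteq> 0. enat (pmult z w))"
  proof (rule sum.cong[OF refl])
    fix z assume "z \<in> {y. y \<in> D \<and> pmult y w \<noteq> 0}"
    then have "z \<in> G - P" using eq DG by blast
    then show "zero_mult (\<lambda>x. f x - w) z = enat (pmult z w)" using order_at(3) by (simp add: pmult_def)
  qed
  also have "\<dots> = enat (N w)" unfolding N_def by (simp only: of_nat_eq_enat[symmetric] of_nat_sum)
  finally show ?thesis unfolding count_preimages_def Let_def eq using fin by (simp only: if_True)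
qed

lemma count_poles_eq: "count_poles f P D = enat Ninf"
proof -
  have eq: "P \<inter> D = {y. y \<in> D \<and> porder y \<noteq> 0}" using porder_eq_0_iff by auto
  have fin: "finite (P \<inter> D)"
    using D by (intro finite_subset[OF _ finite_poles[OF K]]) auto
  have "(\<Sum>z\<in>P \<inter> D. pole_mult f z) = (\<Sum>z\<in>P \<inter> D. enat (porder z))"
    using pole_mult_eq pole_order(1)[OF _ open_UNIV UNIV_I] by (intro sum.cong) auto
  then show ?thesis using fin by (simp add: count_poles_def eq Ninf_def of_nat_eq_enat[symmetric] del: of_nat_eq_enat)
qed

text \<open>Lower semicontinuity together with a two-way link between jumps and the boundary:
  absence of solutions in the given collar \<open>U0\<close> rules out a jump, and absence of a jump
  clears some collar \<open>U'\<close> of solutions. The two implications serve opposite directions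
  of the equivalence.\<close>

lemma eventually_N:
  assumes "open U0" "K - D \<subseteq> U0"
  obtains U' where "open U'" "K - D \<subseteq> U'"
    "\<forall>\<^sub>F w in nhds w0. N w0 \<le> N w \<and>
       (N w0 = N w \<longrightarrow> (\<forall>y\<in>D \<inter> U'. pmult y w = 0)) \<and>
       ((\<forall>y\<in>D \<inter> U0. pmult y w = 0) \<longrightarrow> N w0 = N w)"
proof -
  have "\<exists>U. open U \<and> x \<in> U \<and> U \<subseteq> V \<and> (\<forall>\<^sub>F w in nhds w0. finite {y \<in> U. pmult y w \<noteq> 0} \<and>
       (\<Sum>y | y \<in> U \<and> pmult y w \<noteq> 0. pmult y w) = pmult x w0)" if "x \<in> K" "open V" "x \<in> V" for x V
    using local_count[of x V w0] that K by blast
  from eventually_count[OF K(1) D assms finite_pmult[OF K] this] obtain U' where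
    U': "open U'" "K - D \<subseteq> U'" "\<forall>\<^sub>F w in nhds w0. finite {y \<in> D. pmult y w \<noteq> 0} \<and> N w0 \<le> N w \<and>
       (N w0 = N w \<longrightarrow> (\<forall>y\<in>D \<inter> U'. pmult y w = 0)) \<and>
       ((\<forall>y\<in>D \<inter> U0. pmult y w = 0) \<longrightarrow> N w0 = N w)"
    unfolding N_def by blast
  from U'(3) have "\<forall>\<^sub>F w in nhds w0. N w0 \<le> N w \<and>
       (N w0 = N w \<longrightarrow> (\<forall>y\<in>D \<inter> U'. pmult y w = 0)) \<and>
       ((\<forall>y\<in>D \<inter> U0. pmult y w = 0) \<longrightarrow> N w0 = N w)" by eventually_elim blast
  with U' show ?thesis using that by blast
qed

lemma eventually_Ninf:
  assumes "open U0" "K - D \<subseteq> U0"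
  obtains U' where "open U'" "K - D \<subseteq> U'"
    "\<forall>\<^sub>F w in at_infinity. Ninf \<le> N w \<and>
       (Ninf = N w \<longrightarrow> (\<forall>y\<in>D \<inter> U'. pmult y w = 0)) \<and>
       ((\<forall>y\<in>D \<inter> U0. pmult y w = 0) \<longrightarrow> Ninf = N w)"
proof -
  have "\<exists>U. open U \<and> x \<in> U \<and> U \<subseteq> V \<and> (\<forall>\<^sub>F w in at_infinity. finite {y \<in> U. pmult y w \<noteq> 0} \<and>
       (\<Sum>y | y \<in> U \<and> pmult y w \<noteq> 0. pmult y w) = porder x)" if "x \<in> K" "open V" "x \<in> V" for x V
    using local_count_infinity[of x V] that K by blast
  moreover have "finite {y \<in> K. porder y \<noteq> 0}"
    using finite_poles[OF K] by (simp add: porder_eq_0_iff Int_def)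
  ultimately obtain U' where
    U': "open U'" "K - D \<subseteq> U'" "\<forall>\<^sub>F w in at_infinity. finite {y \<in> D. pmult y w \<noteq> 0} \<and> Ninf \<le> N w \<and>
       (Ninf = N w \<longrightarrow> (\<forall>y\<in>D \<inter> U'. pmult y w = 0)) \<and>
       ((\<forall>y\<in>D \<inter> U0. pmult y w = 0) \<longrightarrow> Ninf = N w)"
    using eventually_count[OF K(1) D assms, of porder pmult at_infinity] unfolding N_def Ninf_def by blast
  from U'(3) have "\<forall>\<^sub>F w in at_infinity. Ninf \<le> N w \<and>
       (Ninf = N w \<longrightarrow> (\<forall>y\<in>D \<inter> U'. pmult y w = 0)) \<and>
       ((\<forall>y\<in>D \<inter> U0. pmult y w = 0) \<longrightarrow> Ninf = N w)" by eventually_elim blast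
  with U' show ?thesis using that by blast
qed

end

subsection \<open>Regular points on the curve\<close>

text \<open>\<open>\<kappa>\<close> is the inverse chart. Derivatives are recorded at the base
  points only, which suffices to compare directions of arcs through \<open>z0\<close>.\<close>

definition jordan_chart ::
  "complex set \<Rightarrow> complex \<Rightarrow> (complex \<Rightarrow> complex) \<Rightarrow> (complex \<Rightarrow> complex) \<Rightarrow> real \<Rightarrow> complex \<Rightarrow> bool" where
  "jordan_chart S z0 F \<kappa> r c \<longleftrightarrow> r > 0 \<and> c \<noteq> 0 \<and> F 0 = z0 \<and> open (F ` ball 0 r) \<and>
     homeomorphism (ball 0 r) (F ` ball 0 r) F \<kappa> \<and>
     (F has_field_derivative c) (at 0) \<and> (\<kappa> has_field_derivative inverse c) (at z0) \<and>
     (\<forall>z\<in>ball 0 r. (F z \<in> S \<longleftrightarrow> Im z = 0) \<and> (F z \<in> inside S \<longleftrightarrow> Im z > 0) \<and> (F z \<in> outside S \<longleftrightarrow> Im z < 0))"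

lemma jordan_chart_exists:
  assumes "smooth_jordan_curve S" "z0 \<in> S"
  obtains F \<kappa> r c where "jordan_chart S z0 F \<kappa> r c"
proof -
  obtain F r c where F: "r > 0" "c \<noteq> 0" "F 0 = z0" "continuous_on (ball 0 r) F" "inj_on F (ball 0 r)"
    "(F has_derivative (\<lambda>h. c * h)) (at 0)" "\<And>z. z \<in> ball 0 r \<Longrightarrow> F z \<in> S \<longleftrightarrow> Im z = 0"
    "\<And>z. z \<in> ball 0 r \<Longrightarrow> F z \<in> inside S \<longleftrightarrow> Im z > 0"
    "\<And>z. z \<in> ball 0 r \<Longrightarrow> F z \<in> outside S \<longleftrightarrow> Im z < 0"
    by (rule smooth_jordan_curve_chart[OF assms], rule that; assumption)
  obtain \<kappa> where \<kappa>: "homeomorphism (ball 0 r) (F ` ball 0 r) F \<kappa>"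
    using invariance_of_domain_homeomorphism[OF open_ball F(4) _ F(5)] by auto
  have op: "open (F ` ball 0 r)" using invariance_of_domain[OF F(4) open_ball F(5)] .
  have z0: "z0 \<in> F ` ball 0 r" using F(1,3) by force
  have dF: "(F has_field_derivative c) (at 0)" using F(6) by (simp add: has_field_derivative_def)
  have \<kappa>z: "\<kappa> z0 = 0" using \<kappa> F(1,3) by (metis centre_in_ball homeomorphism_apply1)
  have "(\<kappa> has_field_derivative inverse c) (at z0)"
  proof (rule has_field_derivative_inverse_basic[OF _ F(2) _ op z0])
    show "(F has_field_derivative c) (at (\<kappa> z0))" using dF \<kappa>z by simp
    show "continuous (at z0) \<kappa>" using \<kappa> op z0
      by (metis continuous_on_eq_continuous_at homeomorphism_def)
    show "F (\<kappa> z) = z" if "z \<in> F ` ball 0 r" for z using \<kappa> that homeomorphism_apply2 by metis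
  qed
  then show ?thesis using that[of F \<kappa> r c] F(1-3,7-9) op \<kappa> dF unfolding jordan_chart_def by blast
qed

lemma jordan_chartD:
  assumes "jordan_chart S z0 F \<kappa> r c"
  shows "r > 0" "c \<noteq> 0" "F 0 = z0" "open (F ` ball 0 r)" "z0 \<in> F ` ball 0 r" "\<kappa> z0 = 0"
    "continuous_on (ball 0 r) F" "continuous_on (F ` ball 0 r) \<kappa>"
    "\<And>z. z \<in> ball 0 r \<Longrightarrow> \<kappa> (F z) = z" "\<And>w. w \<in> F ` ball 0 r \<Longrightarrow> F (\<kappa> w) = w"
    "\<And>w. w \<in> F ` ball 0 r \<Longrightarrow> \<kappa> w \<in> ball 0 r"
    "\<And>z. z \<in> ball 0 r \<Longrightarrow> F z \<in> S \<longleftrightarrow> Im z = 0"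
    "\<And>w. w \<in> F ` ball 0 r \<Longrightarrow> w \<in> S \<longleftrightarrow> Im (\<kappa> w) = 0"
    "\<And>z. z \<in> ball 0 r \<Longrightarrow> F z \<in> inside S \<longleftrightarrow> Im z > 0"
    "\<And>w. w \<in> F ` ball 0 r \<Longrightarrow> w \<in> inside S \<longleftrightarrow> Im (\<kappa> w) > 0"
    "\<And>w. w \<in> F ` ball 0 r \<Longrightarrow> w \<in> outside S \<longleftrightarrow> Im (\<kappa> w) < 0"
proof -
  have *: "r > 0" "c \<noteq> 0" "F 0 = z0" "open (F ` ball 0 r)" "homeomorphism (ball 0 r) (F ` ball 0 r) F \<kappa>"
    "\<And>z. z \<in> ball 0 r \<Longrightarrow> F z \<in> S \<longleftrightarrow> Im z = 0" "\<And>z. z \<in> ball 0 r \<Longrightarrow> F z \<in> inside S \<longleftrightarrow> Im z > 0"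
    "\<And>z. z \<in> ball 0 r \<Longrightarrow> F z \<in> outside S \<longleftrightarrow> Im z < 0"
    using assms unfolding jordan_chart_def by blast+
  show 1: "\<kappa> (F z) = z" if "z \<in> ball 0 r" for z using homeomorphism_apply1[OF *(5) that] .
  show "r > 0" "c \<noteq> 0" "F 0 = z0" "open (F ` ball 0 r)" by fact+
  show "z0 \<in> F ` ball 0 r" using *(1,3) by force
  show "\<kappa> z0 = 0" using 1[of 0] *(1,3) by simp
  show "continuous_on (ball 0 r) F" "continuous_on (F ` ball 0 r) \<kappa>" using *(5) homeomorphism_def by blast+
  show "F (\<kappa> w) = w" if "w \<in> F ` ball 0 r" for w using homeomorphism_apply2[OF *(5) that] .
  show "\<kappa> w \<in> ball 0 r" if "w \<in> F ` ball 0 r" for w using 1 that by auto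
  show "F z \<in> S \<longleftrightarrow> Im z = 0" "F z \<in> inside S \<longleftrightarrow> Im z > 0" if "z \<in> ball 0 r" for z using *(6,7) that by auto
  show "w \<in> S \<longleftrightarrow> Im (\<kappa> w) = 0" "w \<in> inside S \<longleftrightarrow> Im (\<kappa> w) > 0" "w \<in> outside S \<longleftrightarrow> Im (\<kappa> w) < 0"
    if "w \<in> F ` ball 0 r" for w using *(6-8) 1 that by auto
qed

text \<open>Caratheodory's form of the derivative: first-order expansions become exact identities
  with factors continuous at the base point, so they can be multiplied and composed without error
  terms.\<close>

lemma jordan_chart_quotients:
  assumes "jordan_chart S z0 F \<kappa> r c"
  obtains L K where "\<And>z. F z - z0 = L z * z" "isCont L 0" "L 0 = c"
    "\<And>z. \<kappa> z = K z * (z - z0)" "isCont K z0" "K z0 = inverse c"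
proof -
  have d: "(F has_field_derivative c) (at 0)" "(\<kappa> has_field_derivative inverse c) (at z0)"
    using assms unfolding jordan_chart_def by blast+
  obtain L where L: "\<And>z. F z - F 0 = L z * (z - 0)" "isCont L 0" "L 0 = c"
    using d(1) unfolding CARAT_DERIV by blast
  obtain K where K: "\<And>z. \<kappa> z - \<kappa> z0 = K z * (z - z0)" "isCont K z0" "K z0 = inverse c"
    using d(2) unfolding CARAT_DERIV by blast
  show ?thesis using that[of L K] L K jordan_chartD(3,6)[OF assms] by simp
qed

text \<open>After the zero of \<open>f - f z0\<close> is split off, the remaining factor is
  zero-free on a disk and has a logarithm there, hence an \<open>n\<close>-th root; \<open>k\<close>
  is \<open>z - z0\<close> times that root.\<close>

lemma local_power_form:
  assumes f: "f holomorphic_on V" "open V" "connected V" "\<not> f constant_on V" "z0 \<in> V"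
  obtains n k r where "n > 0" "r > 0" "ball z0 r \<subseteq> V" "k holomorphic_on ball z0 r" "k z0 = 0" "deriv k z0 \<noteq> 0"
    "inj_on k (ball z0 r)" "\<And>z. z \<in> ball z0 r \<Longrightarrow> f z - f z0 = k z ^ n" "n = 1 \<Longrightarrow> deriv f z0 \<noteq> 0"
proof -
  have hol: "(\<lambda>z. f z - f z0) holomorphic_on V" using f by (intro holomorphic_intros)
  have nc: "\<not> (\<lambda>x. f x - f z0) constant_on V"
    using f(4) unfolding constant_on_def by (metis diff_add_cancel)
  obtain g r n where g: "0 < n"  "0 < r"  "ball z0 r \<subseteq> V" "g holomorphic_on ball z0 r"
            "\<And>w. w \<in> ball z0 r \<Longrightarrow> f w - f z0 = (w - z0)^n * g w"
            "\<And>w. w \<in> ball z0 r \<Longrightarrow> g w \<noteq> 0"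
    by (rule holomorphic_factor_zero_nonconstant[OF hol f(2,3,5) diff_self nc], rule that; assumption)
  obtain l where l: "l holomorphic_on ball z0 r" "\<And>z. z \<in> ball z0 r \<Longrightarrow> g z = exp (l z)"
    using contractible_imp_holomorphic_log[OF g(4) convex_imp_contractible[OF convex_ball] g(6)] by metis
  define j where "j = (\<lambda>z. exp (l z / of_nat n))"
  define k where "k = (\<lambda>z. (z - z0) * j z)"
  have holj: "j holomorphic_on ball z0 r" unfolding j_def using l by (intro holomorphic_intros) (use g in auto)
  have holk: "k holomorphic_on ball z0 r" unfolding k_def using holj by (intro holomorphic_intros)
  have jn: "j z ^ n = g z" if "z \<in> ball z0 r" for z
    using l(2)[OF that] g(1) by (simp add: j_def exp_of_nat_mult[symmetric])
  have "(j has_field_derivative deriv j z0) (at z0)"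
    using holj g(2) by (meson centre_in_ball holomorphic_derivI open_ball)
  then have dk: "(k has_field_derivative j z0) (at z0)" unfolding k_def
    by (auto intro!: derivative_eq_intros)
  have dk0: "deriv k z0 \<noteq> 0" using DERIV_imp_deriv[OF dk] by (simp add: j_def)
  obtain r' where r': "r' > 0" "ball z0 r' \<subseteq> ball z0 r" "inj_on k (ball z0 r')"
    using has_complex_derivative_locally_injective[OF holk _ open_ball dk0] g(2) by auto
  have eq: "f z - f z0 = k z ^ n" if "z \<in> ball z0 r'" for z
    using g(5)[of z] jn[of z] r' that by (auto simp: k_def power_mult_distrib)
  have n1: "deriv f z0 \<noteq> 0" if "n = 1"
  proof -
    have "((\<lambda>z. f z0 + k z) has_field_derivative j z0) (at z0)"
      using dk by (auto intro!: derivative_eq_intros)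
    then have "(f has_field_derivative j z0) (at z0)"
    proof (rule has_field_derivative_transform_within_open[OF _ open_ball])
      show "z0 \<in> ball z0 r'" using r' by simp
      show "f z0 + k x = f x" if "x \<in> ball z0 r'" for x using eq[OF that] \<open>n = 1\<close> by (simp add: algebra_simps)
    qed
    then show ?thesis using DERIV_imp_deriv by (force simp: j_def)
  qed
  show ?thesis
    by (rule that[OF g(1) r'(1) _ _ _ dk0 r'(3) eq n1])
       (use r' g holk holomorphic_on_subset in \<open>auto simp: k_def\<close>)
qed

lemma Im_of_real_mult: "Im (of_real x * z) = x * Im z"
  by simp

text \<open>For \<open>Im v > 0\<close> the argument of \<open>v ^ n\<close> sweeps the interval
  from 0 to n*pi, which contains the one from 0 to 2*pi. So \<open>A * v ^ n\<close> reaches every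
  direction except perhaps that of \<open>A\<close> itself; a target \<open>\<tau>\<close> avoiding
  this ray is found in the required half plane.\<close>

lemma upper_root:
  fixes A :: complex and \<sigma> :: real
  assumes n: "n \<ge> 2" and A: "A \<noteq> 0" and \<sigma>: "\<sigma> = 1 \<or> \<sigma> = -1"
  obtains v where "Im v > 0" "\<sigma> * Im (A * v ^ n) < 0"
proof -
  obtain \<tau> where \<tau>: "\<sigma> * Im \<tau> < 0" "\<not> (\<tau> / A \<in> \<real> \<and> 0 \<le> Re (\<tau> / A))"
  proof (cases "- \<sigma> *\<^sub>R \<i> / A \<in> \<real> \<and> 0 \<le> Re (- \<sigma> *\<^sub>R \<i> / A)")
    case False
    then show ?thesis using that[of "- \<sigma> *\<^sub>R \<i>"] \<sigma> by auto
  next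
    case True
    then obtain x where x: "- \<sigma> *\<^sub>R \<i> / A = of_real x" by (auto elim: Reals_cases)
    \<comment> \<open>The first target lies on the forbidden ray. Adding 1 keeps its imaginary part
      but takes it off the real line through \<open>A\<close>.\<close>
    have "\<not> (1 - \<sigma> *\<^sub>R \<i>) / A \<in> \<real>"
    proof
      assume "(1 - \<sigma> *\<^sub>R \<i>) / A \<in> \<real>"
      then obtain y where y: "(1 - \<sigma> *\<^sub>R \<i>) / A = of_real y" by (auto elim: Reals_cases)
      have "- \<sigma> *\<^sub>R \<i> = of_real x * A" "1 - \<sigma> *\<^sub>R \<i> = of_real y * A"
        using x y A by (auto simp: field_simps)
      note xy = this
      have "1 = (1 - \<sigma> *\<^sub>R \<i>) - (- \<sigma> *\<^sub>R \<i>)" by simp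
      also have "\<dots> = of_real y * A - of_real x * A" using xy by (simp only:)
      also have "\<dots> = of_real (y - x) * A" by (simp add: algebra_simps)
      finally have "1 = of_real (y - x) * A" .
      with xy(1) have "Re A * (y - x) = 1" "Im A * (y - x) = 0" "Im A * x = - \<sigma>" by (auto simp: complex_eq_iff mult.commute)
      then show False using \<sigma> by auto
    qed
    then show ?thesis using that[of "1 - \<sigma> *\<^sub>R \<i>"] \<sigma> by auto
  qed
  define \<rho> where "\<rho> = \<tau> / A"
  have \<rho>0: "\<rho> \<noteq> 0" using \<tau> A by (auto simp: \<rho>_def)
  have a: "0 < Arg2pi \<rho>" "Arg2pi \<rho> < 2 * pi"
    using \<tau>(2) Arg2pi_eq_0[of \<rho>] Arg2pi_ge_0[of \<rho>] Arg2pi_lt_2pi[of \<rho>] by (auto simp: \<rho>_def less_le)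
  \<comment> \<open>The \<open>n\<close>-th root of \<open>\<rho>\<close> with the smallest positive
    argument, which is below pi because \<open>Arg2pi \<rho> < 2 * pi\<close> and
    \<open>n \<ge> 2\<close>.\<close>
  define v where "v = of_real (root n (cmod \<rho>)) * exp (\<i> * of_real (Arg2pi \<rho> / n))"
  have "root n (cmod \<rho>) ^ n = cmod \<rho>" using n by simp
  then have "complex_of_real (root n (cmod \<rho>)) ^ n = of_real (cmod \<rho>)" by (metis of_real_power)
  then have "v ^ n = of_real (cmod \<rho>) * exp (\<i> * of_real (Arg2pi \<rho>))"
    using n by (simp add: v_def power_mult_distrib exp_of_nat_mult[symmetric])
  also have "\<dots> = \<rho>" using Arg2pi_eq[of \<rho>] by simp
  finally have vn: "A * v ^ n = \<tau>" using A by (simp add: \<rho>_def)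
  have "2 * pi \<le> n * pi" using n by simp
  then have "Arg2pi \<rho> < n * pi" using a by linarith
  then have "Arg2pi \<rho> / n < pi" using n by (simp add: divide_less_eq mult.commute)
  moreover have "0 < Arg2pi \<rho> / n" using a n by simp
  ultimately have "sin (Arg2pi \<rho> / n) > 0" by (rule sin_gt_zero[rotated])
  then have "Im v > 0" using \<rho>0 n by (simp add: v_def Im_exp)
  then show ?thesis by (rule that) (simp only: vn \<tau>(1))
qed

text \<open>At a critical point of multiplicity \<open>n \<ge> 2\<close> the half disk on one side of the curve, whose
  opening angle is \<open>\<pi>\<close> by smoothness, is mapped onto a sector of angle \<open>n\<pi> \<ge> 2\<pi>\<close>.\<close>
lemma one_sided_imp_regular:
  assumes S: "smooth_jordan_curve S" "z0 \<in> S" and \<Gamma>: "smooth_jordan_curve \<Gamma>" "f z0 \<in> \<Gamma>"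
    and f: "f holomorphic_on V" "open V" "connected V" "\<not> f constant_on V" "z0 \<in> V"
    and U: "open U" "z0 \<in> U" and side: "f ` (U \<inter> inside S) \<subseteq> inside \<Gamma> \<or> f ` (U \<inter> inside S) \<subseteq> outside \<Gamma>"
  shows "deriv f z0 \<noteq> 0"
proof -
  obtain n k r where k: "n > 0" "r > 0" "ball z0 r \<subseteq> V" "k holomorphic_on ball z0 r" "k z0 = 0" "deriv k z0 \<noteq> 0"
    "inj_on k (ball z0 r)" "\<And>z. z \<in> ball z0 r \<Longrightarrow> f z - f z0 = k z ^ n" "n = 1 \<Longrightarrow> deriv f z0 \<noteq> 0"
    by (rule local_power_form[OF f], rule that; assumption)
  obtain F \<kappa> rS a where chS: "jordan_chart S z0 F \<kappa> rS a" using jordan_chart_exists[OF S] by blast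
  obtain H \<eta> \<rho> b where ch\<Gamma>: "jordan_chart \<Gamma> (f z0) H \<eta> \<rho> b" using jordan_chart_exists[OF \<Gamma>] by blast
  note cS = jordan_chartD[OF chS] and c\<Gamma> = jordan_chartD[OF ch\<Gamma>]
  obtain L where L: "\<And>z. F z - z0 = L z * z" "isCont L 0" "L 0 = a"
    using jordan_chart_quotients[OF chS] by metis
  obtain K where K: "\<And>w. \<eta> w = K w * (w - f z0)" "isCont K (f z0)" "K (f z0) = inverse b"
    using jordan_chart_quotients[OF ch\<Gamma>] by metis
  have dk: "(k has_field_derivative deriv k z0) (at z0)"
    using k(2,4) by (meson centre_in_ball holomorphic_derivI open_ball)
  obtain J where J: "\<And>z. k z - k z0 = J z * (z - z0)" "isCont J z0" "J z0 = deriv k z0"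
    using dk unfolding CARAT_DERIV by blast
  \<comment> \<open>In the two charts \<open>f\<close> reads
    \<open>\<eta> (f (F \<zeta>)) = E \<zeta> * \<zeta> ^ n\<close> near 0, with \<open>E\<close>
    continuous at 0; \<open>E 0 \<noteq> 0\<close> is the leading coefficient.\<close>
  define E where "E = (\<lambda>\<zeta>. K (f (F \<zeta>)) * (J (F \<zeta>) * L \<zeta>) ^ n)"
  have cF: "isCont F 0" using cS(1,7) by (simp add: continuous_on_eq_continuous_at)
  have cf: "isCont f z0" using f by (meson continuous_on_eq_continuous_at holomorphic_on_imp_continuous_on)
  have cfF: "isCont (\<lambda>\<zeta>. f (F \<zeta>)) 0" using isCont_o2[OF cF, of f] cf cS(3) by simp
  then have "isCont (\<lambda>\<zeta>. K (f (F \<zeta>))) 0" using isCont_o2[OF cfF, of K] K(2) cS(3) by simp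
  moreover have "isCont (\<lambda>\<zeta>. J (F \<zeta>)) 0" using isCont_o2[OF cF, of J] J(2) cS(3) by simp
  ultimately have cE: "isCont E 0" unfolding E_def using L(2) by (intro continuous_intros)
  define A where "A = E 0"
  have A0: "A \<noteq> 0" using L(3) K(3) J(3) k(6) cS(2,3) c\<Gamma>(2) by (simp add: A_def E_def)
  have main: "n = 1"
  proof (rule ccontr)
    assume "n \<noteq> 1"
    then have n2: "n \<ge> 2" using k(1) by simp
    obtain \<sigma> :: real where \<sigma>: "\<sigma> = 1 \<or> \<sigma> = -1"
      and sg: "\<And>z. z \<in> U \<inter> inside S \<Longrightarrow> f z \<in> H ` ball 0 \<rho> \<Longrightarrow> \<sigma> * Im (\<eta> (f z)) > 0"
      using side
    proof
      assume "f ` (U \<inter> inside S) \<subseteq> inside \<Gamma>"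
      then show ?thesis using that[of 1] c\<Gamma>(15) by auto
    next
      assume "f ` (U \<inter> inside S) \<subseteq> outside \<Gamma>"
      then show ?thesis using that[of "-1"] c\<Gamma>(16) by auto
    qed
    \<comment> \<open>A direction into \<open>inside S\<close> whose image direction points to the
      forbidden side of \<open>\<Gamma>\<close>; following it for small \<open>t\<close> contradicts
      \<open>sg\<close>.\<close>
    obtain v where v: "Im v > 0" "\<sigma> * Im (A * v ^ n) < 0" using upper_root[OF n2 A0 \<sigma>] by blast
    have lim: "((\<lambda>t. of_real t * v) \<longlongrightarrow> 0) (at_right (0::real))"
      by (auto intro!: tendsto_eq_intros)
    have "((\<lambda>t. E (of_real t * v)) \<longlongrightarrow> A) (at_right (0::real))"
      unfolding A_def using isCont_tendsto_compose[OF cE lim] .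
    then have "((\<lambda>t. \<sigma> * Im (E (of_real t * v) * v ^ n)) \<longlongrightarrow> \<sigma> * Im (A * v ^ n)) (at_right 0)"
      by (intro tendsto_intros)
    then have e1: "\<forall>\<^sub>F t in at_right 0. \<sigma> * Im (E (of_real t * v) * v ^ n) < 0"
      using v(2) by (rule order_tendstoD(2))
    have e2: "\<forall>\<^sub>F t in at_right 0. of_real t * v \<in> ball 0 rS"
      using lim cS(1) by (intro topological_tendstoD[OF lim]) auto
    have lF: "((\<lambda>t. F (of_real t * v)) \<longlongrightarrow> z0) (at_right (0::real))"
      using isCont_tendsto_compose[OF cF lim] cS(3) by simp
    have e3: "\<forall>\<^sub>F t in at_right 0. F (of_real t * v) \<in> U \<inter> ball z0 r"
      using U k(2) by (intro topological_tendstoD[OF lF]) auto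
    have lf: "((\<lambda>t. f (F (of_real t * v))) \<longlongrightarrow> f z0) (at_right (0::real))"
      using isCont_tendsto_compose[OF cf lF] .
    have e4: "\<forall>\<^sub>F t in at_right 0. f (F (of_real t * v)) \<in> H ` ball 0 \<rho>"
      using c\<Gamma>(4,5) by (intro topological_tendstoD[OF lf]) auto
    have "\<forall>\<^sub>F t in at_right (0::real). False"
      using e1 e2 e3 e4 eventually_at_right_less[of 0]
    proof eventually_elim
      case (elim t)
      define \<zeta> where "\<zeta> = of_real t * v"
      have "Im \<zeta> > 0" using v elim by (simp add: \<zeta>_def)
      then have "F \<zeta> \<in> inside S" using cS(14) elim \<zeta>_def by blast
      then have "\<sigma> * Im (\<eta> (f (F \<zeta>))) > 0" using sg elim \<zeta>_def by blast
      moreover have "\<eta> (f (F \<zeta>)) = of_real (t ^ n) * (E \<zeta> * v ^ n)"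
      proof -
        have "f (F \<zeta>) - f z0 = k (F \<zeta>) ^ n" using k(8) elim \<zeta>_def by blast
        also have "k (F \<zeta>) = J (F \<zeta>) * (L \<zeta> * \<zeta>)" using J(1)[of "F \<zeta>"] L(1)[of \<zeta>] k(5) by simp
        finally show ?thesis using K(1)[of "f (F \<zeta>)"] by (simp add: E_def \<zeta>_def power_mult_distrib algebra_simps)
      qed
      ultimately have "\<sigma> * (t ^ n * Im (E \<zeta> * v ^ n)) > 0"
        using Im_of_real_mult[of "t ^ n" "E \<zeta> * v ^ n"] by (simp only:)
      then have "t ^ n * (\<sigma> * Im (E \<zeta> * v ^ n)) > 0" by (simp add: mult.left_commute)
      moreover have "t ^ n * (\<sigma> * Im (E \<zeta> * v ^ n)) < 0"
      proof (rule mult_pos_neg)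
        show "t ^ n > 0" using elim by simp
        show "\<sigma> * Im (E \<zeta> * v ^ n) < 0" using elim(1) by (simp only: \<zeta>_def)
      qed
      ultimately show False by linarith
    qed
    then show False by simp
  qed
  then show ?thesis by (rule k(9))
qed


text \<open>The preimage of the curve contains \<open>2n\<close> arcs emanating from a point of multiplicity \<open>n\<close>; they are
  obtained by lifting the two arcs of \<open>\<Gamma>\<close> through an \<open>n\<close>-th root. Their tangents
  cannot all be parallel to that of \<open>S\<close> unless \<open>n = 1\<close>.\<close>
lemma component_imp_regular:
  assumes S: "smooth_jordan_curve S" "z0 \<in> S" and \<Gamma>: "smooth_jordan_curve \<Gamma>" "f z0 \<in> \<Gamma>"
    and f: "f holomorphic_on V" "open V" "connected V" "\<not> f constant_on V" "z0 \<in> V"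
    and comp: "S \<in> components {z \<in> V. f z \<in> \<Gamma>}"
  shows "deriv f z0 \<noteq> 0"
proof -
  obtain n k r where k: "n > 0" "r > 0" "ball z0 r \<subseteq> V" "k holomorphic_on ball z0 r" "k z0 = 0" "deriv k z0 \<noteq> 0"
    "inj_on k (ball z0 r)" "\<And>z. z \<in> ball z0 r \<Longrightarrow> f z - f z0 = k z ^ n" "n = 1 \<Longrightarrow> deriv f z0 \<noteq> 0"
    by (rule local_power_form[OF f], rule that; assumption)
  obtain F \<kappa> rS a where chS: "jordan_chart S z0 F \<kappa> rS a" using jordan_chart_exists[OF S] by blast
  obtain H \<eta> \<rho> b where ch\<Gamma>: "jordan_chart \<Gamma> (f z0) H \<eta> \<rho> b" using jordan_chart_exists[OF \<Gamma>] by blast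
  note cS = jordan_chartD[OF chS] and c\<Gamma> = jordan_chartD[OF ch\<Gamma>]
  obtain K where K: "\<And>w. \<kappa> w = K w * (w - z0)" "isCont K z0" "K z0 = inverse a"
    using jordan_chart_quotients[OF chS] by metis
  obtain M where M: "\<And>z. H z - f z0 = M z * z" "isCont M 0" "M 0 = b"
    using jordan_chart_quotients[OF ch\<Gamma>] by metis
  have dk: "(k has_field_derivative deriv k z0) (at z0)"
    using k(2,4) by (meson centre_in_ball holomorphic_derivI open_ball)
  obtain J where J: "\<And>z. k z - k z0 = J z * (z - z0)" "isCont J z0" "J z0 = deriv k z0"
    using dk unfolding CARAT_DERIV by blast
  define B where "B = ball z0 r"
  have contk: "continuous_on B k" using k(4) holomorphic_on_imp_continuous_on unfolding B_def by blast
  have opk: "open (k ` B)" using invariance_of_domain[OF contk] k(7) unfolding B_def by blast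
  obtain ki where ki: "homeomorphism B (k ` B) k ki"
    using invariance_of_domain_homeomorphism[OF _ contk] k(7) unfolding B_def by auto
  have z0B: "z0 \<in> B" using k(2) by (simp add: B_def)
  have ki0: "ki 0 = z0" using homeomorphism_apply1[OF ki z0B] k(5) by simp
  have zero: "0 \<in> k ` B" using z0B k(5) by force
  have contki: "continuous_on (k ` B) ki" using ki homeomorphism_def by blast
  \<comment> \<open>One lifted arc for each root \<open>v0\<close>; \<open>\<sigma>\<close> selects
    which half of \<open>\<Gamma>\<close> at \<open>f z0\<close> is lifted. The arc starts in
    direction \<open>v0 / deriv k z0\<close>, and lying in \<open>S\<close> forces this to be a real
    multiple of the tangent \<open>a\<close>.\<close>
  have ckey: "Im (v0 / (deriv k z0 * a)) = 0"
    if \<sigma>: "\<sigma> = 1 \<or> \<sigma> = -1" and v0: "v0 ^ n = of_real \<sigma> * b" for \<sigma> :: real and v0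
  proof -
    have "isCont (\<lambda>t. M t / b) 0" using M(2) c\<Gamma>(2) by (intro continuous_intros) auto
    then have "((\<lambda>t. M t / b) \<longlongrightarrow> 1) (nhds 0)"
      using M(3) c\<Gamma>(2) tendsto_at_iff_tendsto_nhds[of "\<lambda>t. M t / b" 0] by (simp add: isCont_def)
    then have "\<forall>\<^sub>F t in nhds 0. M t / b \<in> ball 1 1" by (rule topological_tendstoD) auto
    then obtain \<delta> where \<delta>: "\<delta> > 0" "\<And>t. t \<in> ball 0 \<delta> \<Longrightarrow> M t / b \<in> ball 1 1"
      unfolding eventually_nhds_metric by (auto simp: dist_commute)
    define R where "R = min \<delta> \<rho>"
    have R: "R > 0" using \<delta> c\<Gamma>(1) by (simp add: R_def)
    have contM: "continuous_on (ball 0 R) M"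
    proof (rule continuous_at_imp_continuous_on, rule ballI)
      fix t :: complex assume t: "t \<in> ball 0 R"
      show "isCont M t"
      proof (cases "t = 0")
        case True then show ?thesis using M(2) by simp
      next
        case False
        have "isCont H t" using c\<Gamma>(7) t by (simp add: continuous_on_eq_continuous_at R_def)
        then have "isCont (\<lambda>t. (H t - f z0) / t) t" using False by (intro continuous_intros)
        moreover have ev: "\<forall>\<^sub>F s in nhds t. (H s - f z0) / s = M s"
          using t1_space_nhds[OF False] by eventually_elim (simp add: M(1))
        ultimately show ?thesis using isCont_cong[OF ev] by simp
      qed
    qed
    \<comment> \<open>Parametrizing by \<open>s ^ n\<close> makes the root explicit:
      \<open>H (T s) - f z0 = M (T s) * \<sigma> * s ^ n\<close>, so \<open>\<beta> s\<close> is
      \<open>s\<close> times a continuous factor with value \<open>v0\<close> at 0.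
      \<open>M / b\<close> stays in the disk of radius 1 about 1, where the principal logarithm is
      continuous.\<close>
    define T where "T = (\<lambda>s::real. complex_of_real (\<sigma> * s ^ n))"
    define \<beta> where "\<beta> = (\<lambda>s::real. of_real s * (v0 * exp (Ln (M (T s) / b) / of_nat n)))"
    define s1 where "s1 = min 1 R"
    have s1: "s1 > 0" using R by (simp add: s1_def)
    have TR: "T s \<in> ball 0 R" if "s \<in> {-s1<..<s1}" for s
    proof -
      have "\<bar>s\<bar> < 1" "\<bar>s\<bar> < R" using that by (auto simp: s1_def)
      then have "\<bar>s\<bar> ^ n \<le> \<bar>s\<bar>" using k(1) power_decreasing[of 1 n "\<bar>s\<bar>"] by simp
      moreover have "cmod (T s) = \<bar>s\<bar> ^ n" using \<sigma> by (auto simp: T_def norm_mult norm_power power_abs)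
      ultimately show ?thesis using \<open>\<bar>s\<bar> < R\<close> by simp
    qed
    have pos: "M (T s) / b \<notin> \<real>\<^sub>\<le>\<^sub>0" "M (T s) / b \<noteq> 0" if "s \<in> {-s1<..<s1}" for s
    proof -
      have "T s \<in> ball 0 \<delta>" using TR[OF that] by (simp add: R_def)
      then have "cmod (1 - M (T s) / b) < 1" using \<delta>(2) by (metis dist_norm mem_ball)
      then have "Re (M (T s) / b) > 0" using abs_Re_le_cmod[of "1 - M (T s) / b"] by simp
      then show "M (T s) / b \<notin> \<real>\<^sub>\<le>\<^sub>0" "M (T s) / b \<noteq> 0" by (auto simp: complex_nonpos_Reals_iff)
    qed
    have contT: "continuous_on A T" for A unfolding T_def by (intro continuous_intros)
    have contq: "continuous_on {-s1<..<s1} (\<lambda>s. v0 * exp (Ln (M (T s) / b) / of_nat n))"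
      using pos TR c\<Gamma>(2) k(1)
      by (intro continuous_intros continuous_on_compose2[OF contM contT]) auto
    have cont\<beta>: "continuous_on {-s1<..<s1} \<beta>"
      unfolding \<beta>_def by (rule continuous_on_mult[OF _ contq]) (intro continuous_intros)
    have \<beta>n: "\<beta> s ^ n = H (T s) - f z0" if "s \<in> {-s1<..<s1}" for s
    proof -
      have "\<beta> s ^ n = of_real s ^ n * (v0 ^ n * (M (T s) / b))"
        using pos[OF that] k(1) by (simp add: \<beta>_def power_mult_distrib exp_of_nat_mult[symmetric] exp_Ln)
      then show ?thesis using c\<Gamma>(2) M(1) by (simp add: v0 T_def)
    qed
    have "open ({-s1<..<s1} \<inter> \<beta> -` (k ` B))"
      using continuous_open_preimage[OF cont\<beta> open_greaterThanLessThan opk] .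
    moreover have "0 \<in> {-s1<..<s1} \<inter> \<beta> -` (k ` B)" using s1 zero by (simp add: \<beta>_def)
    ultimately obtain \<epsilon> where \<epsilon>: "\<epsilon> > 0" "ball 0 \<epsilon> \<subseteq> {-s1<..<s1} \<inter> \<beta> -` (k ` B)" by (meson openE)
    define arm where "arm = (\<lambda>s. ki (\<beta> s))"
    have in1: "s \<in> {-s1<..<s1}" "\<beta> s \<in> k ` B" if "\<bar>s\<bar> < \<epsilon>" for s using \<epsilon> that by (auto simp: subset_iff)
    have contarm: "continuous_on (ball 0 \<epsilon>) arm"
      unfolding arm_def using \<epsilon>(2)
      by (intro continuous_on_compose2[OF contki continuous_on_subset[OF cont\<beta>]]) auto
    have armB: "arm s \<in> B" "k (arm s) = \<beta> s" if "\<bar>s\<bar> < \<epsilon>" for s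
      using homeomorphism_apply2[OF ki in1(2)[OF that]] homeomorphism_image2[OF ki] in1(2)[OF that]
      by (auto simp: arm_def)
    have arm0: "arm 0 = z0" by (simp add: arm_def \<beta>_def ki0)
    have "f (arm s) \<in> \<Gamma>" if "\<bar>s\<bar> < \<epsilon>" for s
    proof -
      have "f (arm s) - f z0 = H (T s) - f z0"
        using k(8)[of "arm s"] armB[OF that] \<beta>n[OF in1(1)[OF that]] by (simp add: B_def)
      then have "f (arm s) = H (T s)" by simp
      moreover have "T s \<in> ball 0 \<rho>" using TR[OF in1(1)[OF that]] by (simp add: R_def)
      ultimately show ?thesis using c\<Gamma>(12)[of "T s"] by (simp add: T_def)
    qed
    then have "arm ` ball 0 \<epsilon> \<subseteq> {z \<in> V. f z \<in> \<Gamma>}" using armB k(3) by (auto simp: B_def)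
    moreover have "connected (arm ` ball 0 \<epsilon>)" using contarm by (intro connected_continuous_image) auto
    moreover have "S \<inter> arm ` ball 0 \<epsilon> \<noteq> {}" using arm0 S(2) \<epsilon>(1) by force
    \<comment> \<open>The only use of the component hypothesis: a connected piece of the preimage of
      \<open>\<Gamma>\<close> through \<open>z0\<close> is absorbed by \<open>S\<close>.\<close>
    ultimately have armS: "arm ` ball 0 \<epsilon> \<subseteq> S" using components_maximal[OF comp] by blast
    have carm: "isCont arm 0" using contarm \<epsilon>(1) by (simp add: continuous_on_eq_continuous_at)
    then have larm: "(arm \<longlongrightarrow> z0) (at_right 0)"
      using arm0 by (metis isCont_def tendsto_within_subset subset_UNIV)
    have lq: "((\<lambda>s. v0 * exp (Ln (M (T s) / b) / of_nat n)) \<longlongrightarrow> v0) (at_right 0)"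
    proof -
      have "isCont (\<lambda>s. v0 * exp (Ln (M (T s) / b) / of_nat n)) 0"
        using contq s1 by (simp add: continuous_on_eq_continuous_at)
      moreover have "v0 * exp (Ln (M (T 0) / b) / of_nat n) = v0"
      proof -
        have "T 0 = 0" using k(1) by (simp add: T_def)
        then show ?thesis using M(3) c\<Gamma>(2) by simp
      qed
      ultimately show ?thesis by (metis (no_types, lifting) isCont_def tendsto_within_subset subset_UNIV)
    qed
    have lJ: "((\<lambda>s. J (arm s)) \<longlongrightarrow> deriv k z0) (at_right 0)"
      using isCont_tendsto_compose[OF J(2) larm] J(3) by simp
    have lK: "((\<lambda>s. K (arm s)) \<longlongrightarrow> inverse a) (at_right 0)"
      using isCont_tendsto_compose[OF K(2) larm] K(3) by simp
    \<comment> \<open>For small positive \<open>s\<close> this quantity is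
      \<open>\<kappa> (arm s) / s\<close>, which is real because \<open>arm s\<close> lies in
      \<open>S\<close>.\<close>
    have lim: "((\<lambda>s. K (arm s) * ((v0 * exp (Ln (M (T s) / b) / of_nat n)) / J (arm s))) \<longlongrightarrow> inverse a * (v0 / deriv k z0)) (at_right 0)"
      using lq lJ lK k(6) by (intro tendsto_intros)
    have ev1: "\<forall>\<^sub>F s in at_right 0. J (arm s) \<noteq> 0" using tendsto_imp_eventually_ne[OF lJ k(6)] .
    have ev2: "\<forall>\<^sub>F s in at_right 0. arm s \<in> F ` ball 0 rS"
      using cS(4,5) by (intro topological_tendstoD[OF larm]) auto
    have ev3: "\<forall>\<^sub>F s in at_right 0. \<bar>s\<bar> < \<epsilon>"
      using \<epsilon>(1) by (intro eventually_at_rightI[of 0 \<epsilon>]) auto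
    have "\<forall>\<^sub>F s in at_right 0. Im (K (arm s) * ((v0 * exp (Ln (M (T s) / b) / of_nat n)) / J (arm s))) = 0"
      using ev1 ev2 ev3 eventually_at_right_less[of 0]
    proof eventually_elim
      case (elim s)
      have "of_real s * (v0 * exp (Ln (M (T s) / b) / of_nat n)) = J (arm s) * (arm s - z0)"
        using armB(2)[OF elim(3)] J(1)[of "arm s"] k(5) by (simp add: \<beta>_def)
      then have "K (arm s) * ((of_real s * (v0 * exp (Ln (M (T s) / b) / of_nat n))) / J (arm s)) = K (arm s) * (arm s - z0)"
        using elim(1) by (simp only:) simp
      then have "of_real s * (K (arm s) * ((v0 * exp (Ln (M (T s) / b) / of_nat n)) / J (arm s))) = K (arm s) * (arm s - z0)"
        by (simp only: times_divide_eq_right mult.left_commute)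
      also have "\<dots> = \<kappa> (arm s)" using K(1) by simp
      finally have "Im (of_real s * (K (arm s) * ((v0 * exp (Ln (M (T s) / b) / of_nat n)) / J (arm s)))) = Im (\<kappa> (arm s))"
        by (rule arg_cong)
      moreover have "arm s \<in> S" using armS elim(3) by (auto simp: image_subset_iff)
      then have "Im (\<kappa> (arm s)) = 0" using cS(13)[OF elim(2)] by simp
      ultimately have "s * Im (K (arm s) * ((v0 * exp (Ln (M (T s) / b) / of_nat n)) / J (arm s))) = 0"
        using Im_of_real_mult by (simp only:)
      then show ?case using elim(4) by simp
    qed
    moreover have "((\<lambda>s. Im (K (arm s) * ((v0 * exp (Ln (M (T s) / b) / of_nat n)) / J (arm s)))) \<longlongrightarrow> Im (inverse a * (v0 / deriv k z0))) (at_right 0)"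
      using tendsto_Im[OF lim] .
    ultimately have "((\<lambda>s::real. 0) \<longlongrightarrow> Im (inverse a * (v0 / deriv k z0))) (at_right 0)"
      by (rule Lim_transform_eventually[rotated])
    then have "Im (inverse a * (v0 / deriv k z0)) = 0" by (simp add: tendsto_const_iff)
    moreover have "inverse a * (v0 / deriv k z0) = v0 / (deriv k z0 * a)" by (simp add: divide_inverse)
    ultimately show ?thesis by (simp only:)
  qed
  have main: "n = 1"
  proof (rule ccontr)
    assume "n \<noteq> 1"
    then have n2: "n \<ge> 2" using k(1) by simp
    \<comment> \<open>Two neighbouring arcs, lifted from opposite halves of \<open>\<Gamma>\<close>:
      \<open>v0\<close> is a root of \<open>b\<close> and \<open>v0 * e\<close> one of
      \<open>-b\<close>. Both directions can be real multiples of \<open>a\<close> only if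
      \<open>sin (pi / n) = 0\<close>.\<close>
    define v0 where "v0 = exp (Ln b / of_nat n)"
    define e where "e = cis (pi / n)"
    have v0n: "v0 ^ n = b" using k(1) c\<Gamma>(2) by (simp add: v0_def exp_of_nat_mult[symmetric])
    have "e ^ n = cis (real n * (pi / n))" unfolding e_def by (rule Complex.DeMoivre)
    then have en: "e ^ n = -1" using k(1) by simp
    define Q where "Q = v0 / (deriv k z0 * a)"
    have "Im Q = 0" using ckey[of 1 v0] v0n by (simp add: Q_def)
    moreover have "Im (Q * e) = 0" using ckey[of "-1" "v0 * e"] v0n en by (simp add: Q_def power_mult_distrib)
    moreover have "Q \<noteq> 0" using cS(2) k(6) by (simp add: Q_def v0_def)
    ultimately have "sin (pi / n) = 0" by (auto simp: e_def complex_eq_iff)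
    moreover have "sin (pi / n) > 0" using n2 by (intro sin_gt_zero) (auto simp: field_simps)
    ultimately show False by simp
  qed
  then show ?thesis by (rule k(9))
qed

text \<open>\<open>f\<close> is a homeomorphism near \<open>z0\<close>, so the preimage of
  \<open>\<Gamma>\<close> is there the pullback of a single arc. That arc is connected and contains
  \<open>z0\<close>, so it belongs to the component \<open>S\<close>.\<close>

lemma component_imp_isolated:
  assumes S: "z0 \<in> S" and \<Gamma>: "smooth_jordan_curve \<Gamma>" "f z0 \<in> \<Gamma>"
    and f: "f holomorphic_on V" "open V" "z0 \<in> V" "deriv f z0 \<noteq> 0"
    and comp: "S \<in> components {z \<in> V. f z \<in> \<Gamma>}"
  obtains U where "open U" "z0 \<in> U" "{z \<in> V. f z \<in> \<Gamma>} \<inter> U \<subseteq> S"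
proof -
  obtain r where r: "r > 0" "ball z0 r \<subseteq> V" "open (f ` ball z0 r)" "inj_on f (ball z0 r)"
    using has_complex_derivative_locally_invertible[OF f(1,3,2,4)] by metis
  define B where "B = ball z0 r"
  have contf: "continuous_on B f" using f(1) r(2) holomorphic_on_imp_continuous_on holomorphic_on_subset
    unfolding B_def by blast
  obtain \<phi> where \<phi>: "homeomorphism B (f ` B) f \<phi>"
    using invariance_of_domain_homeomorphism[OF _ contf] r(4) unfolding B_def by auto
  have z0B: "z0 \<in> B" using r(1) by (simp add: B_def)
  obtain H \<eta> \<rho> b where ch\<Gamma>: "jordan_chart \<Gamma> (f z0) H \<eta> \<rho> b" using jordan_chart_exists[OF \<Gamma>] by blast
  note c\<Gamma> = jordan_chartD[OF ch\<Gamma>]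
  have "open (ball 0 \<rho> \<inter> H -` (f ` B))"
    using continuous_open_preimage[OF c\<Gamma>(7) open_ball] r(3) by (simp add: B_def)
  moreover have "0 \<in> ball 0 \<rho> \<inter> H -` (f ` B)" using c\<Gamma>(1,3) z0B by simp
  ultimately obtain d where d: "d > 0" "ball 0 d \<subseteq> ball 0 \<rho> \<inter> H -` (f ` B)" by (meson openE)
  define I where "I = ball 0 d \<inter> {z. Im z = 0}"
  define U where "U = B \<inter> f -` (H ` ball 0 d)"
  have opH: "open (H ` ball 0 d)"
  proof (rule invariance_of_domain)
    show "continuous_on (ball 0 d) H" using c\<Gamma>(7) d(2) continuous_on_subset by blast
    show "inj_on H (ball 0 d)" using c\<Gamma>(9) d(2) by (metis (no_types, lifting) inj_on_def Int_iff subsetD)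
  qed simp
  have "convex I" unfolding I_def by (intro convex_Int convex_ball convex_hyperplane[of \<i> 0, simplified] )
  then have "connected I" by (rule convex_connected)
  then have "connected (\<phi> ` H ` I)"
  proof (intro connected_continuous_image)
    show "continuous_on I H" using c\<Gamma>(7) d(2) continuous_on_subset unfolding I_def by blast
    show "continuous_on (H ` I) \<phi>"
      using \<phi> d(2) unfolding homeomorphism_def I_def by (auto intro: continuous_on_subset)
  qed
  moreover have sub: "\<phi> ` H ` I \<subseteq> {z \<in> V. f z \<in> \<Gamma>}"
  proof clarsimp
    fix t assume t: "t \<in> I"
    then have HB: "H t \<in> f ` B" and H\<Gamma>: "H t \<in> \<Gamma>" using d(2) c\<Gamma>(12)[of t] by (auto simp: I_def)
    have "f (\<phi> (H t)) = H t" using homeomorphism_apply2[OF \<phi> HB] .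
    moreover have "\<phi> (H t) \<in> B" using HB \<phi> homeomorphism_image2 by blast
    ultimately show "\<phi> (H t) \<in> V \<and> f (\<phi> (H t)) \<in> \<Gamma>" using H\<Gamma> r(2) by (auto simp: B_def)
  qed
  moreover have "z0 \<in> \<phi> ` H ` I"
  proof -
    have "0 \<in> I" using d(1) by (simp add: I_def)
    moreover have "\<phi> (H 0) = z0" using c\<Gamma>(3) homeomorphism_apply1[OF \<phi> z0B] by simp
    ultimately show ?thesis by (metis imageI)
  qed
  ultimately have IS: "\<phi> ` H ` I \<subseteq> S" using components_maximal[OF comp] S by blast
  show ?thesis
  proof (rule that[of U])
    show "open U" unfolding U_def using continuous_open_preimage[OF contf _ opH] by (simp add: B_def)
    show "z0 \<in> U" using z0B d(1) c\<Gamma>(3) by (auto simp: U_def intro!: image_eqI[of _ H 0])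
    show "{z \<in> V. f z \<in> \<Gamma>} \<inter> U \<subseteq> S"
    proof clarify
      fix z assume z: "z \<in> U" "f z \<in> \<Gamma>"
      then obtain t where t: "t \<in> ball 0 d" "f z = H t" and zB: "z \<in> B" by (auto simp: U_def)
      then have "Im t = 0" using c\<Gamma>(12)[of t] d(2) z(2) by auto
      then have "t \<in> I" using t by (simp add: I_def)
      moreover have "z = \<phi> (H t)" using homeomorphism_apply1[OF \<phi> zB] t by simp
      ultimately show "z \<in> S" using IS by blast
    qed
  qed
qed

text \<open>Here \<open>S\<close> is not yet known to be a component. Read in the chart of
  \<open>\<Gamma>\<close>, \<open>f\<close> along \<open>S\<close> is an injective continuous real
  function \<open>q\<close>; its image contains an interval, so \<open>f\<close> carries
  \<open>S\<close> onto a whole subarc of \<open>\<Gamma>\<close> about \<open>f z0\<close>, and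
  local injectivity leaves no room for preimages off \<open>S\<close>.\<close>

lemma subset_preimage_imp_isolated:
  assumes S: "smooth_jordan_curve S" "z0 \<in> S" and \<Gamma>: "smooth_jordan_curve \<Gamma>" "f ` S \<subseteq> \<Gamma>"
    and f: "f holomorphic_on V" "open V" "z0 \<in> V" "deriv f z0 \<noteq> 0"
  obtains U where "open U" "z0 \<in> U" "{z \<in> V. f z \<in> \<Gamma>} \<inter> U \<subseteq> S"
proof -
  obtain r where r: "r > 0" "ball z0 r \<subseteq> V" "inj_on f (ball z0 r)"
    using has_complex_derivative_locally_injective[OF f(1,3,2,4)] by metis
  have f0: "f z0 \<in> \<Gamma>" using S \<Gamma> by blast
  obtain F \<kappa> rS a where chS: "jordan_chart S z0 F \<kappa> rS a" using jordan_chart_exists[OF S] by blast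
  obtain H \<eta> \<rho> b where ch\<Gamma>: "jordan_chart \<Gamma> (f z0) H \<eta> \<rho> b" using jordan_chart_exists[OF \<Gamma>(1) f0] by blast
  note cS = jordan_chartD[OF chS] and c\<Gamma> = jordan_chartD[OF ch\<Gamma>]
  define B where "B = ball z0 r"
  have contf: "continuous_on B f" using f(1) r(2) holomorphic_on_imp_continuous_on holomorphic_on_subset
    unfolding B_def by blast
  define B' where "B' = B \<inter> f -` (H ` ball 0 \<rho>)"
  have B': "open B'" "z0 \<in> B'"
    unfolding B'_def using continuous_open_preimage[OF contf _ c\<Gamma>(4)] r(1) c\<Gamma>(5) by (auto simp: B_def)
  have "open (ball 0 rS \<inter> F -` B')" using continuous_open_preimage[OF cS(7) open_ball B'(1)] .
  moreover have "0 \<in> ball 0 rS \<inter> F -` B'" using cS(1,3) B'(2) by simp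
  ultimately obtain d where d: "d > 0" "ball 0 d \<subseteq> ball 0 rS \<inter> F -` B'" by (meson openE)
  have inb: "complex_of_real x \<in> ball 0 rS" "F (of_real x) \<in> B'" if "x \<in> {-d<..<d}" for x
  proof -
    have "complex_of_real x \<in> ball 0 d" using that by auto
    then show "complex_of_real x \<in> ball 0 rS" "F (of_real x) \<in> B'" using d(2) by blast+
  qed
  define q where "q = (\<lambda>x::real. Re (\<eta> (f (F (of_real x)))))"
  have real: "\<eta> (f (F (of_real x))) = of_real (q x)" if "x \<in> {-d<..<d}" for x
  proof -
    have "F (of_real x) \<in> S" using cS(12)[OF inb(1)[OF that]] by simp
    then have "f (F (of_real x)) \<in> \<Gamma>" using \<Gamma> by blast
    moreover have "f (F (of_real x)) \<in> H ` ball 0 \<rho>" using inb(2)[OF that] by (simp add: B'_def)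
    ultimately show ?thesis using c\<Gamma>(13) by (simp add: q_def complex_eq_iff)
  qed
  have contq: "continuous_on {-d<..<d} q"
  proof -
    have "continuous_on {-d<..<d} (\<lambda>x. F (of_real x))"
      using inb(1) by (intro continuous_on_compose2[OF cS(7)] continuous_intros) auto
    then have "continuous_on {-d<..<d} (\<lambda>x. f (F (of_real x)))"
      by (rule continuous_on_compose2[OF contf]) (use inb(2) in \<open>auto simp: B'_def\<close>)
    then have "continuous_on {-d<..<d} (\<lambda>x. \<eta> (f (F (of_real x))))"
      by (rule continuous_on_compose2[OF c\<Gamma>(8)]) (use inb(2) in \<open>auto simp: B'_def\<close>)
    then show ?thesis unfolding q_def by (intro continuous_intros)
  qed
  have injq: "inj_on q {-d<..<d}"
  proof (rule inj_onI)
    fix x y assume xy: "x \<in> {-d<..<d}" "y \<in> {-d<..<d}" "q x = q y"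
    then have "\<eta> (f (F (of_real x))) = \<eta> (f (F (of_real y)))" using real by simp
    then have "f (F (of_real x)) = f (F (of_real y))"
      using c\<Gamma>(10) inb(2)[OF xy(1)] inb(2)[OF xy(2)] unfolding B'_def by (metis IntD2 vimageE)
    then have "F (of_real x) = F (of_real y)"
      using r(3) inb(2)[OF xy(1)] inb(2)[OF xy(2)] by (auto simp: B'_def B_def inj_on_def)
    then show "x = y" using cS(9) inb(1)[OF xy(1)] inb(1)[OF xy(2)] by (metis of_real_eq_iff)
  qed
  \<comment> \<open>Invariance of domain in dimension one: \<open>S\<close> cannot stop or turn back
    over \<open>\<Gamma>\<close> at \<open>z0\<close>.\<close>
  have "open (q ` {-d<..<d})" using invariance_of_domain[OF contq open_greaterThanLessThan injq] .
  moreover have "0 \<in> q ` {-d<..<d}"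
  proof -
    have "q 0 = 0" using cS(3) c\<Gamma>(6) by (simp add: q_def)
    then show ?thesis using d(1) by (intro image_eqI[of _ _ 0]) auto
  qed
  ultimately obtain e where e: "e > 0" "ball 0 e \<subseteq> q ` {-d<..<d}" by (meson openE)
  define U where "U = B' \<inter> (\<lambda>z. \<eta> (f z)) -` ball 0 e"
  have cB': "continuous_on B' (\<lambda>z. \<eta> (f z))"
    by (rule continuous_on_compose2[OF c\<Gamma>(8) continuous_on_subset[OF contf]]) (auto simp: B'_def)
  show ?thesis
  proof (rule that[of U])
    show "open U" unfolding U_def using continuous_open_preimage[OF cB' B'(1) open_ball] .
    show "z0 \<in> U" using B'(2) c\<Gamma>(6) e(1) by (simp add: U_def)
    show "{z \<in> V. f z \<in> \<Gamma>} \<inter> U \<subseteq> S"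
    proof clarify
      fix z assume z: "z \<in> U" "f z \<in> \<Gamma>"
      have zB: "z \<in> B" "f z \<in> H ` ball 0 \<rho>" "\<eta> (f z) \<in> ball 0 e" using z(1) by (auto simp: U_def B'_def)
      have im: "Im (\<eta> (f z)) = 0" using c\<Gamma>(13)[OF zB(2)] z(2) by simp
      have "Re (\<eta> (f z)) \<in> ball 0 e" using zB(3) abs_Re_le_cmod[of "\<eta> (f z)"] by simp
      then obtain x where x: "x \<in> {-d<..<d}" "Re (\<eta> (f z)) = q x" using e(2) by blast
      have "\<eta> (f z) = \<eta> (f (F (of_real x)))" using real[OF x(1)] x(2) im by (simp add: complex_eq_iff)
      then have "f z = f (F (of_real x))"
        using c\<Gamma>(10) inb(2)[OF x(1)] zB(2) unfolding B'_def by (metis IntD2 vimageE)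
      then have "z = F (of_real x)"
        using r(3) inb(2)[OF x(1)] zB(1) by (auto simp: B'_def B_def inj_on_def)
      then show "z \<in> S" using cS(12)[OF inb(1)[OF x(1)]] by simp
    qed
  qed
qed

subsection \<open>Pseudo-lemniscates and preimage counts\<close>

locale jordan_curves = nonconstant_meromorphic +
  fixes S \<Gamma> :: "complex set"
  assumes simply: "simply_connected G" and S: "smooth_jordan_curve S" "S \<subseteq> G"
    and \<Gamma>: "smooth_jordan_curve \<Gamma>"
begin

lemmas JS = smooth_jordan_curve_facts[OF S(1)] and J\<Gamma> = smooth_jordan_curve_facts[OF \<Gamma>]

sublocale meromorphic_on_compact f G P "inside S" "inside S \<union> S"
proof
  show "compact (inside S \<union> S)" "open (inside S)" using JS by auto
  show "inside S \<union> S \<subseteq> G"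
    using subset_simply_connected_imp_inside_subset[OF simply G(1) S(2)] S(2) by blast
qed auto

lemma boundary: "inside S \<union> S - inside S = S" using JS(16) by blast

lemma S_closure: assumes "z \<in> S" "open U" "z \<in> U" shows "U \<inter> inside S \<noteq> {}"
proof -
  have "z \<in> closure (inside S)" using assms JS(14) by blast
  then show ?thesis using assms by (metis Int_commute disjoint_iff open_Int_closure_eq_empty)
qed

text \<open>Since \<open>f\<close> maps \<open>S\<close> into \<open>\<Gamma>\<close>, its values
  near \<open>S\<close> avoid a disk about \<open>w0\<close>; no solution can cross
  \<open>S\<close>, so \<open>N\<close> does not jump.\<close>

lemma N_locally_constant:
  assumes fS: "f ` S \<subseteq> \<Gamma>" "S \<inter> P = {}" and w0: "w0 \<notin> \<Gamma>"
  shows "\<forall>\<^sub>F w in nhds w0. N w = N w0"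
proof -
  have "open (- \<Gamma>)" using J\<Gamma>(1) compact_imp_closed by blast
  then obtain d where d: "d > 0" "cball w0 d \<subseteq> - \<Gamma>" using w0 open_contains_cball by (metis ComplI)
  define U0 where "U0 = {z \<in> G - P. f z \<in> - cball w0 d}"
  have "open U0" unfolding U0_def by (intro open_preimage) auto
  moreover have "S \<subseteq> U0" using fS d S(2) unfolding U0_def by blast
  ultimately obtain U' where "\<forall>\<^sub>F w in nhds w0. N w0 \<le> N w \<and>
       (N w0 = N w \<longrightarrow> (\<forall>y\<in>inside S \<inter> U'. pmult y w = 0)) \<and>
       ((\<forall>y\<in>inside S \<inter> U0. pmult y w = 0) \<longrightarrow> N w0 = N w)"
    using eventually_N[of U0 w0] unfolding boundary by metis
  moreover have "\<forall>\<^sub>F w in nhds w0. w \<in> ball w0 d" using d by (intro eventually_nhds_in_open) auto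
  ultimately show ?thesis
  proof eventually_elim
    case (elim w)
    have "pmult y w = 0" if "y \<in> inside S \<inter> U0" for y
      using that elim(2) pmult_eq_0_iff[of y w] by (auto simp: U0_def)
    then show ?case using elim by auto
  qed
qed

lemma N_constant_on:
  assumes fS: "f ` S \<subseteq> \<Gamma>" "S \<inter> P = {}" and X: "connected X" "X \<inter> \<Gamma> = {}"
  obtains n where "\<And>w. w \<in> X \<Longrightarrow> N w = n"
proof -
  have "N constant_on X"
  proof (rule locally_constant_imp_constant[OF X(1)])
    fix a assume a: "a \<in> X"
    then have "\<forall>\<^sub>F w in nhds a. N w = N a" using N_locally_constant[OF fS] X by blast
    then obtain T where T: "open T" "a \<in> T" "\<forall>w\<in>T. N w = N a" unfolding eventually_nhds by blast
    show "\<exists>T. openin (top_of_set X) T \<and> a \<in> T \<and> (\<forall>x\<in>T. N x = N a)"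
    proof (intro exI conjI ballI)
      show "openin (top_of_set X) (X \<inter> T)" using T(1) by (rule openin_open_Int)
      show "a \<in> X \<inter> T" using a T(2) by blast
      show "N x = N a" if "x \<in> X \<inter> T" for x using T(3) that by simp
    qed
  qed
  then show ?thesis using that unfolding constant_on_def by blast
qed

lemma eventually_outside: "\<forall>\<^sub>F w in at_infinity. w \<in> outside \<Gamma>"
proof -
  have "bounded (inside \<Gamma> \<union> \<Gamma>)" using J\<Gamma>(15) compact_imp_bounded by blast
  then obtain b where b: "\<And>w. w \<in> inside \<Gamma> \<union> \<Gamma> \<Longrightarrow> cmod w \<le> b" unfolding bounded_iff by blast
  have "w \<in> outside \<Gamma>" if "b + 1 \<le> cmod w" for w
  proof -
    have "w \<notin> inside \<Gamma> \<union> \<Gamma>" using b[of w] that by auto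
    then show ?thesis using J\<Gamma>(11) by blast
  qed
  then show ?thesis unfolding eventually_at_infinity by blast
qed

text \<open>Same mechanism at infinity: \<open>f\<close> is bounded near \<open>S\<close> because
  \<open>\<Gamma>\<close> is bounded.\<close>

lemma eventually_N_infinity:
  assumes fS: "f ` S \<subseteq> \<Gamma>" "S \<inter> P = {}"
  shows "\<forall>\<^sub>F w in at_infinity. N w = Ninf"
proof -
  obtain b where b: "\<And>w. w \<in> \<Gamma> \<Longrightarrow> cmod w \<le> b" using compact_imp_bounded[OF J\<Gamma>(1)] by (auto simp: bounded_iff)
  define U0 where "U0 = {z \<in> G - P. f z \<in> ball 0 (b + 1)}"
  have "open U0" unfolding U0_def by (intro open_preimage) auto
  moreover have "S \<subseteq> U0"
  proof
    fix z assume "z \<in> S"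
    moreover from this have "cmod (f z) \<le> b" using b fS by blast
    ultimately show "z \<in> U0" using fS S(2) by (auto simp: U0_def)
  qed
  ultimately obtain U' where "\<forall>\<^sub>F w in at_infinity. Ninf \<le> N w \<and>
       (Ninf = N w \<longrightarrow> (\<forall>y\<in>inside S \<inter> U'. pmult y w = 0)) \<and>
       ((\<forall>y\<in>inside S \<inter> U0. pmult y w = 0) \<longrightarrow> Ninf = N w)"
    using eventually_Ninf[of U0] unfolding boundary by metis
  moreover have "\<forall>\<^sub>F w in at_infinity. b + 1 \<le> cmod w" unfolding eventually_at_infinity by blast
  ultimately show ?thesis
  proof eventually_elim
    case (elim w)
    have "pmult y w = 0" if "y \<in> inside S \<inter> U0" for y
      using that elim(2) pmult_eq_0_iff[of y w] by (auto simp: U0_def)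
    then show ?case using elim by auto
  qed
qed

section \<open>From a pseudo-lemniscate to preimage counts, and back\<close>

lemma pseudo_lemniscateD:
  assumes "pseudo_lemniscate f G P \<Gamma> S"
  shows "f ` S \<subseteq> \<Gamma>" "S \<inter> P = {}"
  using in_components_subset[OF assms[unfolded pseudo_lemniscate_def]] by auto

lemma pseudo_lemniscate_isolated:
  assumes "pseudo_lemniscate f G P \<Gamma> S" "z0 \<in> S"
  obtains U where "open U" "z0 \<in> U" "{z \<in> G - P. f z \<in> \<Gamma>} \<inter> U \<subseteq> S"
proof -
  have comp: "S \<in> components {z \<in> G - P. f z \<in> \<Gamma>}" using assms(1) by (simp add: pseudo_lemniscate_def)
  have z0: "z0 \<in> G - P" "f z0 \<in> \<Gamma>" using in_components_subset[OF comp] assms(2) by auto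
  have "deriv f z0 \<noteq> 0"
    using component_imp_regular[OF S(1) assms(2) \<Gamma> z0(2) hol open_GP connected_GP nonconst z0(1) comp] .
  from component_imp_isolated[OF assms(2) \<Gamma> z0(2) hol open_GP z0(1) this comp] show ?thesis
    using that by blast
qed

text \<open>Neither containment of \<open>S\<close> nor connectedness is demanded, so that any union
  of collars for the same \<open>X\<close> is again one; this is what lets local collars be
  glued.\<close>

definition collar :: "complex set \<Rightarrow> complex set \<Rightarrow> bool" where
  "collar X U \<longleftrightarrow> open U \<and> U \<subseteq> G - P \<and> f ` (U \<inter> inside S) \<subseteq> X"

text \<open>Near \<open>z0\<close> the preimage of \<open>\<Gamma>\<close> lies on \<open>S\<close>,
  so \<open>f\<close> avoids \<open>\<Gamma>\<close> on the image of an upper half disk under the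
  chart. That image is connected, hence sent into one face.\<close>

lemma local_collar:
  assumes "pseudo_lemniscate f G P \<Gamma> S" "z0 \<in> S"
  shows "\<exists>U. z0 \<in> U \<and> (collar (inside \<Gamma>) U \<or> collar (outside \<Gamma>) U)"
proof -
  obtain U1 where U1: "open U1" "z0 \<in> U1" "{z \<in> G - P. f z \<in> \<Gamma>} \<inter> U1 \<subseteq> S"
    by (rule pseudo_lemniscate_isolated[OF assms], rule that; assumption)
  obtain F \<kappa> r c where ch: "jordan_chart S z0 F \<kappa> r c" using jordan_chart_exists[OF S(1) assms(2)] by blast
  note c = jordan_chartD[OF ch]
  define W where "W = U1 \<inter> (G - P)"
  have z0: "z0 \<in> G - P" using pseudo_lemniscateD[OF assms(1)] assms(2) S(2) by blast
  have "open W" unfolding W_def using U1(1) open_GP by (rule open_Int)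
  then have "open (ball 0 r \<inter> F -` W)" by (rule continuous_open_preimage[OF c(7) open_ball])
  moreover have "0 \<in> ball 0 r \<inter> F -` W" using c(1,3) z0 U1(2) by (simp add: W_def)
  ultimately obtain d where d: "d > 0" "ball 0 d \<subseteq> ball 0 r \<inter> F -` W" by (meson openE)
  define U where "U = F ` ball 0 d"
  have cFd: "continuous_on (ball 0 d) F" using c(7) d(2) continuous_on_subset by blast
  have opU: "open U" unfolding U_def
  proof (rule invariance_of_domain[OF cFd open_ball])
    show "inj_on F (ball 0 d)" using c(9) d(2) by (metis (no_types, lifting) inj_on_def Int_iff subsetD)
  qed
  have UW: "U \<subseteq> W" using d(2) by (auto simp: U_def)
  have z0U: "z0 \<in> U" using c(3) d(1) unfolding U_def by (intro image_eqI[of _ F 0]) auto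
  have eq: "U \<inter> inside S = F ` (ball 0 d \<inter> {z. Im z > 0})"
    using c(14) d(2) by (auto simp: U_def subset_iff)
  have "connected (U \<inter> inside S)"
    unfolding eq using cFd by (intro connected_continuous_image connected_half_ball) (auto intro: continuous_on_subset)
  moreover have "continuous_on (U \<inter> inside S) f" using cont UW by (auto simp: W_def intro: continuous_on_subset)
  ultimately have con: "connected (f ` (U \<inter> inside S))" by (intro connected_continuous_image)
  have "f z \<notin> \<Gamma>" if "z \<in> U \<inter> inside S" for z
    using that UW U1(3) JS(16) unfolding W_def by blast
  then have "f ` (U \<inter> inside S) \<subseteq> inside \<Gamma> \<union> outside \<Gamma>" using J\<Gamma>(11) by blast
  then have "f ` (U \<inter> inside S) \<subseteq> inside \<Gamma> \<or> f ` (U \<inter> inside S) \<subseteq> outside \<Gamma>"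
    using connectedD[OF con J\<Gamma>(5,7)] J\<Gamma>(10) by blast
  then show ?thesis using opU UW z0U by (auto simp: collar_def W_def)
qed

text \<open>Connectedness of \<open>S\<close>: the largest collars for the two faces cover
  \<open>S\<close>. If they met at a point of \<open>S\<close> they would meet at a nearby point of
  \<open>inside S\<close>, whose value would lie in both faces.\<close>

lemma global_collar:
  assumes "pseudo_lemniscate f G P \<Gamma> S"
  obtains U where "S \<subseteq> U" "collar (inside \<Gamma>) U \<or> collar (outside \<Gamma>) U"
proof -
  define UU where "UU = (\<lambda>X. \<Union>{U. collar X U})"
  have col: "collar X (UU X)" for X unfolding UU_def collar_def by blast
  have op: "open (UU X)" for X using col by (simp add: collar_def)
  have cov: "S \<subseteq> UU (inside \<Gamma>) \<union> UU (outside \<Gamma>)" using local_collar[OF assms] unfolding UU_def by blast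
  have "UU (inside \<Gamma>) \<inter> UU (outside \<Gamma>) \<inter> S = {}"
  proof (rule ccontr)
    assume "UU (inside \<Gamma>) \<inter> UU (outside \<Gamma>) \<inter> S \<noteq> {}"
    then obtain z where z: "z \<in> S" "z \<in> UU (inside \<Gamma>) \<inter> UU (outside \<Gamma>)" by blast
    have "UU (inside \<Gamma>) \<inter> UU (outside \<Gamma>) \<inter> inside S \<noteq> {}"
      using S_closure[OF z(1) _ z(2)] op by blast
    then obtain y where "y \<in> UU (inside \<Gamma>) \<inter> inside S" "y \<in> UU (outside \<Gamma>) \<inter> inside S" by blast
    then have "f y \<in> inside \<Gamma>" "f y \<in> outside \<Gamma>" using col[of "inside \<Gamma>"] col[of "outside \<Gamma>"] unfolding collar_def by blast+
    then show False using J\<Gamma>(10) by blast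
  qed
  then have "UU (inside \<Gamma>) \<inter> S = {} \<or> UU (outside \<Gamma>) \<inter> S = {}" using connectedD[OF JS(2) op op _ cov] by blast
  then have "S \<subseteq> UU (outside \<Gamma>) \<or> S \<subseteq> UU (inside \<Gamma>)" using cov by blast
  then show ?thesis using that col by blast
qed

text \<open>\<open>X\<close> is the face taken on the inner side of \<open>S\<close>. Values in
  \<open>Y\<close> near \<open>w0\<close> have no solutions in the collar, so the count does not
  change from \<open>Y\<close> to \<open>w0\<close>; semicontinuity along \<open>X\<close> gives the
  inequality that turns \<open>nY\<close> into the minimum.\<close>

lemma N_on_curve:
  assumes U: "S \<subseteq> U" "collar X U" and XY: "X \<inter> Y = {}" "\<Gamma> \<subseteq> closure X" "\<Gamma> \<subseteq> closure Y"
    and w0: "w0 \<in> \<Gamma>" and nX: "\<And>w. w \<in> X \<Longrightarrow> N w = nX" and nY: "\<And>w. w \<in> Y \<Longrightarrow> N w = nY"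
  shows "N w0 = nY" "nY \<le> nX"
proof -
  have "open U" using U by (simp add: collar_def)
  then obtain U' where ev: "\<forall>\<^sub>F w in nhds w0. N w0 \<le> N w \<and>
       (N w0 = N w \<longrightarrow> (\<forall>y\<in>inside S \<inter> U'. pmult y w = 0)) \<and>
       ((\<forall>y\<in>inside S \<inter> U. pmult y w = 0) \<longrightarrow> N w0 = N w)"
    using eventually_N[of U w0] U(1) unfolding boundary by metis
  then obtain T where T: "open T" "w0 \<in> T" "\<And>w. w \<in> T \<Longrightarrow> N w0 \<le> N w \<and>
       ((\<forall>y\<in>inside S \<inter> U. pmult y w = 0) \<longrightarrow> N w0 = N w)"
    unfolding eventually_nhds by blast
  obtain y where y: "y \<in> T" "y \<in> Y" using T XY(3) w0 by (metis closure_iff_nhds_not_empty disjoint_iff subsetD subset_refl)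
  obtain x where x: "x \<in> T" "x \<in> X" using T XY(2) w0 by (metis closure_iff_nhds_not_empty disjoint_iff subsetD subset_refl)
  have "pmult z y = 0" if "z \<in> inside S \<inter> U" for z
  proof -
    have "f z \<in> X" "z \<in> G" using U(2) that unfolding collar_def by blast+
    then have "f z \<noteq> y" using XY(1) y(2) by blast
    then show ?thesis using pmult_eq_0_iff[OF \<open>z \<in> G\<close>] by blast
  qed
  then have "N w0 = N y" using T(3)[OF y(1)] by blast
  then show "N w0 = nY" using nY y by simp
  moreover have "N w0 \<le> N x" using T(3)[OF x(1)] by blast
  ultimately show "nY \<le> nX" using nX x by simp
qed

lemma pseudo_lemniscate_imp_counts:
  assumes "pseudo_lemniscate f G P \<Gamma> S"
  obtains nm np where "\<And>w. w \<in> inside \<Gamma> \<Longrightarrow> N w = nm" "\<And>w. w \<in> outside \<Gamma> \<Longrightarrow> N w = np" "Ninf = np"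
    "\<And>w. w \<in> \<Gamma> \<Longrightarrow> N w = min nm np"
proof -
  note fS = pseudo_lemniscateD[OF assms]
  have disj: "inside \<Gamma> \<inter> \<Gamma> = {}" "outside \<Gamma> \<inter> \<Gamma> = {}" using J\<Gamma>(11) by blast+
  obtain nm where nm: "\<And>w. w \<in> inside \<Gamma> \<Longrightarrow> N w = nm" using N_constant_on[OF fS J\<Gamma>(6) disj(1)] by blast
  obtain np where np: "\<And>w. w \<in> outside \<Gamma> \<Longrightarrow> N w = np" using N_constant_on[OF fS J\<Gamma>(8) disj(2)] by blast
  have "\<forall>\<^sub>F w::complex in at_infinity. Ninf = np"
    using eventually_N_infinity[OF fS] eventually_outside
  proof eventually_elim
    case (elim w)
    then show ?case using np[of w] by simp
  qed
  then have inf: "Ninf = np" using eventually_happens'[OF trivial_limit_at_infinity] by blast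
  obtain U where U: "S \<subseteq> U" "collar (inside \<Gamma>) U \<or> collar (outside \<Gamma>) U" using global_collar[OF assms] by blast
  have cl: "\<Gamma> \<subseteq> closure (inside \<Gamma>)" "\<Gamma> \<subseteq> closure (outside \<Gamma>)" using J\<Gamma>(12,13) by (auto simp: frontier_def)
  have "N w = min nm np" if w: "w \<in> \<Gamma>" for w
    using U(2)
  proof
    assume "collar (inside \<Gamma>) U"
    from N_on_curve[OF U(1) this J\<Gamma>(10) cl w nm np] show ?thesis by simp
  next
    assume c: "collar (outside \<Gamma>) U"
    have "outside \<Gamma> \<inter> inside \<Gamma> = {}" using J\<Gamma>(10) by blast
    from N_on_curve[OF U(1) c this cl(2,1) w np nm] show ?thesis by simp
  qed
  then show ?thesis using that nm np inf by blast
qed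

text \<open>A point \<open>z\<close> of \<open>D\<close> near \<open>z0\<close> is itself a solution
  for the value \<open>f z\<close>, which tends along \<open>F\<close>. The general filter covers
  both a finite boundary value and a pole on \<open>S\<close>.\<close>

lemma values_near_S:
  assumes z0: "z0 \<in> S" and U': "open U'" "z0 \<in> U'" and lim: "filterlim f F (at z0)"
    and ev: "\<forall>\<^sub>F w in F. w \<in> E \<longrightarrow> (\<forall>y\<in>inside S \<inter> U'. pmult y w = 0)"
  obtains U where "open U" "z0 \<in> U" "\<And>z. z \<in> inside S \<inter> U - P \<Longrightarrow> f z \<notin> E"
proof -
  have "\<forall>\<^sub>F z in at z0. f z \<in> E \<longrightarrow> (\<forall>y\<in>inside S \<inter> U'. pmult y (f z) = 0)"
    using eventually_compose_filterlim[OF ev lim] .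
  then obtain T where T: "open T" "z0 \<in> T" "\<And>z. z \<in> T \<Longrightarrow> z \<noteq> z0 \<Longrightarrow> f z \<in> E \<longrightarrow> (\<forall>y\<in>inside S \<inter> U'. pmult y (f z) = 0)"
    unfolding eventually_at_topological by blast
  show ?thesis
  proof (rule that[of "T \<inter> U'"])
    fix z assume z: "z \<in> inside S \<inter> (T \<inter> U') - P"
    have "z \<noteq> z0" using z z0 JS(16) by blast
    moreover have "pmult z (f z) \<noteq> 0" using z pmult_eq_0_iff[of z "f z"] DG by auto
    moreover have "pmult z (f z) = 0" if "f z \<in> E"
      using T(3)[of z] z \<open>z \<noteq> z0\<close> that by simp
    ultimately show "f z \<notin> E" by auto
  qed (use T U' in auto)
qed

text \<open>With all values missed, every point of \<open>D\<close> near \<open>z0\<close> would be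
  a pole, but only finitely many poles lie in the compact set
  \<open>inside S \<union> S\<close>.\<close>

lemma not_eventually_missed:
  assumes z0: "z0 \<in> S" and U': "open U'" "z0 \<in> U'" and lim: "filterlim f F (at z0)"
    and ev: "\<forall>\<^sub>F w in F. (\<forall>y\<in>inside S \<inter> U'. pmult y w = 0)"
  shows False
proof -
  obtain U where U: "open U" "z0 \<in> U" "\<And>z. z \<in> inside S \<inter> U - P \<Longrightarrow> f z \<notin> UNIV"
    using values_near_S[OF z0 U' lim, of UNIV] ev by auto
  have ne: "U \<inter> inside S \<noteq> {}" using S_closure[OF z0 U(1,2)] .
  have op: "open (U \<inter> inside S)" using U(1) JS(5) by blast
  have "infinite (U \<inter> inside S)" using ne op by (metis finite_imp_not_open)
  moreover have "finite ((inside S \<union> S) \<inter> P)" using finite_poles[OF K] .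
  ultimately have "\<not> U \<inter> inside S \<subseteq> (inside S \<union> S) \<inter> P" using finite_subset by blast
  then show False using U(3) by blast
qed

lemma counts_imp_pseudo_lemniscate:
  assumes nm: "\<And>w. w \<in> inside \<Gamma> \<Longrightarrow> N w = nm" and np: "\<And>w. w \<in> outside \<Gamma> \<Longrightarrow> N w = np" and inf: "Ninf = np"
    and n\<Gamma>: "\<And>w. w \<in> \<Gamma> \<Longrightarrow> N w = min nm np"
  shows "pseudo_lemniscate f G P \<Gamma> S"
proof -
  \<comment> \<open>\<open>N\<close> equals \<open>Ninf\<close> near infinity, so large values are
    missed in \<open>D\<close> near \<open>S\<close>; a pole on \<open>S\<close> would produce
    them.\<close>
  have SP: "S \<inter> P = {}"
  proof (rule ccontr)
    assume "S \<inter> P \<noteq> {}"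
    then obtain p where p: "p \<in> S" "p \<in> P" by blast
    obtain U' where U': "open U'" "S \<subseteq> U'" "\<forall>\<^sub>F w in at_infinity. Ninf \<le> N w \<and>
       (Ninf = N w \<longrightarrow> (\<forall>y\<in>inside S \<inter> U'. pmult y w = 0)) \<and>
       ((\<forall>y\<in>inside S \<inter> UNIV. pmult y w = 0) \<longrightarrow> Ninf = N w)"
      using eventually_Ninf[of UNIV] unfolding boundary by auto
    have "\<forall>\<^sub>F w in at_infinity. \<forall>y\<in>inside S \<inter> U'. pmult y w = 0"
      using U'(3) eventually_outside by eventually_elim (use np inf in auto)
    then show False using not_eventually_missed[OF p(1) U'(1) _ pole[OF p(2), unfolded is_pole_def]] p U' by blast
  qed
  have lim: "filterlim f (nhds (f z)) (at z)" if "z \<in> S" for z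
  proof -
    have "z \<in> G - P" using that SP S(2) by blast
    then have "isCont f z" using cont open_GP continuous_on_eq_continuous_at by blast
    then show ?thesis by (simp add: isCont_def)
  qed
  have evN: "\<exists>U'. open U' \<and> S \<subseteq> U' \<and> (\<forall>\<^sub>F w in nhds w0. N w0 = N w \<longrightarrow> (\<forall>y\<in>inside S \<inter> U'. pmult y w = 0))" for w0
  proof -
    obtain U' where U': "open U'" "S \<subseteq> U'" "\<forall>\<^sub>F w in nhds w0. N w0 \<le> N w \<and>
       (N w0 = N w \<longrightarrow> (\<forall>y\<in>inside S \<inter> U'. pmult y w = 0)) \<and>
       ((\<forall>y\<in>inside S \<inter> UNIV. pmult y w = 0) \<longrightarrow> N w0 = N w)"
      using eventually_N[of UNIV w0] unfolding boundary by auto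
    moreover from U'(3) have "\<forall>\<^sub>F w in nhds w0. N w0 = N w \<longrightarrow> (\<forall>y\<in>inside S \<inter> U'. pmult y w = 0)"
      by eventually_elim blast
    ultimately show ?thesis by blast
  qed
  \<comment> \<open>The same argument at a finite value: \<open>N\<close> is constant on the open
    face containing \<open>f z\<close>, so values near \<open>f z\<close> would be missed in
    \<open>D\<close> near \<open>z\<close>.\<close>
  have fS: "f z \<in> \<Gamma>" if z: "z \<in> S" for z
  proof (rule ccontr)
    assume "f z \<notin> \<Gamma>"
    then obtain X where X: "X = inside \<Gamma> \<or> X = outside \<Gamma>" "f z \<in> X" using J\<Gamma>(11) by blast
    have op: "open X" and cst: "\<And>w. w \<in> X \<Longrightarrow> N w = N (f z)" using X nm np J\<Gamma>(5,7) by auto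
    obtain U' where U': "open U'" "S \<subseteq> U'" "\<forall>\<^sub>F w in nhds (f z). N (f z) = N w \<longrightarrow> (\<forall>y\<in>inside S \<inter> U'. pmult y w = 0)"
      using evN by blast
    have "\<forall>\<^sub>F w in nhds (f z). w \<in> X" using op X(2) by (rule eventually_nhds_in_open)
    with U'(3) have "\<forall>\<^sub>F w in nhds (f z). \<forall>y\<in>inside S \<inter> U'. pmult y w = 0"
    proof eventually_elim
      case (elim w)
      then show ?case using cst[of w] by simp
    qed
    then show False using not_eventually_missed[OF z U'(1) _ lim[OF z]] z U' by blast
  qed
  have iso: "\<exists>U. open U \<and> z \<in> U \<and> {z \<in> G - P. f z \<in> \<Gamma>} \<inter> U \<subseteq> S" if z: "z \<in> S" for z
  proof -
    have zGP: "z \<in> G - P" using z SP S(2) by blast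
    \<comment> \<open>\<open>X\<close> is the face with the larger count (the inner one on a tie).
      Off \<open>X\<close>, on \<open>\<Gamma>\<close> included, the count is the minimum, which is
      also \<open>N (f z)\<close>; these values are therefore missed near \<open>z\<close>, and
      \<open>D\<close> near \<open>z\<close> is sent into \<open>X\<close>.\<close>
    obtain E X where EX: "X = inside \<Gamma> \<or> X = outside \<Gamma>" "E = - X" "\<And>w. w \<in> E \<Longrightarrow> N w = N (f z)"
    proof (cases "np \<le> nm")
      case True
      have "N w = N (f z)" if "w \<in> - inside \<Gamma>" for w
      proof -
        have "w \<in> \<Gamma> \<or> w \<in> outside \<Gamma>" using that J\<Gamma>(11) by blast
        then show ?thesis using np[of w] n\<Gamma>[of w] n\<Gamma>[OF fS[OF z]] True by auto
      qed
      then show ?thesis using that[of "inside \<Gamma>"] by blast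
    next
      case False
      have "N w = N (f z)" if "w \<in> - outside \<Gamma>" for w
      proof -
        have "w \<in> \<Gamma> \<or> w \<in> inside \<Gamma>" using that J\<Gamma>(11) by blast
        then show ?thesis using nm[of w] n\<Gamma>[of w] n\<Gamma>[OF fS[OF z]] False by auto
      qed
      then show ?thesis using that[of "outside \<Gamma>"] by blast
    qed
    obtain U' where U': "open U'" "S \<subseteq> U'" "\<forall>\<^sub>F w in nhds (f z). N (f z) = N w \<longrightarrow> (\<forall>y\<in>inside S \<inter> U'. pmult y w = 0)"
      using evN by blast
    from U'(3) have "\<forall>\<^sub>F w in nhds (f z). w \<in> E \<longrightarrow> (\<forall>y\<in>inside S \<inter> U'. pmult y w = 0)"
    proof eventually_elim
      case (elim w)
      then show ?case using EX(3)[of w] by simp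
    qed
    from values_near_S[OF z U'(1) _ lim[OF z] this] obtain U where U: "open U" "z \<in> U"
      "\<And>z. z \<in> inside S \<inter> U - P \<Longrightarrow> f z \<notin> E" using z U'(2) by blast
    have U2: "open (U \<inter> (G - P))" "z \<in> U \<inter> (G - P)" using U(1,2) open_GP zGP by auto
    have "f ` (U \<inter> (G - P) \<inter> inside S) \<subseteq> X" using U(3) EX(2) by blast
    then have "f ` (U \<inter> (G - P) \<inter> inside S) \<subseteq> inside \<Gamma> \<or> f ` (U \<inter> (G - P) \<inter> inside S) \<subseteq> outside \<Gamma>" using EX(1) by blast
    then have d: "deriv f z \<noteq> 0"
      using one_sided_imp_regular[OF S(1) z \<Gamma> fS[OF z] hol open_GP connected_GP nonconst zGP U2] by blast
    have fS': "f ` S \<subseteq> \<Gamma>" using fS by blast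
    obtain U where "open U" "z \<in> U" "{z \<in> G - P. f z \<in> \<Gamma>} \<inter> U \<subseteq> S"
      by (rule subset_preimage_imp_isolated[OF S(1) z \<Gamma> fS' hol open_GP zGP d], rule that; assumption)
    then show ?thesis by blast
  qed
  have sub: "S \<subseteq> {z \<in> G - P. f z \<in> \<Gamma>}" using fS SP S(2) by blast
  \<comment> \<open>By \<open>iso\<close>, \<open>S\<close> is relatively open in any such
    \<open>T\<close>, and it is closed by compactness; a connected \<open>T\<close> cannot be
    larger.\<close>
  have "T = S" if T: "T \<noteq> {}" "S \<subseteq> T" "T \<subseteq> {z \<in> G - P. f z \<in> \<Gamma>}" "connected T" for T
  proof -
    define W where "W = \<Union>{U. open U \<and> {z \<in> G - P. f z \<in> \<Gamma>} \<inter> U \<subseteq> S}"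
    have "open W" unfolding W_def by blast
    moreover have "S = T \<inter> W" using iso T(2,3) unfolding W_def by blast
    ultimately have "openin (top_of_set T) S" by (metis openin_open_Int)
    moreover have "closedin (top_of_set T) S"
      using JS(1) T(2) by (meson closed_subset compact_imp_closed)
    ultimately show ?thesis using T(4) JS(3) unfolding connected_clopen by blast
  qed
  then show ?thesis unfolding pseudo_lemniscate_def in_components_maximal using sub JS(2,3) by blast
qed

end

text \<open>For constant \<open>f\<close> the only possible component is all of
  \<open>G - P\<close>, so \<open>S\<close> would be open as well as compact and nonempty.\<close>

lemma pseudo_lemniscate_imp_nonconstant:
  assumes G: "open G" "connected G" and S: "smooth_jordan_curve S"
    and f: "meromorphic_with_poles f G P" and lem: "pseudo_lemniscate f G P \<Gamma> S"
  shows "\<not> f constant_on (G - P)"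
proof
  assume "f constant_on (G - P)"
  then obtain w where w: "\<And>z. z \<in> G - P \<Longrightarrow> f z = w" unfolding constant_on_def by blast
  have sp: "P sparse_in G" using f sparse_in_open[OF G(1)] by (auto simp: meromorphic_with_poles_def)
  have op: "open (G - P)" and con: "connected (G - P)"
    using open_diff_sparse_pts[OF G(1) sp] sparse_imp_connected[OF _ G(2,1) sp] by auto
  have comp: "S \<in> components {z \<in> G - P. f z \<in> \<Gamma>}" using lem by (simp add: pseudo_lemniscate_def)
  then have ne: "{z \<in> G - P. f z \<in> \<Gamma>} \<noteq> {}" by (metis components_empty empty_iff)
  then have "{z \<in> G - P. f z \<in> \<Gamma>} = G - P" using w by auto
  with comp con ne have "S = G - P" by (metis connected_eq_connected_components_eq components_eq_sing_iff singletonD)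
  then have "open S" "closed S" "S \<noteq> {}" "bounded S"
    using op smooth_jordan_curve_facts(1,3)[OF S] compact_imp_closed compact_imp_bounded by auto
  then show False using clopen[of S] not_bounded_UNIV by blast
qed

text \<open>A constant value would be taken at infinitely many points of \<open>inside S\<close>, so
  its count would be infinite.\<close>

lemma finite_counts_imp_nonconstant:
  assumes G: "open G" "connected G" and S: "smooth_jordan_curve S" "inside S \<union> S \<subseteq> G"
    and f: "meromorphic_with_poles f G P" and fin: "\<And>w. count_preimages f P (inside S) w \<noteq> \<infinity>"
  shows "\<not> f constant_on (G - P)"
proof
  assume "f constant_on (G - P)"
  then obtain w where w: "\<And>z. z \<in> G - P \<Longrightarrow> f z = w" unfolding constant_on_def by blast
  note J = smooth_jordan_curve_facts[OF S(1)]
  have sp: "P sparse_in G" using f sparse_in_open[OF G(1)] by (auto simp: meromorphic_with_poles_def)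
  have "finite ((inside S \<union> S) \<inter> P)"
    using sparse_in_compact_finite[OF sparse_in_subset[OF sp S(2)] J(15)] .
  moreover have "infinite (inside S)" using J(4,5) finite_imp_not_open by blast
  moreover have "inside S \<subseteq> (inside S - P) \<union> ((inside S \<union> S) \<inter> P)" by blast
  ultimately have "infinite (inside S - P)" using finite_subset finite_UnI by blast
  moreover have "{z \<in> inside S - P. f z = w} = inside S - P" using w S(2) by blast
  ultimately have "count_preimages f P (inside S) w = \<infinity>" by (simp add: count_preimages_def)
  then show False using fin by blast
qed

subsection \<open>Blaschke products\<close>

text \<open>The limit \<open>norm z\<close> to 1 from below, uniform in the argument; all boundary
  behaviour of disk functions is phrased with this filter.\<close>

abbreviation at_circle :: "complex filter" where
  "at_circle \<equiv> filtercomap norm (at_left (1::real))"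

lemma eventually_at_circle:
  "eventually Q at_circle \<longleftrightarrow> (\<exists>r<1. \<forall>z. r < norm z \<and> norm z < 1 \<longrightarrow> Q z)"
proof
  assume "eventually Q at_circle"
  then obtain R where R: "eventually R (at_left 1)" "\<And>z. R (norm z) \<Longrightarrow> Q z"
    unfolding eventually_filtercomap by blast
  then obtain r where "r < 1" "\<And>y. r < y \<Longrightarrow> y < 1 \<Longrightarrow> R y"
    using eventually_at_left[of 0 "1::real" R] by auto
  then show "\<exists>r<1. \<forall>z. r < norm z \<and> norm z < 1 \<longrightarrow> Q z" using R(2) by blast
next
  assume "\<exists>r<1. \<forall>z. r < norm z \<and> norm z < 1 \<longrightarrow> Q z"
  then obtain r where r: "r < 1" "\<And>z. r < norm z \<Longrightarrow> norm z < 1 \<Longrightarrow> Q z" by blast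
  have "eventually (\<lambda>y. r < y \<and> y < 1) (at_left (1::real))"
    using eventually_at_left[of r "1::real"] r(1) by auto
  then show "eventually Q at_circle" unfolding eventually_filtercomap using r(2) by blast
qed

lemma eventually_at_circle_ball: "\<forall>\<^sub>F z in at_circle. z \<in> ball 0 1"
  unfolding eventually_at_circle by (rule exI[of _ 0]) auto

lemma eventually_at_circle_notin:
  assumes "compact C" "C \<subseteq> ball 0 1"
  shows "\<forall>\<^sub>F z in at_circle. z \<notin> C"
proof (cases "C = {}")
  case False
  obtain x where x: "x \<in> C" "\<And>y. y \<in> C \<Longrightarrow> norm y \<le> norm x"
    using continuous_attains_sup[OF assms(1) False, of norm] by (auto intro: continuous_intros)
  then have "norm x < 1" using assms(2) by auto
  then show ?thesis unfolding eventually_at_circle using x(2) by (intro exI[of _ "norm x"]) (auto simp: not_less[symmetric])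
qed simp

lemma tendsto_norm_at_circle: "(norm \<longlongrightarrow> 1) at_circle"
  using filterlim_filtercomap[of norm "at_left (1::real)"]
  by (rule filterlim_mono) (auto simp: at_within_le_nhds)

definition blaschke_factor :: "complex \<Rightarrow> complex \<Rightarrow> complex" where
  "blaschke_factor a z = (z - a) / (1 - cnj a * z)"

lemma blaschke_denom_nonzero:
  assumes "norm a < 1" "norm z < 1" shows "1 - cnj a * z \<noteq> 0"
proof
  assume "1 - cnj a * z = 0"
  then have "norm (cnj a * z) = 1" by (metis norm_one right_minus_eq)
  moreover have "norm a * norm z < 1 * 1" using assms by (intro mult_strict_mono) auto
  ultimately show False by (simp add: norm_mult)
qed

lemma blaschke_factor_analytic:
  assumes "norm a < 1" "norm z < 1" shows "blaschke_factor a analytic_on {z}"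
  unfolding blaschke_factor_def using blaschke_denom_nonzero[OF assms] by (intro analytic_intros) auto

lemma has_order_blaschke_factor:
  assumes "norm a < 1" "norm z < 1"
  shows "has_order (blaschke_factor a) z (if z = a then 1 else 0)"
proof (cases "z = a")
  case True
  have "has_order (\<lambda>x. (x - a) * inverse (1 - cnj a * x)) a (1 + 0)"
    using blaschke_denom_nonzero[OF assms] True
    by (intro has_order_mult has_order_ident has_order_analytic analytic_intros) auto
  then show ?thesis using True by (simp add: blaschke_factor_def[abs_def] divide_inverse)
next
  case False
  then show ?thesis using blaschke_denom_nonzero[OF assms] blaschke_factor_analytic[OF assms]
    by (auto intro!: has_order_analytic simp: blaschke_factor_def)
qed

text \<open>From the identity \<open>id\<close>, the squared modulus differs from 1 by a multiple of
  \<open>1 - (norm z)\<^sup>2\<close>, and the denominator stays away from 0.\<close>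

lemma norm_blaschke_factor_tendsto:
  assumes a: "norm a < 1"
  shows "((\<lambda>z. norm (blaschke_factor a z)) \<longlongrightarrow> 1) at_circle"
proof -
  have id: "(norm (z - a))\<^sup>2 = (norm (1 - cnj a * z))\<^sup>2 - (1 - (norm a)\<^sup>2) * (1 - (norm z)\<^sup>2)" for z
  proof -
    have "complex_of_real ((norm (z - a))\<^sup>2) = of_real ((norm (1 - cnj a * z))\<^sup>2 - (1 - (norm a)\<^sup>2) * (1 - (norm z)\<^sup>2))"
      by (simp add: complex_norm_square algebra_simps del: of_real_power)
    then show ?thesis by (simp only: of_real_eq_iff)
  qed
  have "((\<lambda>z. 1 - (norm z)\<^sup>2) \<longlongrightarrow> 1 - 1\<^sup>2) at_circle"
    by (intro tendsto_diff tendsto_const tendsto_power tendsto_norm_at_circle)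
  then have lim0: "((\<lambda>z. 1 - (norm z)\<^sup>2) \<longlongrightarrow> 0) at_circle" by simp
  have "((\<lambda>z. (norm (blaschke_factor a z))\<^sup>2 - 1) \<longlongrightarrow> 0) at_circle"
  \<comment> \<open>The constant comes from \<open>norm (1 - cnj a * z) \<ge> 1 - norm a\<close> on
    the disk.\<close>
  proof (rule tendsto_0_le[OF lim0, where K = "1 / (1 - norm a)\<^sup>2"])
    show "\<forall>\<^sub>F z in at_circle. norm ((norm (blaschke_factor a z))\<^sup>2 - 1) \<le> norm (1 - (norm z)\<^sup>2) * (1 / (1 - norm a)\<^sup>2)"
      using eventually_at_circle_ball
    proof eventually_elim
      case (elim z)
      then have z: "norm z < 1" by simp
      define d where "d = norm (1 - cnj a * z)"
      have d: "1 - norm a \<le> d"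
      proof -
        have "norm (cnj a * z) \<le> norm a" using z mult_left_mono[of "norm z" 1 "norm a"] by (simp add: norm_mult)
        then show ?thesis using norm_triangle_ineq2[of 1 "cnj a * z"] by (simp add: d_def)
      qed
      have d0: "d > 0" using d a by linarith
      have "(norm (blaschke_factor a z))\<^sup>2 = (d\<^sup>2 - (1 - (norm a)\<^sup>2) * (1 - (norm z)\<^sup>2)) / d\<^sup>2"
        by (simp add: blaschke_factor_def norm_divide power_divide id d_def)
      also have "\<dots> = 1 - (1 - (norm a)\<^sup>2) * (1 - (norm z)\<^sup>2) / d\<^sup>2" using d0 by (simp add: diff_divide_distrib)
      finally have "norm ((norm (blaschke_factor a z))\<^sup>2 - 1) = \<bar>1 - (norm z)\<^sup>2\<bar> * (\<bar>1 - (norm a)\<^sup>2\<bar> / d\<^sup>2)"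
        by (simp add: abs_mult)
      also have "\<dots> \<le> \<bar>1 - (norm z)\<^sup>2\<bar> * (1 / (1 - norm a)\<^sup>2)"
      proof (intro mult_left_mono frac_le)
        have "(norm a)\<^sup>2 \<le> 1" using a by (simp add: power_le_one)
        then show "\<bar>1 - (norm a)\<^sup>2\<bar> \<le> 1" by simp
        show "(1 - norm a)\<^sup>2 \<le> d\<^sup>2" using d a by (intro power_mono) auto
      qed (use a in auto)
      finally show ?case by simp
    qed
  qed
  then have "((\<lambda>z. (norm (blaschke_factor a z))\<^sup>2 - 1 + 1) \<longlongrightarrow> 0 + 1) at_circle" by (intro tendsto_intros)
  then have "((\<lambda>z. sqrt ((norm (blaschke_factor a z))\<^sup>2)) \<longlongrightarrow> sqrt 1) at_circle" by (intro tendsto_intros) simp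
  then show ?thesis by simp
qed

lemma blaschke_product_Suc:
  assumes "blaschke_product n A" "norm b < 1"
  shows "blaschke_product (Suc n) (\<lambda>z. A z * blaschke_factor b z)"
proof -
  obtain c a where ca: "norm c = 1" "\<And>j. j < n \<Longrightarrow> norm (a j) < 1"
    "\<And>z. z \<in> ball 0 1 \<Longrightarrow> A z = c * (\<Prod>j<n. (z - a j) / (1 - cnj (a j) * z))"
    using assms unfolding blaschke_product_def by blast
  define a' where "a' = a(n := b)"
  have "(\<Prod>j<Suc n. (z - a' j) / (1 - cnj (a' j) * z)) = (\<Prod>j<n. (z - a j) / (1 - cnj (a j) * z)) * blaschke_factor b z" for z
    by (simp add: a'_def blaschke_factor_def)
  then show ?thesis unfolding blaschke_product_def
    using ca assms(2) by (intro exI[of _ c] exI[of _ a']) (auto simp: a'_def less_Suc_eq)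
qed

lemma blaschke_product_power:
  assumes "blaschke_product n A" "norm b < 1"
  shows "blaschke_product (n + k) (\<lambda>z. A z * blaschke_factor b z ^ k)"
proof (induction k)
  case 0
  then show ?case using assms by simp
next
  case (Suc k)
  from blaschke_product_Suc[OF this assms(2)] show ?case by (simp add: mult_ac)
qed

lemma blaschke_product_prod:
  assumes "finite Z" "Z \<subseteq> ball 0 1" "norm c = 1"
  shows "blaschke_product (\<Sum>a\<in>Z. m a) (\<lambda>z. c * (\<Prod>a\<in>Z. blaschke_factor a z ^ m a))"
  using assms
proof (induction Z rule: finite_induct)
  case empty
  then show ?case by (auto simp: blaschke_product_def)
next
  case (insert b Z)
  then have "blaschke_product (sum m Z) (\<lambda>z. c * (\<Prod>a\<in>Z. blaschke_factor a z ^ m a))" "norm b < 1" by auto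
  from blaschke_product_power[OF this, of "m b"] insert show ?case by (simp add: mult_ac add_ac)
qed

lemma blaschke_product_divide:
  assumes "blaschke_product n A" "blaschke_product 0 B" "\<And>z. z \<in> ball 0 1 \<Longrightarrow> g z = A z / B z"
  shows "blaschke_product n g"
proof -
  obtain c a where ca: "norm c = 1" "\<And>j. j < n \<Longrightarrow> norm (a j) < 1"
    "\<And>z. z \<in> ball 0 1 \<Longrightarrow> A z = c * (\<Prod>j<n. (z - a j) / (1 - cnj (a j) * z))"
    using assms(1) unfolding blaschke_product_def by blast
  obtain d where d: "norm d = 1" "\<And>z. z \<in> ball 0 1 \<Longrightarrow> B z = d"
    using assms(2) unfolding blaschke_product_def by auto
  show ?thesis unfolding blaschke_product_def
    using ca d assms(3) by (intro exI[of _ "c / d"] exI[of _ a]) (auto simp: norm_divide)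
qed

text \<open>Maximum modulus on a smaller closed disk around 0 that contains \<open>\<xi>\<close> and
  whose boundary circle already has \<open>norm (k z) < 1 + e\<close>.\<close>

lemma norm_le_1_from_circle:
  assumes k: "k holomorphic_on ball 0 1" and lim: "((\<lambda>z. norm (k z)) \<longlongrightarrow> 1) at_circle" and \<xi>: "\<xi> \<in> ball 0 1"
  shows "norm (k \<xi>) \<le> 1"
proof (rule field_le_epsilon)
  fix e :: real assume "e > 0"
  then have "\<forall>\<^sub>F z in at_circle. norm (k z) < 1 + e" using order_tendstoD(2)[OF lim, of "1 + e"] by simp
  then obtain r where r: "r < 1" "\<And>z. r < norm z \<Longrightarrow> norm z < 1 \<Longrightarrow> norm (k z) < 1 + e"
    unfolding eventually_at_circle by blast
  obtain s where s: "max (max r (norm \<xi>)) 0 < s" "s < 1" using dense[of "max (max r (norm \<xi>)) 0" 1] r(1) \<xi> by auto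
  show "norm (k \<xi>) \<le> 1 + e"
  proof (rule maximum_modulus_frontier[of k "cball 0 s"])
    show "k holomorphic_on interior (cball 0 s)" using k s by (auto intro: holomorphic_on_subset)
    show "continuous_on (closure (cball 0 s)) k"
      using holomorphic_on_imp_continuous_on[OF k] s by (auto intro: continuous_on_subset)
    show "norm (k z) \<le> 1 + e" if "z \<in> frontier (cball 0 s)" for z using that r(2)[of z] s by auto
    show "\<xi> \<in> cball 0 s" using s by auto
  qed simp
qed

text \<open>Dividing out the Blaschke products of the zeros and of the poles leaves a zero-free holomorphic
  function of boundary modulus 1; the maximum principle for it and for its reciprocal makes it constant.\<close>
lemma quotient_of_blaschke_products:
  fixes g :: "complex \<Rightarrow> complex" and ord :: "complex \<Rightarrow> int"
  assumes ord: "\<And>z. z \<in> ball 0 1 \<Longrightarrow> has_order g z (ord z)" and fin: "finite {z \<in> ball 0 1. ord z \<noteq> 0}"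
    and hol: "g holomorphic_on ball 0 1 - {z. ord z < 0}"
    and zero: "\<And>z. z \<in> ball 0 1 \<Longrightarrow> ord z > 0 \<Longrightarrow> g z = 0"
    and lim: "((\<lambda>z. norm (g z)) \<longlongrightarrow> 1) at_circle"
  obtains A B where "blaschke_product (\<Sum>z | z \<in> ball 0 1 \<and> ord z > 0. nat (ord z)) A"
    "blaschke_product (\<Sum>z | z \<in> ball 0 1 \<and> ord z < 0. nat (- ord z)) B"
    "\<And>z. z \<in> ball 0 1 \<Longrightarrow> ord z \<ge> 0 \<Longrightarrow> g z = A z / B z"
proof -
  define Z where "Z = {z. z \<in> ball 0 1 \<and> ord z > 0}"
  define Q where "Q = {z. z \<in> ball 0 1 \<and> ord z < 0}"
  have Z: "finite Z" "Z \<subseteq> ball 0 1"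
    by (rule finite_subset[OF _ fin]) (auto simp: Z_def)
  have Q: "finite Q" "Q \<subseteq> ball 0 1"
    by (rule finite_subset[OF _ fin]) (auto simp: Q_def)
  define A where "A = (\<lambda>z. \<Prod>a\<in>Z. blaschke_factor a z ^ nat (ord a))"
  define B where "B = (\<lambda>z. \<Prod>a\<in>Q. blaschke_factor a z ^ nat (- ord a))"
  have oprod: "has_order (\<lambda>x. \<Prod>a\<in>X. blaschke_factor a x ^ m a) z (if z \<in> X then int (m z) else 0)"
    if "finite X" "X \<subseteq> ball 0 1" "z \<in> ball 0 1" for X m z
  proof -
    have "has_order (\<lambda>x. \<Prod>a\<in>X. blaschke_factor a x ^ m a) z (\<Sum>a\<in>X. int (m a) * (if z = a then 1 else 0))"
      using that by (intro has_order_prod has_order_power has_order_blaschke_factor) auto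
    moreover have "(\<Sum>a\<in>X. int (m a) * (if z = a then 1 else 0)) = (if z \<in> X then int (m z) else 0)"
      using that(1) by (simp add: if_distrib[of "\<lambda>t. _ * t"] sum.delta' cong: if_cong)
    ultimately show ?thesis by simp
  qed
  have lprod: "((\<lambda>z. norm (\<Prod>a\<in>X. blaschke_factor a z ^ m a)) \<longlongrightarrow> 1) at_circle" if "X \<subseteq> ball 0 1" for X and m :: "complex \<Rightarrow> nat"
  proof -
    have "((\<lambda>z. \<Prod>a\<in>X. norm (blaschke_factor a z) ^ m a) \<longlongrightarrow> (\<Prod>a\<in>X. 1 ^ m a)) at_circle"
      using that by (intro tendsto_intros norm_blaschke_factor_tendsto) auto
    then show ?thesis by (simp add: prod_norm[symmetric] norm_power)
  qed
  have anprod: "(\<lambda>z. \<Prod>a\<in>X. blaschke_factor a z ^ m a) holomorphic_on ball 0 1" if "X \<subseteq> ball 0 1" for X and m :: "complex \<Rightarrow> nat"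
  proof -
    have "blaschke_factor a holomorphic_on ball 0 1" if "a \<in> X" for a
      using that \<open>X \<subseteq> ball 0 1\<close> blaschke_denom_nonzero[of a] unfolding blaschke_factor_def[abs_def]
      by (intro holomorphic_intros) auto
    then show ?thesis by (intro holomorphic_intros) auto
  qed
  have nzprod: "(\<Prod>a\<in>X. blaschke_factor a z ^ m a) \<noteq> 0" if "finite X" "X \<subseteq> ball 0 1" "z \<in> ball 0 1" "z \<notin> X" for X z and m :: "complex \<Rightarrow> nat"
    using that blaschke_denom_nonzero[of _ z] by (auto simp: blaschke_factor_def)
  define E where "E = Z \<union> Q"
  have E: "finite E" "E \<subseteq> ball 0 1" using Z Q by (auto simp: E_def)
  \<comment> \<open>Of order 0 everywhere on the disk, but possibly with wrong values on the finite
    set \<open>E\<close>; \<open>remove_sings\<close> repairs these below.\<close>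
  define h where "h = (\<lambda>z. g z * inverse (A z) * B z)"
  have oh: "has_order h z 0" if z: "z \<in> ball 0 1" for z
  proof -
    have "has_order h z (ord z + - (if z \<in> Z then int (nat (ord z)) else 0) + (if z \<in> Q then int (nat (- ord z)) else 0))"
      unfolding h_def A_def B_def
      by (intro has_order_mult has_order_inverse ord z oprod Z Q)
    moreover have "ord z + - (if z \<in> Z then int (nat (ord z)) else 0) + (if z \<in> Q then int (nat (- ord z)) else 0) = 0"
      using z by (auto simp: Z_def Q_def)
    ultimately show ?thesis by simp
  qed
  have holA: "A holomorphic_on ball 0 1" and holB: "B holomorphic_on ball 0 1"
    unfolding A_def B_def using anprod Z Q by auto
  have holh: "h holomorphic_on ball 0 1 - E"
  proof -
    have "g holomorphic_on ball 0 1 - E"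
      by (rule holomorphic_on_subset[OF hol]) (auto simp: E_def Q_def)
    moreover have "A holomorphic_on ball 0 1 - E" "B holomorphic_on ball 0 1 - E"
      using holA holB by (auto intro: holomorphic_on_subset)
    moreover have "A z \<noteq> 0" if "z \<in> ball 0 1 - E" for z
      using that nzprod[OF Z] by (auto simp: A_def E_def)
    ultimately show ?thesis unfolding h_def by (intro holomorphic_intros) auto
  qed
  define k where "k = remove_sings h"
  have opE: "open (ball 0 1 - E')" if "E' \<subseteq> E" for E'
    using finite_subset[OF that E(1)] finite_imp_closed by blast
  have kan: "k analytic_on {z}" "k z \<noteq> 0" if z: "z \<in> ball 0 1" for z
  proof -
    obtain l where l: "l \<noteq> 0" "(h \<longlongrightarrow> l) (at z)" using has_order_0_tendsto[OF oh[OF z]] by blast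
    have "isolated_singularity_at h z"
    proof (rule isolated_singularity_at_holomorphic)
      show "h holomorphic_on (ball 0 1 - (E - {z})) - {z}" using holh by (rule holomorphic_on_subset) auto
      show "open (ball 0 1 - (E - {z}))" using opE by blast
    qed (use z in auto)
    then show "k analytic_on {z}" unfolding k_def using l(2) by (rule remove_sings_analytic_at)
    show "k z \<noteq> 0" using remove_sings_eqI[OF l(2)] l(1) by (simp add: k_def)
  qed
  have kh: "k z = h z" if "z \<in> ball 0 1 - E" for z
    unfolding k_def using holh opE[of E] that by (intro remove_sings_at_analytic) (auto simp: analytic_at)
  have holk: "k holomorphic_on ball 0 1"
    using kan(1) by (meson analytic_imp_holomorphic analytic_on_analytic_at)
  have limk: "((\<lambda>z. norm (k z)) \<longlongrightarrow> 1) at_circle"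
  proof -
    have "((\<lambda>z. norm (g z) * inverse (norm (A z)) * norm (B z)) \<longlongrightarrow> 1 * inverse 1 * 1) at_circle"
      unfolding A_def B_def using lim by (intro tendsto_intros lprod Z Q) auto
    moreover have "\<forall>\<^sub>F z in at_circle. norm (g z) * inverse (norm (A z)) * norm (B z) = norm (k z)"
      using eventually_at_circle_ball eventually_at_circle_notin[OF finite_imp_compact[OF E(1)] E(2)]
      by eventually_elim (simp add: kh h_def norm_mult norm_inverse)
    ultimately show ?thesis using Lim_transform_eventually by fastforce
  qed
  have k1: "norm (k z) = 1" if z: "z \<in> ball 0 1" for z
  proof -
    have "norm (k z) \<le> 1" using norm_le_1_from_circle[OF holk limk z] .
    moreover have "norm (inverse (k z)) \<le> 1"
    proof (rule norm_le_1_from_circle[OF _ _ z])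
      show "(\<lambda>z. inverse (k z)) holomorphic_on ball 0 1" by (rule holomorphic_on_inverse[OF holk]) (use kan(2) in auto)
      have "((\<lambda>z. inverse (norm (k z))) \<longlongrightarrow> inverse 1) at_circle" using limk by (intro tendsto_intros) auto
      then show "((\<lambda>z. norm (inverse (k z))) \<longlongrightarrow> 1) at_circle" by (simp add: norm_inverse)
    qed
    then have "1 \<le> norm (k z)" using kan(2)[OF z] by (simp add: norm_inverse inverse_le_1_iff)
    ultimately show ?thesis by simp
  qed
  have "k constant_on ball 0 1"
    by (rule maximum_modulus_principle[OF holk, of "ball 0 1" 0]) (auto simp: k1)
  then obtain c where c: "\<And>z. z \<in> ball 0 1 \<Longrightarrow> k z = c" unfolding constant_on_def by blast
  have c1: "norm c = 1" using k1[of 0] c[of 0] by simp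
  show ?thesis
  proof (rule that[of "\<lambda>z. c * A z" "\<lambda>z. 1 * B z"])
    show "blaschke_product (\<Sum>z | z \<in> ball 0 1 \<and> ord z > 0. nat (ord z)) (\<lambda>z. c * A z)"
      using blaschke_product_prod[OF Z c1] unfolding A_def Z_def .
    show "blaschke_product (\<Sum>z | z \<in> ball 0 1 \<and> ord z < 0. nat (- ord z)) (\<lambda>z. 1 * B z)"
      using blaschke_product_prod[OF Q norm_one] unfolding B_def Q_def .
    fix z :: complex assume z: "z \<in> ball 0 1" "ord z \<ge> 0"
    show "g z = c * A z / (1 * B z)"
    proof (cases "ord z = 0")
      case True
      then have "z \<in> ball 0 1 - E" using z by (auto simp: E_def Z_def Q_def)
      moreover from this have "A z \<noteq> 0" "B z \<noteq> 0" unfolding A_def B_def using nzprod[OF Z] nzprod[OF Q] by (auto simp: E_def)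
      moreover have "c = g z * inverse (A z) * B z" using kh[OF calculation(1)] c[OF z(1)] by (simp add: h_def)
      ultimately show ?thesis by simp
    next
      case False
      \<comment> \<open>At a zero of \<open>g\<close> the values of \<open>h\<close> and
        \<open>k\<close> need not agree, so the equation is checked directly: both sides
        vanish.\<close>
      then have zZ: "z \<in> Z" and "ord z > 0" using z by (auto simp: Z_def)
      then have "blaschke_factor z z ^ nat (ord z) = 0" by (simp add: blaschke_factor_def)
      then have "A z = 0" unfolding A_def using zZ Z(1) by (metis (no_types, lifting) prod_zero)
      then show ?thesis using zero[OF z(1) \<open>ord z > 0\<close>] by simp
    qed
  qed
qed

text \<open>Properness: the inverse map is continuous, so it takes the compact \<open>C\<close> to a
  compact subset of the open disk.\<close>

lemma riemann_map_at_circle: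
  assumes \<phi>: "riemann_map \<phi> D" and C: "compact C" "C \<subseteq> D"
  shows "\<forall>\<^sub>F z in at_circle. \<phi> z \<in> D - C"
proof -
  have hol: "\<phi> holomorphic_on ball 0 1" and bij: "bij_betw \<phi> (ball 0 1) D" using \<phi> by (auto simp: riemann_map_def)
  have inj: "inj_on \<phi> (ball 0 1)" and im: "\<phi> ` ball 0 1 = D" using bij by (auto simp: bij_betw_def)
  obtain g where g: "g holomorphic_on (\<phi> ` ball 0 1)" "\<And>z. z \<in> ball 0 1 \<Longrightarrow> g (\<phi> z) = z"
    using holomorphic_has_inverse[OF hol open_ball inj] by metis
  have "continuous_on C g" using g(1) C(2) im holomorphic_on_imp_continuous_on continuous_on_subset by metis
  then have "compact (g ` C)" using C(1) by (rule compact_continuous_image)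
  moreover have "g ` C \<subseteq> ball 0 1" using C(2) g(2) im by force
  ultimately have "\<forall>\<^sub>F z in at_circle. z \<notin> g ` C" by (rule eventually_at_circle_notin)
  with eventually_at_circle_ball show ?thesis
  proof eventually_elim
    case (elim z)
    have "\<phi> z \<notin> C" using elim g(2)[OF elim(1)] by (metis imageI)
    then show ?case using elim im by blast
  qed
qed

section \<open>Transport to the unit disk and the two factorizations\<close>

context jordan_curves
begin

context
  fixes \<phi> assumes \<phi>: "riemann_map \<phi> (inside S)"
begin

lemma riemann_holo: "\<phi> holomorphic_on ball 0 1" and riemann_inj: "inj_on \<phi> (ball 0 1)"
  and riemann_image: "\<phi> ` ball 0 1 = inside S"
  using \<phi> by (auto simp: riemann_map_def bij_betw_def)

lemma riemann_in: "z \<in> ball 0 1 \<Longrightarrow> \<phi> z \<in> inside S"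
  using riemann_image by blast

lemma eventually_riemann_near_S:
  assumes "open U" "S \<subseteq> U"
  shows "\<forall>\<^sub>F z in at_circle. \<phi> z \<in> inside S \<inter> U"
proof -
  have "compact ((inside S \<union> S) - U)" using JS(15) assms(1) by (rule compact_diff)
  moreover have "(inside S \<union> S) - U \<subseteq> inside S" using assms(2) by blast
  ultimately have "\<forall>\<^sub>F z in at_circle. \<phi> z \<in> inside S - ((inside S \<union> S) - U)" by (rule riemann_map_at_circle[OF \<phi>])
  then show ?thesis by eventually_elim blast
qed

lemma has_order_pullback: "z \<in> ball 0 1 \<Longrightarrow> has_order h (\<phi> z) n \<Longrightarrow> has_order (\<lambda>x. h (\<phi> x)) z n"
  using has_order_compose[OF _ riemann_holo open_ball _ riemann_inj] by blast

lemma sum_pullback: "(\<Sum>z | z \<in> ball 0 1 \<and> R (\<phi> z). n (\<phi> z)) = (\<Sum>y | y \<in> inside S \<and> R y. n y)"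
proof -
  have "bij_betw \<phi> {z. z \<in> ball 0 1 \<and> R (\<phi> z)} {y. y \<in> inside S \<and> R y}"
    unfolding bij_betw_def
  proof
    show "inj_on \<phi> {z. z \<in> ball 0 1 \<and> R (\<phi> z)}" using riemann_inj by (rule inj_on_subset) auto
    show "\<phi> ` {z. z \<in> ball 0 1 \<and> R (\<phi> z)} = {y. y \<in> inside S \<and> R y}" unfolding riemann_image[symmetric] by auto
  qed
  then show ?thesis by (rule sum.reindex_bij_betw)
qed

lemma finite_pullback: "finite X \<Longrightarrow> finite {z \<in> ball 0 1. \<phi> z \<in> X}"
  using finite_vimage_IntI[OF _ riemann_inj, of X] by (simp add: vimage_def Int_def conj_commute)

text \<open>\<open>f\<close> has modulus 1 on \<open>S\<close>, and \<open>\<phi>\<close> pushes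
  points near the circle towards \<open>S\<close>. Zeros and poles of the pullback keep their
  orders, so their totals are \<open>N 0\<close> and \<open>Ninf\<close>.\<close>

lemma quotient_on_disk:
  assumes lem: "pseudo_lemniscate f G P \<Gamma> S" and circle: "\<Gamma> = sphere 0 1"
  shows "\<exists>A B. blaschke_product (N 0) A \<and> blaschke_product Ninf B \<and>
    (\<forall>z\<in>ball 0 1. \<phi> z \<notin> P \<longrightarrow> f (\<phi> z) = A z / B z)"
proof -
  note fS = pseudo_lemniscateD[OF lem]
  define ordD where "ordD = (\<lambda>y. if y \<in> P then - int (porder y) else int (pmult y 0))"
  have neg: "ordD y < 0 \<longleftrightarrow> y \<in> P" for y using porder_eq_0_iff[of y] by (auto simp: ordD_def)
  have pos: "ordD y > 0 \<longleftrightarrow> pmult y 0 \<noteq> 0" for y using porder_eq_0_iff[of y] by (auto simp: ordD_def pmult_def)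
  have oD: "has_order f y (ordD y)" if "y \<in> inside S" for y
  proof (cases "y \<in> P")
    case True
    then show ?thesis using pole_order(1)[OF True open_UNIV UNIV_I] by (simp add: ordD_def)
  next
    case False
    then show ?thesis using order_at(1)[of y 0] that DG by (auto simp: ordD_def pmult_def)
  qed
  have val: "f y = 0 \<longleftrightarrow> ordD y > 0" if "y \<in> inside S" "ordD y \<ge> 0" for y
    using that pmult_eq_0_iff[of y 0] DG neg[of y] pos[of y] by auto
  have "finite {y \<in> inside S \<union> S. pmult y 0 \<noteq> 0}" "finite ((inside S \<union> S) \<inter> P)"
    using finite_pmult[OF K] finite_poles[OF K] by auto
  then have fin: "finite {y \<in> inside S. ordD y \<noteq> 0}"
    by (rule finite_subset[rotated, OF finite_UnI]) (auto simp: ordD_def)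
  have lim: "((\<lambda>z. norm (f (\<phi> z))) \<longlongrightarrow> 1) at_circle"
  proof (rule tendstoI)
    fix e :: real assume e: "e > 0"
    define U where "U = {x \<in> G - P. f x \<in> norm -` ball 1 e}"
    have "open U" unfolding U_def by (intro open_preimage open_vimage) (auto intro: continuous_intros)
    moreover have "S \<subseteq> U"
    proof
      fix x assume "x \<in> S"
      moreover from this have "norm (f x) = 1" using fS(1) circle by auto
      ultimately show "x \<in> U" using fS(2) S(2) e by (auto simp: U_def)
    qed
    ultimately have "\<forall>\<^sub>F z in at_circle. \<phi> z \<in> inside S \<inter> U" by (rule eventually_riemann_near_S)
    then show "\<forall>\<^sub>F z in at_circle. dist (norm (f (\<phi> z))) 1 < e"
      by eventually_elim (auto simp: U_def dist_commute)
  qed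
  obtain A B where AB: "blaschke_product (\<Sum>z | z \<in> ball 0 1 \<and> ordD (\<phi> z) > 0. nat (ordD (\<phi> z))) A"
    "blaschke_product (\<Sum>z | z \<in> ball 0 1 \<and> ordD (\<phi> z) < 0. nat (- ordD (\<phi> z))) B"
    "\<And>z. z \<in> ball 0 1 \<Longrightarrow> ordD (\<phi> z) \<ge> 0 \<Longrightarrow> f (\<phi> z) = A z / B z"
  proof (rule quotient_of_blaschke_products[of "\<lambda>z. f (\<phi> z)" "\<lambda>z. ordD (\<phi> z)"])
    show "has_order (\<lambda>x. f (\<phi> x)) z (ordD (\<phi> z))" if "z \<in> ball 0 1" for z
      using has_order_pullback[OF that oD[OF riemann_in[OF that]]] .
    have "{z \<in> ball 0 1. ordD (\<phi> z) \<noteq> 0} = {z \<in> ball 0 1. \<phi> z \<in> {y \<in> inside S. ordD y \<noteq> 0}}"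
      using riemann_in by auto
    then show "finite {z \<in> ball 0 1. ordD (\<phi> z) \<noteq> 0}" using finite_pullback[OF fin] by (simp only:)
    show "(\<lambda>z. f (\<phi> z)) holomorphic_on ball 0 1 - {z. ordD (\<phi> z) < 0}"
    proof (rule holomorphic_on_compose_gen[of \<phi> _ f "G - P", unfolded o_def])
      show "\<phi> holomorphic_on ball 0 1 - {z. ordD (\<phi> z) < 0}" using riemann_holo by (rule holomorphic_on_subset) auto
      show "\<phi> ` (ball 0 1 - {z. ordD (\<phi> z) < 0}) \<subseteq> G - P" using riemann_in DG neg by auto
    qed (fact hol)
    show "f (\<phi> z) = 0" if "z \<in> ball 0 1" "ordD (\<phi> z) > 0" for z using val[OF riemann_in[OF that(1)]] that by simp
  qed (rule lim, rule that)
  have "(\<Sum>z | z \<in> ball 0 1 \<and> ordD (\<phi> z) > 0. nat (ordD (\<phi> z))) = (\<Sum>y | y \<in> inside S \<and> ordD y > 0. nat (ordD y))"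
    by (rule sum_pullback)
  also have "\<dots> = N 0" unfolding N_def pos by (rule sum.cong) (auto simp: ordD_def pmult_def)
  finally have 1: "(\<Sum>z | z \<in> ball 0 1 \<and> ordD (\<phi> z) > 0. nat (ordD (\<phi> z))) = N 0" .
  have "(\<Sum>z | z \<in> ball 0 1 \<and> ordD (\<phi> z) < 0. nat (- ordD (\<phi> z))) = (\<Sum>y | y \<in> inside S \<and> ordD y < 0. nat (- ordD y))"
    by (rule sum_pullback)
  also have "\<dots> = Ninf" unfolding Ninf_def neg porder_eq_0_iff by (rule sum.cong) (auto simp: ordD_def)
  finally have 2: "(\<Sum>z | z \<in> ball 0 1 \<and> ordD (\<phi> z) < 0. nat (- ordD (\<phi> z))) = Ninf" .
  have "f (\<phi> z) = A z / B z" if "z \<in> ball 0 1" "\<phi> z \<notin> P" for z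
    using AB(3)[OF that(1)] that(2) neg[of "\<phi> z"] by simp
  then show ?thesis using AB(1,2) unfolding 1 2 by blast
qed

text \<open>The zeros of the transported function are the solutions of \<open>f = \<psi> 0\<close>,
  with the same multiplicities because the inverse of \<open>\<psi>\<close> has a simple zero at
  \<open>\<psi> 0\<close>; this explains the degree.\<close>

lemma blaschke_on_disk:
  assumes lem: "pseudo_lemniscate f G P \<Gamma> S" and nopole: "P \<inter> inside S = {}"
    and into: "f ` inside S \<subseteq> inside \<Gamma>" and \<psi>: "riemann_map \<psi> (inside \<Gamma>)"
  shows "blaschke_product (N (\<psi> 0)) (\<lambda>z. inv_into (ball 0 1) \<psi> (f (\<phi> z)))"
proof -
  note fS = pseudo_lemniscateD[OF lem]
  define \<psi>i where "\<psi>i = inv_into (ball 0 1) \<psi>"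
  have hol\<psi>: "\<psi> holomorphic_on ball 0 1" and inj\<psi>: "inj_on \<psi> (ball 0 1)" and im\<psi>: "\<psi> ` ball 0 1 = inside \<Gamma>"
    using \<psi> by (auto simp: riemann_map_def bij_betw_def)
  obtain g where g: "g holomorphic_on (\<psi> ` ball 0 1)" "\<And>z. z \<in> ball 0 1 \<Longrightarrow> g (\<psi> z) = z"
    using holomorphic_has_inverse[OF hol\<psi> open_ball inj\<psi>] by metis
  have \<psi>i: "\<psi>i (\<psi> z) = z" if "z \<in> ball 0 1" for z using inv_into_f_f[OF inj\<psi> that] by (simp add: \<psi>i_def)
  have "g y = \<psi>i y" if "y \<in> inside \<Gamma>" for y using that g(2) \<psi>i im\<psi> by force
  then have hol\<psi>i: "\<psi>i holomorphic_on inside \<Gamma>" using g(1) unfolding im\<psi> by (rule holomorphic_transform[rotated])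
  have \<psi>i_in: "\<psi>i y \<in> ball 0 1" "\<psi> (\<psi>i y) = y" if "y \<in> inside \<Gamma>" for y using that \<psi>i im\<psi> by force+
  have inj\<psi>i: "inj_on \<psi>i (inside \<Gamma>)" using \<psi>i_in(2) by (metis inj_on_def)
  define w1 where "w1 = \<psi> 0"
  have w1: "w1 \<in> inside \<Gamma>" using im\<psi> by (auto simp: w1_def)
  have \<psi>iw1: "\<psi>i w1 = 0" using \<psi>i[of 0] by (simp add: w1_def)
  \<comment> \<open>Difference quotient of \<open>\<psi>i\<close> at \<open>w1\<close>, filled in by
    the derivative. It is zero-free by injectivity, so \<open>\<psi>i (f x)\<close> is
    \<open>f x - w1\<close> times a unit.\<close>
  define k where "k = (\<lambda>y. if y = w1 then deriv \<psi>i w1 else (\<psi>i y - \<psi>i w1) / (y - w1))"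
  have holk: "k holomorphic_on inside \<Gamma>" unfolding k_def using hol\<psi>i J\<Gamma>(5) by (rule pole_lemma_open)
  have k0: "k y \<noteq> 0" if "y \<in> inside \<Gamma>" for y
  proof (cases "y = w1")
    case True
    then show ?thesis using holomorphic_injective_imp_regular[OF hol\<psi>i J\<Gamma>(5) inj\<psi>i w1] by (simp add: k_def)
  next
    case False
    then have "\<psi>i y \<noteq> \<psi>i w1" using inj_onD[OF inj\<psi>i _ that w1] by blast
    then show ?thesis using False by (simp add: k_def)
  qed
  have fact: "(f x - w1) * k (f x) = \<psi>i (f x)" for x by (simp add: k_def \<psi>iw1)
  define ordD where "ordD = (\<lambda>y. int (pmult y w1))"
  have ndP: "y \<in> G - P" if "y \<in> inside S" for y using that DG nopole by blast
  have oD: "has_order (\<lambda>x. \<psi>i (f x)) y (ordD y)" if y: "y \<in> inside S" for y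
  proof -
    have "has_order (\<lambda>x. f x - w1) y (ordD y)" using order_at(1)[OF ndP[OF y], of w1] ndP[OF y] by (simp add: ordD_def pmult_def)
    moreover have "has_order (\<lambda>x. k (f x)) y 0"
    proof (rule has_order_analytic)
      have "(\<lambda>x. k (f x)) holomorphic_on inside S"
        using holk into hol ndP by (intro holomorphic_on_compose_gen[of f _ k "inside \<Gamma>", unfolded o_def])
          (auto intro: holomorphic_on_subset)
      then show "(\<lambda>x. k (f x)) analytic_on {y}" using JS(5) y analytic_at by blast
      show "k (f y) \<noteq> 0" using k0 into y by blast
    qed
    ultimately have "has_order (\<lambda>x. (f x - w1) * k (f x)) y (ordD y + 0)" by (rule has_order_mult)
    then show ?thesis unfolding fact by simp
  qed
  have val: "\<psi>i (f y) = 0 \<longleftrightarrow> ordD y > 0" if y: "y \<in> inside S" for y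
  proof -
    have "\<psi>i (f y) = 0 \<longleftrightarrow> f y = w1" using inj_onD[OF inj\<psi>i, of "f y" w1] into y w1 \<psi>iw1 by auto
    moreover have "ordD y > 0 \<longleftrightarrow> f y = w1" using pmult_pos_iff[of y w1] ndP[OF y] by (auto simp: ordD_def)
    ultimately show ?thesis by blast
  qed
  have fin: "finite {y \<in> inside S. ordD y \<noteq> 0}"
    by (rule finite_subset[OF _ finite_pmult[OF K, of w1]]) (auto simp: ordD_def)
  have lim: "((\<lambda>z. norm (\<psi>i (f (\<phi> z)))) \<longlongrightarrow> 1) at_circle"
  proof (rule tendstoI)
    fix e :: real assume e: "e > 0"
    \<comment> \<open>A compact part of \<open>inside \<Gamma>\<close>. As \<open>f\<close> maps
      \<open>S\<close> into \<open>\<Gamma>\<close>, values near \<open>S\<close> avoid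
      \<open>C\<close>, hence \<open>\<psi>i\<close> of them has modulus above
      \<open>1 - e\<close>.\<close>
    define C where "C = \<psi> ` cball 0 (1 - e)"
    have cb: "cball 0 (1 - e) \<subseteq> ball (0::complex) 1" using e by auto
    have "compact C" unfolding C_def
      using holomorphic_on_imp_continuous_on[OF hol\<psi>] cb by (intro compact_continuous_image) (auto intro: continuous_on_subset)
    then have "open (- C)" using compact_imp_closed by blast
    define U where "U = {x \<in> G - P. f x \<in> - C}"
    have "open U" unfolding U_def using \<open>open (- C)\<close> by (rule open_preimage)
    moreover have "S \<subseteq> U"
    proof
      fix x assume x: "x \<in> S"
      have "C \<subseteq> inside \<Gamma>" using cb im\<psi> by (auto simp: C_def)
      moreover have "f x \<notin> inside \<Gamma>" using fS(1) x J\<Gamma>(16) by blast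
      ultimately show "x \<in> U" using fS(2) S(2) x by (auto simp: U_def)
    qed
    ultimately have "\<forall>\<^sub>F z in at_circle. \<phi> z \<in> inside S \<inter> U" by (rule eventually_riemann_near_S)
    then show "\<forall>\<^sub>F z in at_circle. dist (norm (\<psi>i (f (\<phi> z)))) 1 < e"
    proof eventually_elim
      case (elim z)
      then have y: "f (\<phi> z) \<in> inside \<Gamma>" "f (\<phi> z) \<notin> C" using into by (auto simp: U_def)
      have "\<psi>i (f (\<phi> z)) \<notin> cball 0 (1 - e)" using y \<psi>i_in(2)[OF y(1)] unfolding C_def by (metis imageI)
      then show ?case using \<psi>i_in(1)[OF y(1)] by (auto simp: dist_real_def)
    qed
  qed
  obtain A B where AB: "blaschke_product (\<Sum>z | z \<in> ball 0 1 \<and> ordD (\<phi> z) > 0. nat (ordD (\<phi> z))) A"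
    "blaschke_product (\<Sum>z | z \<in> ball 0 1 \<and> ordD (\<phi> z) < 0. nat (- ordD (\<phi> z))) B"
    "\<And>z. z \<in> ball 0 1 \<Longrightarrow> ordD (\<phi> z) \<ge> 0 \<Longrightarrow> \<psi>i (f (\<phi> z)) = A z / B z"
  proof (rule quotient_of_blaschke_products[of "\<lambda>z. \<psi>i (f (\<phi> z))" "\<lambda>z. ordD (\<phi> z)"])
    show "has_order (\<lambda>x. \<psi>i (f (\<phi> x))) z (ordD (\<phi> z))" if "z \<in> ball 0 1" for z
      using has_order_pullback[OF that oD[OF riemann_in[OF that]]] .
    have "{z \<in> ball 0 1. ordD (\<phi> z) \<noteq> 0} = {z \<in> ball 0 1. \<phi> z \<in> {y \<in> inside S. ordD y \<noteq> 0}}"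
      using riemann_in by auto
    then show "finite {z \<in> ball 0 1. ordD (\<phi> z) \<noteq> 0}" using finite_pullback[OF fin] by (simp only:)
    have "(\<lambda>x. \<psi>i (f x)) holomorphic_on inside S"
      using hol\<psi>i into hol ndP by (intro holomorphic_on_compose_gen[of f _ \<psi>i "inside \<Gamma>", unfolded o_def])
        (auto intro: holomorphic_on_subset)
    then have "(\<lambda>z. \<psi>i (f (\<phi> z))) holomorphic_on ball 0 1"
      using riemann_holo riemann_image by (intro holomorphic_on_compose_gen[of \<phi> _ "\<lambda>x. \<psi>i (f x)" "inside S", unfolded o_def]) auto
    then show "(\<lambda>z. \<psi>i (f (\<phi> z))) holomorphic_on ball 0 1 - {z. ordD (\<phi> z) < 0}" by (rule holomorphic_on_subset) auto
    show "\<psi>i (f (\<phi> z)) = 0" if "z \<in> ball 0 1" "ordD (\<phi> z) > 0" for z using val[OF riemann_in[OF that(1)]] that by simp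
  qed (rule lim, rule that)
  have "(\<Sum>z | z \<in> ball 0 1 \<and> ordD (\<phi> z) > 0. nat (ordD (\<phi> z))) = (\<Sum>y | y \<in> inside S \<and> ordD y > 0. nat (ordD y))"
    by (rule sum_pullback)
  also have "\<dots> = N w1" unfolding N_def by (rule sum.cong) (auto simp: ordD_def)
  finally have 1: "(\<Sum>z | z \<in> ball 0 1 \<and> ordD (\<phi> z) > 0. nat (ordD (\<phi> z))) = N w1" .
  \<comment> \<open>\<open>ordD\<close> is never negative here, so the denominator is a unimodular
    constant that can be absorbed.\<close>
  have "blaschke_product 0 B" using AB(2) by (simp add: ordD_def)
  then have "blaschke_product (N w1) (\<lambda>z. \<psi>i (f (\<phi> z)))"
    by (rule blaschke_product_divide[OF AB(1)[unfolded 1]]) (simp add: AB(3) ordD_def)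
  then show ?thesis unfolding w1_def \<psi>i_def .
qed

end

end

theorem theorem1p2:
  fixes G S \<Gamma> P :: "complex set" and f :: "complex \<Rightarrow> complex"
  assumes G: "open G" "connected G" "simply_connected G"
    and S: "smooth_jordan_curve S" "S \<subseteq> G"
    and \<Gamma>: "smooth_jordan_curve \<Gamma>"
    and f: "meromorphic_with_poles f G P"
  shows
   "(pseudo_lemniscate f G P \<Gamma> S \<longleftrightarrow>
       (\<exists>nm np :: nat.
          (\<forall>w\<in>inside \<Gamma>. count_preimages f P (inside S) w = enat nm) \<and>
          (\<forall>w\<in>outside \<Gamma>. count_preimages f P (inside S) w = enat np) \<and>
          count_poles f P (inside S) = enat np \<and>
          (\<forall>w\<in>\<Gamma>. count_preimages f P (inside S) w = enat (min nm np))))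
    \<and>
    (\<forall>nm np :: nat.
       pseudo_lemniscate f G P \<Gamma> S \<and>
       (\<forall>w\<in>inside \<Gamma>. count_preimages f P (inside S) w = enat nm) \<and>
       (\<forall>w\<in>outside \<Gamma>. count_preimages f P (inside S) w = enat np) \<and>
       count_poles f P (inside S) = enat np \<and>
       (\<forall>w\<in>\<Gamma>. count_preimages f P (inside S) w = enat (min nm np)) \<longrightarrow>
       (P \<inter> inside S = {} \<longrightarrow>
          np = 0 \<and>
          (\<forall>\<phi> \<psi>. riemann_map \<phi> (inside S) \<and> riemann_map \<psi> (inside \<Gamma>) \<longrightarrow>
             blaschke_product nm (\<lambda>z. inv_into (ball 0 1) \<psi> (f (\<phi> z))))) \<and>
       (\<Gamma> = sphere 0 1 \<longrightarrow>
          (\<forall>\<phi>. riemann_map \<phi> (inside S) \<longrightarrow>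
             (\<exists>A B. blaschke_product nm A \<and> blaschke_product np B \<and>
                (\<forall>z\<in>ball 0 1. \<phi> z \<notin> P \<longrightarrow> f (\<phi> z) = A z / B z)))))"
proof -
  note J\<Gamma> = smooth_jordan_curve_facts[OF \<Gamma>]
  have loc: "jordan_curves f G P S \<Gamma>" if "\<not> f constant_on (G - P)"
    by unfold_locales (use G S \<Gamma> f that in auto)
  have 1: "\<exists>nm np :: nat.
          (\<forall>w\<in>inside \<Gamma>. count_preimages f P (inside S) w = enat nm) \<and>
          (\<forall>w\<in>outside \<Gamma>. count_preimages f P (inside S) w = enat np) \<and>
          count_poles f P (inside S) = enat np \<and>
          (\<forall>w\<in>\<Gamma>. count_preimages f P (inside S) w = enat (min nm np))"
    if lem: "pseudo_lemniscate f G P \<Gamma> S"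
  proof -
    interpret jordan_curves f G P S \<Gamma>
      using loc pseudo_lemniscate_imp_nonconstant[OF G(1,2) S(1) f lem] by blast
    obtain nm np where n: "\<And>w. w \<in> inside \<Gamma> \<Longrightarrow> N w = nm" "\<And>w. w \<in> outside \<Gamma> \<Longrightarrow> N w = np" "Ninf = np"
      "\<And>w. w \<in> \<Gamma> \<Longrightarrow> N w = min nm np"
      by (rule pseudo_lemniscate_imp_counts[OF lem], rule that; assumption)
    show ?thesis unfolding count_preimages_eq count_poles_eq
      by (rule exI[of _ nm], rule exI[of _ np]) (simp add: n)
  qed
  have 2: "pseudo_lemniscate f G P \<Gamma> S"
    if n: "\<forall>w\<in>inside \<Gamma>. count_preimages f P (inside S) w = enat nm"
          "\<forall>w\<in>outside \<Gamma>. count_preimages f P (inside S) w = enat np"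
          "count_poles f P (inside S) = enat np"
          "\<forall>w\<in>\<Gamma>. count_preimages f P (inside S) w = enat (min nm np)" for nm np :: nat
  proof -
    have "count_preimages f P (inside S) w \<noteq> \<infinity>" for w
    proof -
      have "w \<in> inside \<Gamma> \<or> w \<in> outside \<Gamma> \<or> w \<in> \<Gamma>" using J\<Gamma>(11) by blast
      then show ?thesis using n by auto
    qed
    moreover have "inside S \<union> S \<subseteq> G"
      using subset_simply_connected_imp_inside_subset[OF G(3,1) S(2)] S(2) by blast
    ultimately interpret jordan_curves f G P S \<Gamma>
      using loc finite_counts_imp_nonconstant[OF G(1,2) S(1) _ f] by blast
    show ?thesis
      by (rule counts_imp_pseudo_lemniscate[of nm np])
         (use n in \<open>simp_all add: count_preimages_eq count_poles_eq\<close>)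
  qed
  have 3: "(P \<inter> inside S = {} \<longrightarrow>
          np = 0 \<and>
          (\<forall>\<phi> \<psi>. riemann_map \<phi> (inside S) \<and> riemann_map \<psi> (inside \<Gamma>) \<longrightarrow>
             blaschke_product nm (\<lambda>z. inv_into (ball 0 1) \<psi> (f (\<phi> z))))) \<and>
       (\<Gamma> = sphere 0 1 \<longrightarrow>
          (\<forall>\<phi>. riemann_map \<phi> (inside S) \<longrightarrow>
             (\<exists>A B. blaschke_product nm A \<and> blaschke_product np B \<and>
                (\<forall>z\<in>ball 0 1. \<phi> z \<notin> P \<longrightarrow> f (\<phi> z) = A z / B z))))"
    if lem: "pseudo_lemniscate f G P \<Gamma> S"
      and n: "\<forall>w\<in>inside \<Gamma>. count_preimages f P (inside S) w = enat nm"
          "\<forall>w\<in>outside \<Gamma>. count_preimages f P (inside S) w = enat np"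
          "count_poles f P (inside S) = enat np"
          "\<forall>w\<in>\<Gamma>. count_preimages f P (inside S) w = enat (min nm np)" for nm np :: nat
  proof -
    interpret jordan_curves f G P S \<Gamma>
      using loc pseudo_lemniscate_imp_nonconstant[OF G(1,2) S(1) f lem] by blast
    have N: "\<And>w. w \<in> inside \<Gamma> \<Longrightarrow> N w = nm" "\<And>w. w \<in> outside \<Gamma> \<Longrightarrow> N w = np" "Ninf = np"
      "\<And>w. w \<in> \<Gamma> \<Longrightarrow> N w = min nm np"
      using n by (simp_all add: count_preimages_eq count_poles_eq)
    show ?thesis
    proof (intro conjI impI allI)
      assume np: "P \<inter> inside S = {}"
      then have "count_poles f P (inside S) = 0" by (simp add: count_poles_def)
      then show np0: "np = 0" using n(3) by (simp add: zero_enat_def)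
      \<comment> \<open>With \<open>np = 0\<close> the minimum is 0 too, so values on
        \<open>\<Gamma>\<close> are missed just as those outside.\<close>
      have into: "f ` inside S \<subseteq> inside \<Gamma>"
      proof (clarify, rule ccontr)
        fix y assume y: "y \<in> inside S" "f y \<notin> inside \<Gamma>"
        then have "f y \<in> outside \<Gamma> \<or> f y \<in> \<Gamma>" using J\<Gamma>(11) by blast
        then have "N (f y) = 0" using N(2)[of "f y"] N(4)[of "f y"] np0 by auto
        moreover have "finite {x. x \<in> inside S \<and> pmult x (f y) \<noteq> 0}"
          by (rule finite_subset[OF _ finite_pmult[OF K, of "f y"]]) auto
        ultimately have "pmult y (f y) = 0" using y(1) unfolding N_def by auto
        then show False using pmult_eq_0_iff[of y "f y"] y(1) DG np by auto
      qed
      fix \<phi> \<psi> assume r: "riemann_map \<phi> (inside S) \<and> riemann_map \<psi> (inside \<Gamma>)"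
      have "\<psi> 0 \<in> inside \<Gamma>" using r by (auto simp: riemann_map_def bij_betw_def)
      then show "blaschke_product nm (\<lambda>z. inv_into (ball 0 1) \<psi> (f (\<phi> z)))"
        using blaschke_on_disk[OF conjunct1[OF r] lem np into conjunct2[OF r]] N(1) by simp
    next
      fix \<phi> assume c: "\<Gamma> = sphere 0 1" and r: "riemann_map \<phi> (inside S)"
      have "inside \<Gamma> = ball 0 1" unfolding c
        using inside_frontier_eq_interior[of "cball (0::complex) 1"] by simp
      then have "N 0 = nm" using N(1)[of 0] by simp
      then show "\<exists>A B. blaschke_product nm A \<and> blaschke_product np B \<and>
                (\<forall>z\<in>ball 0 1. \<phi> z \<notin> P \<longrightarrow> f (\<phi> z) = A z / B z)"
        using quotient_on_disk[OF r lem c] N(3) by simp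
    qed
  qed
  show ?thesis
  proof (rule conjI, rule iffI)
    assume "\<exists>nm np :: nat.
          (\<forall>w\<in>inside \<Gamma>. count_preimages f P (inside S) w = enat nm) \<and>
          (\<forall>w\<in>outside \<Gamma>. count_preimages f P (inside S) w = enat np) \<and>
          count_poles f P (inside S) = enat np \<and>
          (\<forall>w\<in>\<Gamma>. count_preimages f P (inside S) w = enat (min nm np))"
    then show "pseudo_lemniscate f G P \<Gamma> S" by (elim exE conjE) (rule 2)
  qed (rule 1, assumption, intro allI impI, elim conjE, rule 3)
qed

end
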